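(* Let $n$ be a positive integer, let $\mathcal{A}$ be an abelian category and let $\mathcal{M}$ be an $n$-cluster-tilting subcategory of $\mathcal{A}$. Then $\mathcal{M}$ is an $n$-abelian category.
   Context: Subcategories are full. Composition is written left to right: for $f\colon A\to B$ and $g\colon B\to C$ the composite $A\to C$ is $fg$. **Functorially finite.** A subcategory $\mathcal{D}$ of an additive category $\mathcal{C}$ is covariantly finite if for every $C\in\mathcal{C}$ there is a morphism $f\colon C\to D$ with $D\in\mathcal{D}$ such that every morphism $C\to D'$ with $D'\in\mathcal{D}$ factors through $f$ (such $f$ is a left $\mathcal{D}$-approximation of $C$). Contravariantly finite and right approximations are defined dually; functorially finite means both. **$n$-cluster-tilting subcategory of an abelian category.** A subcategory $\mathcal{M}$ of $\mathcal{A}$ is cogenerating if every $X\in\mathcal{A}$ admits a monomorphism $X\to Y$ with $Y\in\mathcal{M}$; generating is dual. A generating-cogenerating subcategory $\mathcal{M}$ of $\mathcal{A}$ is $n$-cluster-tilting if it is functorially finite in $\mathcal{A}$ and $$\mathcal{M}=\{X\in\mathcal{A}\mid \operatorname{Ext}^i_{\mathcal{A}}(X,\mathcal{M})=0\ \forall\, 1\le i\le n-1\}=\{X\in\mathcal{A}\mid \operatorname{Ext}^i_{\mathcal{A}}(\mathcal{M},X)=0\ \forall\, 1\le i\le n-1\}.$$ **$n$-cokernels, $n$-kernels, $n$-exact sequences.** In an additive category $\mathcal{C}$, an $n$-cokernel of $d^0\colon X^0\to X^1$ is a sequence $(d^1,\dots,d^n)$, $X^1\xrightarrow{d^1}X^2\to\cdots\xrightarrow{d^n}X^{n+1}$,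 such that for all $Y\in\mathcal{C}$ the induced sequence $0\to\mathcal{C}(X^{n+1},Y)\to\mathcal{C}(X^n,Y)\to\cdots\to\mathcal{C}(X^1,Y)\to\mathcal{C}(X^0,Y)$ is exact. Dually, an $n$-kernel of $d^n\colon X^n\to X^{n+1}$ is a sequence $(d^0,\dots,d^{n-1})$, $X^0\to\cdots\to X^n$, such that $0\to\mathcal{C}(Y,X^0)\to\cdots\to\mathcal{C}(Y,X^n)\to\mathcal{C}(Y,X^{n+1})$ is exact for all $Y$. An $n$-exact sequence is a complex $X^0\xrightarrow{d^0}X^1\to\cdots\to X^n\xrightarrow{d^n}X^{n+1}$ such that $(d^0,\dots,d^{n-1})$ is an $n$-kernel of $d^n$ and $(d^1,\dots,d^n)$ is an $n$-cokernel of $d^0$. **$n$-abelian category.** An additive category $\mathcal{M}$ such that: (A0) $\mathcal{M}$ is idempotent complete; (A1) every morphism in $\mathcal{M}$ has an $n$-kernel and an $n$-cokernel; (A2) for every monomorphism $f^0\colon X^0\to X^1$ in $\mathcal{M}$ and every $n$-cokernel $(f^1,\dots,f^n)$ of $f^0$, the sequence $(f^0,f^1,\dots,f^n)$ is $n$-exact; (A2$^{\mathrm{op}}$) for every epimorphism $g^n\colon X^n\to X^{n+1}$ in $\mathcal{M}$ and every $n$-kernel $(g^0,\dots,g^{n-1})$ of $g^n$, the sequence $(g^0,\dots,g^n)$ is $n$-exact. *)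

theory Defs
  imports "HOL-Algebra.Exact_Sequence"
begin

section \<open>Additive categories\<close>

text \<open>
  A category is given by sets of objects and arrows; the operations are only meaningful where
  they are defined.  The arrows \<open>X \<rightarrow> Y\<close> carry the addition \<open>Add\<close> and the zero \<open>Zero X Y\<close>.
  Composition is written from left to right: \<open>Comp C f g\<close> is \<open>f\<close> followed by \<open>g\<close>.
\<close>

record ('o, 'm) addcat =
  Ob :: "'o set"
  Arr :: "'m set"
  Dom :: "'m \<Rightarrow> 'o"
  Cod :: "'m \<Rightarrow> 'o"
  Idn :: "'o \<Rightarrow> 'm"
  Comp :: "'m \<Rightarrow> 'm \<Rightarrow> 'm"  (infixl \<open>\<cdot>\<index>\<close> 70)
  Add :: "'m \<Rightarrow> 'm \<Rightarrow> 'm"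
  Zero :: "'o \<Rightarrow> 'o \<Rightarrow> 'm"

definition Hom :: "('o, 'm) addcat \<Rightarrow> 'o \<Rightarrow> 'o \<Rightarrow> 'm set" where
  "Hom C X Y = {f \<in> Arr C. Dom C f = X \<and> Cod C f = Y}"

definition hom_group :: "('o, 'm) addcat \<Rightarrow> 'o \<Rightarrow> 'o \<Rightarrow> 'm monoid" where
  "hom_group C X Y = \<lparr>carrier = Hom C X Y, monoid.mult = Add C, one = Zero C X Y\<rparr>"

locale category =
  fixes C :: "('o, 'm) addcat" (structure)
  assumes Dom_Ob: "f \<in> Arr C \<Longrightarrow> Dom C f \<in> Ob C"
    and Cod_Ob: "f \<in> Arr C \<Longrightarrow> Cod C f \<in> Ob C"
    and Idn_Hom: "X \<in> Ob C \<Longrightarrow> Idn C X \<in> Hom C X X"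
    and Comp_Hom: "\<lbrakk>f \<in> Hom C X Y; g \<in> Hom C Y Z\<rbrakk> \<Longrightarrow> f \<cdot> g \<in> Hom C X Z"
    and Idn_Comp: "f \<in> Hom C X Y \<Longrightarrow> Idn C X \<cdot> f = f"
    and Comp_Idn: "f \<in> Hom C X Y \<Longrightarrow> f \<cdot> Idn C Y = f"
    and Comp_assoc:
      "\<lbrakk>f \<in> Hom C W X; g \<in> Hom C X Y; h \<in> Hom C Y Z\<rbrakk> \<Longrightarrow> (f \<cdot> g) \<cdot> h = f \<cdot> (g \<cdot> h)"

locale preadditive_category = category +
  assumes hom_comm_group: "\<lbrakk>X \<in> Ob C; Y \<in> Ob C\<rbrakk> \<Longrightarrow> comm_group (hom_group C X Y)"
    and Comp_Add:
      "\<lbrakk>f \<in> Hom C X Y; g \<in> Hom C Y Z; h \<in> Hom C Y Z\<rbrakk> \<Longrightarrow> f \<cdot> Add C g h = Add C (f \<cdot> g) (f \<cdot> h)"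
    and Add_Comp:
      "\<lbrakk>f \<in> Hom C X Y; g \<in> Hom C X Y; h \<in> Hom C Y Z\<rbrakk> \<Longrightarrow> Add C f g \<cdot> h = Add C (f \<cdot> h) (g \<cdot> h)"

definition zero_object :: "('o, 'm) addcat \<Rightarrow> 'o \<Rightarrow> bool" where
  "zero_object C Z \<longleftrightarrow> Z \<in> Ob C \<and>
     (\<forall>X\<in>Ob C. (\<exists>!f. f \<in> Hom C X Z) \<and> (\<exists>!f. f \<in> Hom C Z X))"

definition biproduct ::
    "('o, 'm) addcat \<Rightarrow> 'o \<Rightarrow> 'o \<Rightarrow> 'o \<Rightarrow> 'm \<Rightarrow> 'm \<Rightarrow> 'm \<Rightarrow> 'm \<Rightarrow> bool" where
  "biproduct C X Y P i1 i2 p1 p2 \<longleftrightarrow>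
     i1 \<in> Hom C X P \<and> i2 \<in> Hom C Y P \<and> p1 \<in> Hom C P X \<and> p2 \<in> Hom C P Y \<and>
     i1 \<cdot>\<^bsub>C\<^esub> p1 = Idn C X \<and> i2 \<cdot>\<^bsub>C\<^esub> p2 = Idn C Y \<and>
     i1 \<cdot>\<^bsub>C\<^esub> p2 = Zero C X Y \<and> i2 \<cdot>\<^bsub>C\<^esub> p1 = Zero C Y X \<and>
     Add C (p1 \<cdot>\<^bsub>C\<^esub> i1) (p2 \<cdot>\<^bsub>C\<^esub> i2) = Idn C P"

locale additive_category = preadditive_category +
  assumes ex_zero_object: "\<exists>Z. zero_object C Z"
    and ex_biproduct: "\<lbrakk>X \<in> Ob C; Y \<in> Ob C\<rbrakk> \<Longrightarrow> \<exists>P i1 i2 p1 p2. biproduct C X Y P i1 i2 p1 p2"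

definition full_subcat :: "('o, 'm) addcat \<Rightarrow> 'o set \<Rightarrow> ('o, 'm) addcat" where
  "full_subcat C M = C\<lparr>Ob := M, Arr := {f \<in> Arr C. Dom C f \<in> M \<and> Cod C f \<in> M}\<rparr>"

definition idempotent_complete :: "('o, 'm) addcat \<Rightarrow> bool" where
  "idempotent_complete C \<longleftrightarrow>
     (\<forall>X\<in>Ob C. \<forall>e\<in>Hom C X X. e \<cdot>\<^bsub>C\<^esub> e = e \<longrightarrow>
        (\<exists>Y\<in>Ob C. \<exists>r\<in>Hom C X Y. \<exists>s\<in>Hom C Y X. r \<cdot>\<^bsub>C\<^esub> s = e \<and> s \<cdot>\<^bsub>C\<^esub> r = Idn C Y))"


section \<open>Abelian categories\<close>

definition is_mono :: "('o, 'm) addcat \<Rightarrow> 'm \<Rightarrow> bool" where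
  "is_mono C f \<longleftrightarrow> f \<in> Arr C \<and>
     (\<forall>W\<in>Ob C. \<forall>g\<in>Hom C W (Dom C f). \<forall>h\<in>Hom C W (Dom C f). g \<cdot>\<^bsub>C\<^esub> f = h \<cdot>\<^bsub>C\<^esub> f \<longrightarrow> g = h)"

definition is_epi :: "('o, 'm) addcat \<Rightarrow> 'm \<Rightarrow> bool" where
  "is_epi C f \<longleftrightarrow> f \<in> Arr C \<and>
     (\<forall>W\<in>Ob C. \<forall>g\<in>Hom C (Cod C f) W. \<forall>h\<in>Hom C (Cod C f) W. f \<cdot>\<^bsub>C\<^esub> g = f \<cdot>\<^bsub>C\<^esub> h \<longrightarrow> g = h)"

definition is_kernel :: "('o, 'm) addcat \<Rightarrow> 'm \<Rightarrow> 'm \<Rightarrow> bool" where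
  "is_kernel C f k \<longleftrightarrow> f \<in> Arr C \<and> k \<in> Arr C \<and> Cod C k = Dom C f \<and>
     k \<cdot>\<^bsub>C\<^esub> f = Zero C (Dom C k) (Cod C f) \<and>
     (\<forall>W\<in>Ob C. \<forall>g\<in>Hom C W (Dom C f). g \<cdot>\<^bsub>C\<^esub> f = Zero C W (Cod C f) \<longrightarrow>
        (\<exists>!h. h \<in> Hom C W (Dom C k) \<and> h \<cdot>\<^bsub>C\<^esub> k = g))"

definition is_cokernel :: "('o, 'm) addcat \<Rightarrow> 'm \<Rightarrow> 'm \<Rightarrow> bool" where
  "is_cokernel C f c \<longleftrightarrow> f \<in> Arr C \<and> c \<in> Arr C \<and> Dom C c = Cod C f \<and>
     f \<cdot>\<^bsub>C\<^esub> c = Zero C (Dom C f) (Cod C c) \<and>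
     (\<forall>W\<in>Ob C. \<forall>g\<in>Hom C (Cod C f) W. f \<cdot>\<^bsub>C\<^esub> g = Zero C (Dom C f) W \<longrightarrow>
        (\<exists>!h. h \<in> Hom C (Cod C c) W \<and> c \<cdot>\<^bsub>C\<^esub> h = g))"

locale abelian_category = additive_category +
  assumes ex_kernel: "f \<in> Arr C \<Longrightarrow> \<exists>k. is_kernel C f k"
    and ex_cokernel: "f \<in> Arr C \<Longrightarrow> \<exists>c. is_cokernel C f c"
    and mono_kernel: "is_mono C f \<Longrightarrow> \<exists>g. is_kernel C g f"
    and epi_cokernel: "is_epi C f \<Longrightarrow> \<exists>g. is_cokernel C g f"


section \<open>Yoneda extension groups\<close>

text \<open>Exactness of \<open>f\<close>, \<open>g\<close> at the middle object: the image of \<open>f\<close> (the kernel of a cokernel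
  of \<open>f\<close>) is a kernel of \<open>g\<close>.\<close>

definition exact_pair :: "('o, 'm) addcat \<Rightarrow> 'm \<Rightarrow> 'm \<Rightarrow> bool" where
  "exact_pair C f g \<longleftrightarrow> Cod C f = Dom C g \<and>
     (\<exists>c k. is_cokernel C f c \<and> is_kernel C c k \<and> is_kernel C g k)"

text \<open>\<open>extensions C i X Y\<close> consists of the exact sequences
  \<open>0 \<rightarrow> Y \<rightarrow> E\<^sub>1 \<rightarrow> \<dots> \<rightarrow> E\<^sub>i \<rightarrow> X \<rightarrow> 0\<close>, represented by the list of the \<open>i + 1\<close> arrows from \<open>Y\<close> to \<open>X\<close>.\<close>

definition extensions :: "('o, 'm) addcat \<Rightarrow> nat \<Rightarrow> 'o \<Rightarrow> 'o \<Rightarrow> 'm list set" where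
  "extensions C i X Y = {ds. length ds = i + 1 \<and>
     is_mono C (ds ! 0) \<and> Dom C (ds ! 0) = Y \<and>
     is_epi C (ds ! i) \<and> Cod C (ds ! i) = X \<and>
     (\<forall>j<i. exact_pair C (ds ! j) (ds ! (j + 1)))}"

text \<open>A morphism of extensions is a commutative ladder whose two outer vertical arrows are
  identities.\<close>

definition extension_morphism ::
    "('o, 'm) addcat \<Rightarrow> nat \<Rightarrow> 'o \<Rightarrow> 'o \<Rightarrow> 'm list \<Rightarrow> 'm list \<Rightarrow> 'm list \<Rightarrow> bool" where
  "extension_morphism C i X Y ds es fs \<longleftrightarrow>
     ds \<in> extensions C i X Y \<and> es \<in> extensions C i X Y \<and>
     length fs = i + 2 \<and> fs ! 0 = Idn C Y \<and> fs ! (i + 1) = Idn C X \<and>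
     (\<forall>j\<le>i. fs ! j \<in> Hom C (Dom C (ds ! j)) (Dom C (es ! j)) \<and>
            fs ! (j + 1) \<in> Hom C (Cod C (ds ! j)) (Cod C (es ! j)) \<and>
            ds ! j \<cdot>\<^bsub>C\<^esub> fs ! (j + 1) = fs ! j \<cdot>\<^bsub>C\<^esub> es ! j)"

definition extension_equiv :: "('o, 'm) addcat \<Rightarrow> nat \<Rightarrow> 'o \<Rightarrow> 'o \<Rightarrow> 'm list rel" where
  "extension_equiv C i X Y = {(ds, es). ds \<in> extensions C i X Y \<and> es \<in> extensions C i X Y \<and>
     equivclp (\<lambda>ds es. \<exists>fs. extension_morphism C i X Y ds es fs) ds es}"

definition Ext :: "('o, 'm) addcat \<Rightarrow> nat \<Rightarrow> 'o \<Rightarrow> 'o \<Rightarrow> 'm list set set" where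
  "Ext C i X Y = extensions C i X Y // extension_equiv C i X Y"

text \<open>For \<open>i \<ge> 1\<close> the set \<open>Ext C i X Y\<close> is the underlying set of the Yoneda extension group (no
  projective or injective objects are needed).  A group is zero iff it has exactly one element, so
  its vanishing can be stated without the Baer sum.\<close>

definition Ext_vanishes :: "('o, 'm) addcat \<Rightarrow> nat \<Rightarrow> 'o \<Rightarrow> 'o \<Rightarrow> bool" where
  "Ext_vanishes C i X Y \<longleftrightarrow> is_singleton (Ext C i X Y)"


section \<open>\<open>n\<close>-cluster-tilting subcategories\<close>

text \<open>A full subcategory is given by its set of objects \<open>M\<close>.\<close>

definition left_approximation :: "('o, 'm) addcat \<Rightarrow> 'o set \<Rightarrow> 'o \<Rightarrow> 'm \<Rightarrow> bool" where
  "left_approximation C M X f \<longleftrightarrow> (\<exists>Y\<in>M. f \<in> Hom C X Y) \<and>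
     (\<forall>Y'\<in>M. \<forall>g\<in>Hom C X Y'. \<exists>h\<in>Hom C (Cod C f) Y'. g = f \<cdot>\<^bsub>C\<^esub> h)"

definition right_approximation :: "('o, 'm) addcat \<Rightarrow> 'o set \<Rightarrow> 'o \<Rightarrow> 'm \<Rightarrow> bool" where
  "right_approximation C M X f \<longleftrightarrow> (\<exists>Y\<in>M. f \<in> Hom C Y X) \<and>
     (\<forall>Y'\<in>M. \<forall>g\<in>Hom C Y' X. \<exists>h\<in>Hom C Y' (Dom C f). g = h \<cdot>\<^bsub>C\<^esub> f)"

definition covariantly_finite :: "('o, 'm) addcat \<Rightarrow> 'o set \<Rightarrow> bool" where
  "covariantly_finite C M \<longleftrightarrow> (\<forall>X\<in>Ob C. \<exists>f. left_approximation C M X f)"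

definition contravariantly_finite :: "('o, 'm) addcat \<Rightarrow> 'o set \<Rightarrow> bool" where
  "contravariantly_finite C M \<longleftrightarrow> (\<forall>X\<in>Ob C. \<exists>f. right_approximation C M X f)"

definition functorially_finite :: "('o, 'm) addcat \<Rightarrow> 'o set \<Rightarrow> bool" where
  "functorially_finite C M \<longleftrightarrow> covariantly_finite C M \<and> contravariantly_finite C M"

definition cogenerating :: "('o, 'm) addcat \<Rightarrow> 'o set \<Rightarrow> bool" where
  "cogenerating C M \<longleftrightarrow> (\<forall>X\<in>Ob C. \<exists>Y\<in>M. \<exists>f\<in>Hom C X Y. is_mono C f)"

definition generating :: "('o, 'm) addcat \<Rightarrow> 'o set \<Rightarrow> bool" where
  "generating C M \<longleftrightarrow> (\<forall>X\<in>Ob C. \<exists>Y\<in>M. \<exists>f\<in>Hom C Y X. is_epi C f)"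

definition n_cluster_tilting :: "('o, 'm) addcat \<Rightarrow> nat \<Rightarrow> 'o set \<Rightarrow> bool" where
  "n_cluster_tilting C n M \<longleftrightarrow> M \<subseteq> Ob C \<and>
     generating C M \<and> cogenerating C M \<and> functorially_finite C M \<and>
     M = {X \<in> Ob C. \<forall>i. 1 \<le> i \<and> i \<le> n - 1 \<longrightarrow> (\<forall>N\<in>M. Ext_vanishes C i X N)} \<and>
     M = {X \<in> Ob C. \<forall>i. 1 \<le> i \<and> i \<le> n - 1 \<longrightarrow> (\<forall>N\<in>M. Ext_vanishes C i N X)}"


section \<open>\<open>n\<close>-abelian categories\<close>

text \<open>A sequence \<open>X\<^sup>0 \<rightarrow> X\<^sup>1 \<rightarrow> \<dots> \<rightarrow> X\<^sup>m\<close> (with \<open>m \<ge> 1\<close>) is represented by the list of its arrows.\<close>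

definition arrow_seq :: "('o, 'm) addcat \<Rightarrow> 'm list \<Rightarrow> bool" where
  "arrow_seq C ds \<longleftrightarrow> ds \<noteq> [] \<and> set ds \<subseteq> Arr C \<and>
     (\<forall>j. j + 1 < length ds \<longrightarrow> Cod C (ds ! j) = Dom C (ds ! (j + 1)))"

definition seq_objects :: "('o, 'm) addcat \<Rightarrow> 'm list \<Rightarrow> 'o list" where
  "seq_objects C ds = Dom C (hd ds) # map (Cod C) ds"

text \<open>In \<open>exact_seq (Gs, hs)\<close> the final group of the sequence comes first.  Hence the
  groups \<open>C(X\<^sup>0, Y), \<dots>, C(X\<^sup>m, Y), 0\<close> of the contravariant sequence appear in this order, while
  the covariant sequence has to be reversed.  The arrow out of \<open>0\<close> is the inclusion of the zero
  morphism.\<close>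

definition contra_hom_exact :: "('o, 'm) addcat \<Rightarrow> 'm list \<Rightarrow> 'o \<Rightarrow> bool" where
  "contra_hom_exact C ds Y \<longleftrightarrow>
     exact_seq (map (\<lambda>X. hom_group C X Y) (seq_objects C ds)
                  @ [singleton_group (Zero C (Cod C (last ds)) Y)],
                map (\<lambda>d g. d \<cdot>\<^bsub>C\<^esub> g) ds @ [id])"

definition co_hom_exact :: "('o, 'm) addcat \<Rightarrow> 'm list \<Rightarrow> 'o \<Rightarrow> bool" where
  "co_hom_exact C ds Y \<longleftrightarrow>
     exact_seq (map (\<lambda>X. hom_group C Y X) (rev (seq_objects C ds))
                  @ [singleton_group (Zero C Y (Dom C (hd ds)))],
                map (\<lambda>d g. g \<cdot>\<^bsub>C\<^esub> d) (rev ds) @ [id])"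

definition n_cokernel :: "('o, 'm) addcat \<Rightarrow> nat \<Rightarrow> 'm \<Rightarrow> 'm list \<Rightarrow> bool" where
  "n_cokernel C n f ds \<longleftrightarrow> length ds = n \<and> arrow_seq C (f # ds) \<and>
     (\<forall>Y\<in>Ob C. contra_hom_exact C (f # ds) Y)"

definition n_kernel :: "('o, 'm) addcat \<Rightarrow> nat \<Rightarrow> 'm \<Rightarrow> 'm list \<Rightarrow> bool" where
  "n_kernel C n f ds \<longleftrightarrow> length ds = n \<and> arrow_seq C (ds @ [f]) \<and>
     (\<forall>Y\<in>Ob C. co_hom_exact C (ds @ [f]) Y)"

definition is_complex :: "('o, 'm) addcat \<Rightarrow> 'm list \<Rightarrow> bool" where
  "is_complex C ds \<longleftrightarrow> arrow_seq C ds \<and>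
     (\<forall>j. j + 1 < length ds \<longrightarrow>
        ds ! j \<cdot>\<^bsub>C\<^esub> ds ! (j + 1) = Zero C (Dom C (ds ! j)) (Cod C (ds ! (j + 1))))"

definition n_exact :: "('o, 'm) addcat \<Rightarrow> nat \<Rightarrow> 'm list \<Rightarrow> bool" where
  "n_exact C n ds \<longleftrightarrow> length ds = n + 1 \<and> is_complex C ds \<and>
     n_kernel C n (last ds) (butlast ds) \<and> n_cokernel C n (hd ds) (tl ds)"

locale n_abelian_category = additive_category C for C :: "('o, 'm) addcat" and n :: nat +
  assumes A0: "idempotent_complete C"
    and A1_kernel: "f \<in> Arr C \<Longrightarrow> \<exists>ds. n_kernel C n f ds"
    and A1_cokernel: "f \<in> Arr C \<Longrightarrow> \<exists>ds. n_cokernel C n f ds"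
    and A2: "\<lbrakk>is_mono C f; n_cokernel C n f ds\<rbrakk> \<Longrightarrow> n_exact C n (f # ds)"
    and A2_op: "\<lbrakk>is_epi C g; n_kernel C n g ds\<rbrakk> \<Longrightarrow> n_exact C n (ds @ [g])"

end

theory Submission
  imports Defs
begin

text \<open>
  An \<open>n\<close>-cokernel of \<open>f\<close> is built from the cokernel of \<open>f\<close> in the abelian category by taking
  left \<open>M\<close>-approximations, which are monic, and passing to their cokernels \<open>L\<close>.  Each step makes
  \<open>Ext\<^sup>1(L, M)\<close> vanish and shifts the vanishing already obtained up by one degree, so after
  \<open>n - 1\<close> steps the cokernel lies in \<open>M\<close>.  Conversely, for an epimorphism of \<open>M\<close> an \<open>n\<close>-kernel is an
  exact sequence of the abelian category, because \<open>M\<close> is generating and cogenerating; a map from one of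
  its cosyzygies to an object \<open>T\<close> of \<open>M\<close> extends to the next term since the obstruction is an element of
  some \<open>Ext\<^sup>i(X, T) = 0\<close> that can be shifted down along the sequence.  The other two axioms follow by
  passing to the opposite category.

  Only vanishing of Yoneda extensions is used, and no long exact sequence is needed.  An extension
  of \<open>X\<close> by \<open>N\<close> has trivial class iff it maps to an exact sequence \<open>0 \<rightarrow> N \<rightarrow> Z\<^sub>1 \<rightarrow> \<dots> \<rightarrow> S \<rightarrow> 0\<close> of the
  same length by a chain map that is the identity on \<open>N\<close> and zero on \<open>X \<rightarrow> S\<close>; the comparison lemma
  shows that this condition is invariant under equivalence of extensions.
\<close>

section \<open>Preadditive categories and their opposites\<close>

text \<open>Abelian categories need not have injective objects. Their role is played by quantifying
  over all coresolutions \<open>0 -> N -> Z1 -> ... -> S -> 0\<close> and by enlarging targets: a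
  map on a subobject extends once its target is embedded into a pushout. So each comparison of chain
  maps yields a new, larger coresolution, and only the last component of the homotopy is remembered.
  A coresolution presents the class of an extension by a map \<open>X -> S\<close>, determined,
  after enlarging, up to maps through the last epimorphism; such a map can be made zero by changing
  the chain map. This is why zero on \<open>X -> S\<close> is the test. The test favours the side of
  \<open>N\<close> and does not dualise by itself: duality is proved for Yoneda extensions, where it
  reverses lists.\<close>

definition Neg :: "('o, 'm) addcat \<Rightarrow> 'm \<Rightarrow> 'm" where
  "Neg C f = m_inv (hom_group C (Dom C f) (Cod C f)) f"

context category
begin

lemma HomI: "\<lbrakk>f \<in> Arr C; Dom C f = X; Cod C f = Y\<rbrakk> \<Longrightarrow> f \<in> Hom C X Y"
  by (simp add: Hom_def)

lemma Hom_arr: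
  assumes "f \<in> Hom C X Y"
  shows "f \<in> Arr C" "Dom C f = X" "Cod C f = Y" "X \<in> Ob C" "Y \<in> Ob C"
  using assms Dom_Ob Cod_Ob by (auto simp: Hom_def)

lemma Comp_simps [simp]:
  assumes "f \<in> Arr C" "g \<in> Arr C" "Cod C f = Dom C g"
  shows "f \<cdot> g \<in> Arr C" "Dom C (f \<cdot> g) = Dom C f" "Cod C (f \<cdot> g) = Cod C g"
  using Comp_Hom[of f "Dom C f" "Cod C f" g "Cod C g"] assms by (auto simp: Hom_def)

lemma Comp_assoc_Arr [simp]:
  assumes "f \<in> Arr C" "g \<in> Arr C" "h \<in> Arr C" "Cod C f = Dom C g" "Cod C g = Dom C h"
  shows "(f \<cdot> g) \<cdot> h = f \<cdot> (g \<cdot> h)"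
  using Comp_assoc[of f "Dom C f" "Cod C f" g "Cod C g" h "Cod C h"] assms by (auto simp: Hom_def)

lemma Idn_simps [simp]:
  assumes "X \<in> Ob C"
  shows "Idn C X \<in> Arr C" "Dom C (Idn C X) = X" "Cod C (Idn C X) = X"
  using Idn_Hom[OF assms] by (auto simp: Hom_def)

lemma Idn_Comp_Arr [simp]: "f \<in> Arr C \<Longrightarrow> Dom C f = X \<Longrightarrow> Idn C X \<cdot> f = f"
  using Idn_Comp by (auto simp: Hom_def)

lemma Comp_Idn_Arr [simp]: "f \<in> Arr C \<Longrightarrow> Cod C f = X \<Longrightarrow> f \<cdot> Idn C X = f"
  using Comp_Idn by (auto simp: Hom_def)

text \<open>Extends a commutative square by a further arrow; together with right-nested composites this
  makes diagram chases a matter of rewriting.\<close>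

lemma post:
  assumes "a \<cdot> b = r" "a \<in> Hom C X Y" "b \<in> Hom C Y Z" "x \<in> Arr C" "Dom C x = Z"
  shows "a \<cdot> (b \<cdot> x) = r \<cdot> x"
  using assms Comp_assoc[of a X Y b Z x "Cod C x"] by (auto simp: Hom_def)

end

section \<open>Bilinear arithmetic in the hom groups\<close>

context preadditive_category
begin

lemma hom_group_sel [simp]:
  "carrier (hom_group C X Y) = Hom C X Y" "mult (hom_group C X Y) = Add C"
  "one (hom_group C X Y) = Zero C X Y"
  by (auto simp: hom_group_def)

lemma hom_comm_group_Hom: "f \<in> Hom C X Y \<Longrightarrow> comm_group (hom_group C X Y)"
  by (rule hom_comm_group) (rule Hom_arr; assumption)+

lemma Zero_Hom: assumes "X \<in> Ob C" "Y \<in> Ob C" shows "Zero C X Y \<in> Hom C X Y"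
proof -
  interpret comm_group "hom_group C X Y" using hom_comm_group assms .
  show ?thesis using one_closed by simp
qed

lemma Add_Hom: assumes "f \<in> Hom C X Y" "g \<in> Hom C X Y" shows "Add C f g \<in> Hom C X Y"
proof -
  interpret comm_group "hom_group C X Y" by (rule hom_comm_group_Hom) (rule assms)
  show ?thesis using m_closed assms by simp
qed

lemma Neg_Hom: assumes "f \<in> Hom C X Y" shows "Neg C f \<in> Hom C X Y"
proof -
  interpret comm_group "hom_group C X Y" by (rule hom_comm_group_Hom) (rule assms)
  show ?thesis using inv_closed[of f] assms by (simp add: Neg_def Hom_def)
qed

lemma Zero_simps [simp]:
  assumes "X \<in> Ob C" "Y \<in> Ob C"
  shows "Zero C X Y \<in> Arr C" "Dom C (Zero C X Y) = X" "Cod C (Zero C X Y) = Y"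
  using Zero_Hom[OF assms] by (auto simp: Hom_def)

lemma Add_simps [simp]:
  assumes "f \<in> Arr C" "g \<in> Arr C" "Dom C g = Dom C f" "Cod C g = Cod C f"
  shows "Add C f g \<in> Arr C" "Dom C (Add C f g) = Dom C f" "Cod C (Add C f g) = Cod C f"
  using Add_Hom[of f "Dom C f" "Cod C f" g] assms by (auto simp: Hom_def)

lemma Neg_simps [simp]:
  assumes "f \<in> Arr C"
  shows "Neg C f \<in> Arr C" "Dom C (Neg C f) = Dom C f" "Cod C (Neg C f) = Cod C f"
  using Neg_Hom[of f "Dom C f" "Cod C f"] assms by (auto simp: Hom_def)

lemma Comp_Add_Arr [simp]:
  assumes "f \<in> Arr C" "g \<in> Arr C" "h \<in> Arr C" "Cod C f = Dom C g" "Dom C h = Dom C g"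
    "Cod C h = Cod C g"
  shows "f \<cdot> Add C g h = Add C (f \<cdot> g) (f \<cdot> h)"
  using Comp_Add[of f "Dom C f" "Cod C f" g "Cod C g" h] assms by (auto simp: Hom_def)

lemma Add_Comp_Arr [simp]:
  assumes "f \<in> Arr C" "g \<in> Arr C" "h \<in> Arr C" "Dom C g = Dom C f" "Cod C g = Cod C f"
    "Cod C f = Dom C h"
  shows "Add C f g \<cdot> h = Add C (f \<cdot> h) (g \<cdot> h)"
  using Add_Comp[of f "Dom C f" "Cod C f" g h "Cod C h"] assms by (auto simp: Hom_def)

lemma Add_assoc_Arr:
  assumes "f \<in> Arr C" "g \<in> Arr C" "h \<in> Arr C" "Dom C g = Dom C f" "Cod C g = Cod C f"
    "Dom C h = Dom C f" "Cod C h = Cod C f"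
  shows "Add C (Add C f g) h = Add C f (Add C g h)"
proof -
  interpret comm_group "hom_group C (Dom C f) (Cod C f)"
    by (rule hom_comm_group_Hom[of f]) (use assms in \<open>simp add: Hom_def\<close>)
  show ?thesis using m_assoc[of f g h] assms by (simp add: Hom_def)
qed

lemma Add_commute:
  assumes "f \<in> Hom C X Y" "g \<in> Hom C X Y"
  shows "Add C f g = Add C g f"
proof -
  interpret comm_group "hom_group C X Y" by (rule hom_comm_group_Hom) (rule assms)
  show ?thesis using m_comm[of f g] assms by simp
qed

lemma Add_Zero [simp]:
  assumes "f \<in> Arr C" "Dom C f = X" "Cod C f = Y"
  shows "Add C f (Zero C X Y) = f" "Add C (Zero C X Y) f = f"
proof -
  interpret comm_group "hom_group C (Dom C f) (Cod C f)"
    by (rule hom_comm_group_Hom[of f]) (use assms in \<open>simp add: Hom_def\<close>)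
  show "Add C f (Zero C X Y) = f" "Add C (Zero C X Y) f = f"
    using r_one[of f] l_one[of f] assms by (simp_all add: Hom_def)
qed

lemma Add_Neg [simp]:
  assumes "f \<in> Arr C"
  shows "Add C f (Neg C f) = Zero C (Dom C f) (Cod C f)" "Add C (Neg C f) f = Zero C (Dom C f) (Cod C f)"
proof -
  interpret comm_group "hom_group C (Dom C f) (Cod C f)"
    by (rule hom_comm_group_Hom[of f]) (use assms in \<open>simp add: Hom_def\<close>)
  show "Add C f (Neg C f) = Zero C (Dom C f) (Cod C f)" "Add C (Neg C f) f = Zero C (Dom C f) (Cod C f)"
    using r_inv[of f] l_inv[of f] assms by (simp_all add: Hom_def Neg_def)
qed

lemma Add_left_cancel:
  assumes "f \<in> Hom C X Y" "g \<in> Hom C X Y" "h \<in> Hom C X Y" "Add C f g = Add C f h"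
  shows "g = h"
proof -
  interpret comm_group "hom_group C X Y" by (rule hom_comm_group_Hom) (rule assms)
  show ?thesis using assms Units_l_cancel[of f g h] by simp
qed

lemma Add_self_Zero:
  assumes "f \<in> Hom C X Y" "Add C f f = f"
  shows "f = Zero C X Y"
  using Add_left_cancel[of f X Y f "Zero C X Y"] assms Hom_arr[OF assms(1)] Zero_Hom by auto

text \<open>The axioms do not mention composites with zero. By bilinearity such a composite is its
  own double, hence zero.\<close>

lemma Comp_Zero [simp]:
  assumes "f \<in> Arr C" "Cod C f = Y" "Z \<in> Ob C"
  shows "f \<cdot> Zero C Y Z = Zero C (Dom C f) Z"
proof -
  have Y: "Y \<in> Ob C" using assms Cod_Ob by blast
  have "Add C (f \<cdot> Zero C Y Z) (f \<cdot> Zero C Y Z) = f \<cdot> Add C (Zero C Y Z) (Zero C Y Z)"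
    using assms Y by (subst Comp_Add_Arr) auto
  also have "\<dots> = f \<cdot> Zero C Y Z" using assms Y by simp
  finally show ?thesis using assms Y by (intro Add_self_Zero HomI) auto
qed

lemma Zero_Comp [simp]:
  assumes "g \<in> Arr C" "Dom C g = Y" "X \<in> Ob C"
  shows "Zero C X Y \<cdot> g = Zero C X (Cod C g)"
proof -
  have Y: "Y \<in> Ob C" using assms Dom_Ob by blast
  have "Add C (Zero C X Y \<cdot> g) (Zero C X Y \<cdot> g) = Add C (Zero C X Y) (Zero C X Y) \<cdot> g"
    using assms Y by (subst Add_Comp_Arr) auto
  also have "\<dots> = Zero C X Y \<cdot> g" using assms Y by simp
  finally show ?thesis using assms Y by (intro Add_self_Zero HomI) auto
qed

lemma Neg_unique:
  assumes "f \<in> Hom C X Y" "g \<in> Hom C X Y" "Add C f g = Zero C X Y"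
  shows "g = Neg C f"
  using Add_left_cancel[of f X Y g "Neg C f"] assms Neg_Hom Hom_arr[OF assms(1)] by auto

lemma Neg_Zero [simp]:
  assumes "X \<in> Ob C" "Y \<in> Ob C"
  shows "Neg C (Zero C X Y) = Zero C X Y"
  by (rule Neg_unique[symmetric, of _ X Y]) (use assms Zero_Hom in auto)

lemma Comp_Neg [simp]:
  assumes "f \<in> Arr C" "g \<in> Arr C" "Cod C f = Dom C g"
  shows "f \<cdot> Neg C g = Neg C (f \<cdot> g)"
proof (rule Neg_unique[of _ "Dom C f" "Cod C g"])
  show "Add C (f \<cdot> g) (f \<cdot> Neg C g) = Zero C (Dom C f) (Cod C g)"
    using assms Cod_Ob by (subst Comp_Add_Arr[symmetric]) auto
qed (use assms in \<open>auto intro: HomI\<close>)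

lemma Neg_Comp [simp]:
  assumes "f \<in> Arr C" "g \<in> Arr C" "Cod C f = Dom C g"
  shows "Neg C f \<cdot> g = Neg C (f \<cdot> g)"
proof (rule Neg_unique[of _ "Dom C f" "Cod C g"])
  show "Add C (f \<cdot> g) (Neg C f \<cdot> g) = Zero C (Dom C f) (Cod C g)"
    using assms Dom_Ob Cod_Ob by (subst Add_Comp_Arr[symmetric]) (auto simp flip: assms(3))
qed (use assms in \<open>auto intro: HomI\<close>)

lemma Add_Neg_eq_Zero:
  assumes "f \<in> Hom C X Y" "g \<in> Hom C X Y" "Add C f (Neg C g) = Zero C X Y"
  shows "f = g"
proof -
  have "f = Add C f (Add C (Neg C g) g)" using assms(1,2)[THEN Hom_arr(1)]
      assms(1,2)[THEN Hom_arr(2)] assms(1,2)[THEN Hom_arr(3)] by simp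
  also have "\<dots> = Add C (Add C f (Neg C g)) g" using assms(1,2)[THEN Hom_arr(1)]
      assms(1,2)[THEN Hom_arr(2)] assms(1,2)[THEN Hom_arr(3)] by (subst Add_assoc_Arr) auto
  also have "\<dots> = g" using assms(2) by (simp add: assms(3) Hom_def)
  finally show ?thesis .
qed

text \<open>Passing to the difference of a parallel pair turns cancellation into triviality of the
  kernel. \<open>W\<close> ranges over the whole type, since membership in a hom set already puts it
  in \<open>Ob C\<close>.\<close>

lemma is_mono_iff:
  "is_mono C f \<longleftrightarrow> f \<in> Arr C \<and>
    (\<forall>W. \<forall>g\<in>Hom C W (Dom C f). g \<cdot> f = Zero C W (Cod C f) \<longrightarrow> g = Zero C W (Dom C f))"
proof (intro iffI conjI allI ballI impI)
  assume m: "is_mono C f"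
  show f: "f \<in> Arr C" using m by (simp add: is_mono_def)
  fix W g assume g: "g \<in> Hom C W (Dom C f)" "g \<cdot> f = Zero C W (Cod C f)"
  then show "g = Zero C W (Dom C f)"
    using m f Hom_arr[OF g(1)] Zero_Hom unfolding is_mono_def by auto
next
  assume *: "f \<in> Arr C \<and>
    (\<forall>W. \<forall>g\<in>Hom C W (Dom C f). g \<cdot> f = Zero C W (Cod C f) \<longrightarrow> g = Zero C W (Dom C f))"
  show "is_mono C f" unfolding is_mono_def
  proof (intro conjI ballI impI)
    show f: "f \<in> Arr C" using * by simp
    fix W g h assume W: "W \<in> Ob C" and gh: "g \<in> Hom C W (Dom C f)" "h \<in> Hom C W (Dom C f)"
      "g \<cdot> f = h \<cdot> f"
    have "Add C g (Neg C h) \<cdot> f = Zero C W (Cod C f)"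
      using gh f by (simp add: Hom_def)
    then have "Add C g (Neg C h) = Zero C W (Dom C f)"
      using * Add_Hom Neg_Hom gh by blast
    then show "g = h" using Add_Neg_eq_Zero gh by blast
  qed
qed

end

section \<open>The opposite category and stability of the axioms under it\<close>

text \<open>This is an involution by equality, not just up to isomorphism, so a statement
  transferred to \<open>opc C\<close> comes back by simplification.\<close>

definition opc :: "('o, 'm) addcat \<Rightarrow> ('o, 'm) addcat" where
  "opc C = \<lparr>Ob = Ob C, Arr = Arr C, Dom = Cod C, Cod = Dom C, Idn = Idn C,
     Comp = (\<lambda>f g. Comp C g f), Add = Add C, Zero = (\<lambda>X Y. Zero C Y X)\<rparr>"

lemma opc_sel [simp]:
  "Ob (opc C) = Ob C" "Arr (opc C) = Arr C" "Dom (opc C) = Cod C" "Cod (opc C) = Dom C"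
  "Idn (opc C) = Idn C" "Comp (opc C) f g = Comp C g f" "Add (opc C) = Add C"
  "Zero (opc C) X Y = Zero C Y X"
  by (simp_all add: opc_def)

lemma opc_opc [simp]: "opc (opc C) = (C :: ('o, 'm) addcat)"
  by (simp add: opc_def)

lemma Hom_opc [simp]: "Hom (opc C) X Y = Hom C Y X"
  by (auto simp: Hom_def)

lemma hom_group_opc [simp]: "hom_group (opc C) X Y = hom_group C Y X"
  by (simp add: hom_group_def)

lemma is_mono_opc [simp]: "is_mono (opc C) = is_epi C"
  by (simp add: is_mono_def is_epi_def fun_eq_iff)

lemma is_epi_opc [simp]: "is_epi (opc C) = is_mono C"
  by (simp add: is_mono_def is_epi_def fun_eq_iff)

lemma is_kernel_opc [simp]: "is_kernel (opc C) = is_cokernel C"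
  by (auto simp: is_kernel_def is_cokernel_def fun_eq_iff)

lemma is_cokernel_opc [simp]: "is_cokernel (opc C) = is_kernel C"
  by (auto simp: is_kernel_def is_cokernel_def fun_eq_iff)

lemma zero_object_opc [simp]: "zero_object (opc C) = zero_object C"
  by (auto simp: zero_object_def fun_eq_iff)

lemma biproduct_opc [simp]: "biproduct (opc C) X Y P i1 i2 p1 p2 = biproduct C X Y P p1 p2 i1 i2"
  by (auto simp: biproduct_def)

lemma category_opc: assumes "category C" shows "category (opc C)"
proof -
  interpret category C by fact
  show ?thesis
    by unfold_locales (auto simp: Dom_Ob Cod_Ob Idn_Hom Comp_Hom Idn_Comp Comp_Idn Comp_assoc)
qed

lemma preadditive_category_opc:
  assumes "preadditive_category C" shows "preadditive_category (opc C)"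
proof -
  interpret preadditive_category C by fact
  show ?thesis
    by (intro preadditive_category.intro category_opc preadditive_category_axioms.intro)
      (auto simp: hom_comm_group Comp_Add Add_Comp intro: category_axioms)
qed

lemma additive_category_opc: assumes "additive_category C" shows "additive_category (opc C)"
proof -
  interpret additive_category C by fact
  interpret op: preadditive_category "opc C" by (rule preadditive_category_opc) unfold_locales
  show ?thesis
    by unfold_locales (use ex_zero_object ex_biproduct in \<open>simp_all, blast\<close>)
qed

lemma abelian_category_opc: assumes "abelian_category C" shows "abelian_category (opc C)"
proof -
  interpret abelian_category C by fact
  interpret op: additive_category "opc C" by (rule additive_category_opc) unfold_locales
  show ?thesis
    by unfold_locales (use ex_kernel ex_cokernel mono_kernel epi_cokernel in simp_all)
qed

section \<open>Short exact sequences in abelian categories\<close>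

definition ses :: "('o, 'm) addcat \<Rightarrow> 'm \<Rightarrow> 'm \<Rightarrow> bool" where
  "ses C m e \<longleftrightarrow> is_kernel C e m \<and> is_cokernel C m e"

lemma ses_opc [simp]: "ses (opc C) e m = ses C m e"
  by (auto simp: ses_def)

context abelian_category
begin

lemma kernel_lift:
  assumes "is_kernel C f k" "g \<in> Hom C W (Dom C f)" "g \<cdot> f = Zero C W (Cod C f)"
  obtains h where "h \<in> Hom C W (Dom C k)" "h \<cdot> k = g"
  using assms Hom_arr(4)[OF assms(2)] unfolding is_kernel_def by blast

lemma cokernel_desc:
  assumes "is_cokernel C f c" "g \<in> Hom C (Cod C f) W" "f \<cdot> g = Zero C (Dom C f) W"
  obtains h where "h \<in> Hom C (Cod C c) W" "c \<cdot> h = g"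
  using assms Hom_arr(5)[OF assms(2)] unfolding is_cokernel_def by blast

lemma kernel_arr:
  assumes "is_kernel C f k"
  shows "f \<in> Arr C" "k \<in> Arr C" "Dom C f = Cod C k" "k \<cdot> f = Zero C (Dom C k) (Cod C f)"
    "Dom C k \<in> Ob C" "Cod C k \<in> Ob C" "Cod C f \<in> Ob C"
  using assms by (auto simp: is_kernel_def Dom_Ob Cod_Ob)

lemma cokernel_arr:
  assumes "is_cokernel C f c"
  shows "f \<in> Arr C" "c \<in> Arr C" "Dom C c = Cod C f" "f \<cdot> c = Zero C (Dom C f) (Cod C c)"
    "Dom C f \<in> Ob C" "Cod C f \<in> Ob C" "Cod C c \<in> Ob C"
  using assms by (auto simp: is_cokernel_def Dom_Ob Cod_Ob)

lemma monoD:
  assumes "is_mono C m" "x \<in> Hom C W (Dom C m)" "y \<in> Hom C W (Dom C m)" "x \<cdot> m = y \<cdot> m"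
  shows "x = y"
  using assms Hom_arr(4)[OF assms(2)] unfolding is_mono_def by blast

lemma epiD:
  assumes "is_epi C e" "x \<in> Hom C (Cod C e) W" "y \<in> Hom C (Cod C e) W" "e \<cdot> x = e \<cdot> y"
  shows "x = y"
  using assms Hom_arr(5)[OF assms(2)] unfolding is_epi_def by blast

lemma kernel_is_mono:
  assumes k: "is_kernel C f k"
  shows "is_mono C k"
  unfolding is_mono_iff
proof (intro conjI allI ballI impI)
  note a = kernel_arr[OF k]
  show "k \<in> Arr C" by (fact a)
  fix W g assume g: "g \<in> Hom C W (Dom C k)" "g \<cdot> k = Zero C W (Cod C k)"
  note b = Hom_arr[OF g(1)]
  have "\<exists>!h. h \<in> Hom C W (Dom C k) \<and> h \<cdot> k = Zero C W (Cod C k)"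
    using k a b unfolding is_kernel_def by (auto simp: Zero_Hom)
  moreover have "Zero C W (Dom C k) \<in> Hom C W (Dom C k)"
    "Zero C W (Dom C k) \<cdot> k = Zero C W (Cod C k)"
    using a b by (auto intro: Zero_Hom)
  ultimately show "g = Zero C W (Dom C k)" using g by blast
qed

lemma abelian_category_opc': "abelian_category (opc C)"
  by (rule abelian_category_opc) unfold_locales

lemma cokernel_is_epi: "is_cokernel C f c \<Longrightarrow> is_epi C c"
  using abelian_category.kernel_is_mono[OF abelian_category_opc'] by simp

text \<open>The monomorphism \<open>m\<close> is a kernel of some \<open>g\<close>, and
  \<open>g\<close> factors through the cokernel \<open>e\<close>; what \<open>e\<close> kills is
  thus killed by \<open>g\<close> and lifts to \<open>m\<close>.\<close>

lemma is_cokernel_mono_ses: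
  assumes e: "is_cokernel C m e" and m: "is_mono C m"
  shows "ses C m e"
proof -
  obtain g where g: "is_kernel C g m" using mono_kernel[OF m] by blast
  note a = cokernel_arr[OF e] and b = kernel_arr[OF g]
  obtain h where h: "h \<in> Hom C (Cod C e) (Cod C g)" "e \<cdot> h = g"
    using cokernel_desc[OF e, of g "Cod C g"] b by (auto simp: Hom_def)
  note c = Hom_arr[OF h(1)]
  have "\<exists>!y. y \<in> Hom C W (Dom C m) \<and> y \<cdot> m = x"
    if x: "x \<in> Hom C W (Dom C e)" "x \<cdot> e = Zero C W (Cod C e)" for W x
  proof -
    have "x \<cdot> g = x \<cdot> (e \<cdot> h)" using h by simp
    also have "\<dots> = Zero C W (Cod C e) \<cdot> h"
      using x a c Hom_arr[OF x(1)] by (subst Comp_assoc_Arr[symmetric]) auto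
    also have "\<dots> = Zero C W (Cod C g)" using a c Hom_arr[OF x(1)] by simp
    finally obtain y where "y \<in> Hom C W (Dom C m)" "y \<cdot> m = x"
      using kernel_lift[OF g, of x W] x a b by auto
    then show ?thesis using monoD[OF m] by blast
  qed
  then show ?thesis using a e by (auto simp: ses_def is_kernel_def)
qed

lemma is_kernel_epi_ses: "is_kernel C e m \<Longrightarrow> is_epi C e \<Longrightarrow> ses C m e"
  using abelian_category.is_cokernel_mono_ses[OF abelian_category_opc'] by simp

lemma mono_ses: "is_mono C m \<Longrightarrow> \<exists>e. ses C m e"
  using ex_cokernel is_cokernel_mono_ses by (fastforce simp: is_mono_def)

lemma ses_arr:
  assumes "ses C m e"
  shows "m \<in> Arr C" "e \<in> Arr C" "Dom C e = Cod C m" "m \<cdot> e = Zero C (Dom C m) (Cod C e)"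
    "Dom C m \<in> Ob C" "Cod C m \<in> Ob C" "Cod C e \<in> Ob C"
  using assms cokernel_arr by (auto simp: ses_def)

lemma ses_lift:
  assumes "ses C m e" "g \<in> Hom C W (Cod C m)" "g \<cdot> e = Zero C W (Cod C e)"
  obtains h where "h \<in> Hom C W (Dom C m)" "h \<cdot> m = g"
  using kernel_lift[of e m g W] assms ses_arr[OF assms(1)] by (auto simp: ses_def)

lemma ses_desc:
  assumes "ses C m e" "g \<in> Hom C (Cod C m) W" "m \<cdot> g = Zero C (Dom C m) W"
  obtains h where "h \<in> Hom C (Cod C e) W" "e \<cdot> h = g"
  using cokernel_desc[of m e g W] assms ses_arr[OF assms(1)] by (auto simp: ses_def)

lemma ses_mono: "ses C m e \<Longrightarrow> is_mono C m"
  using kernel_is_mono by (auto simp: ses_def)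

lemma ses_epi: "ses C m e \<Longrightarrow> is_epi C e"
  using cokernel_is_epi by (auto simp: ses_def)

lemma ses_monoD:
  "\<lbrakk>ses C m e; x \<in> Hom C W (Dom C m); y \<in> Hom C W (Dom C m); x \<cdot> m = y \<cdot> m\<rbrakk> \<Longrightarrow> x = y"
  using monoD ses_mono by blast

lemma ses_epiD:
  "\<lbrakk>ses C m e; x \<in> Hom C (Cod C e) W; y \<in> Hom C (Cod C e) W; e \<cdot> x = e \<cdot> y\<rbrakk> \<Longrightarrow> x = y"
  using epiD ses_epi by blast

text \<open>The difference of \<open>f\<close> and \<open>g\<close> vanishes on the subobject, so it
  lives on the quotient. The homotopies of the comparison lemma arise in this way.\<close>

lemma ses_desc_diff:
  assumes s: "ses C m e" and fg: "f \<in> Hom C (Cod C m) W" "g \<in> Hom C (Cod C m) W" "m \<cdot> f = m \<cdot> g"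
  obtains h where "h \<in> Hom C (Cod C e) W" "f = Add C g (e \<cdot> h)"
proof -
  note a = ses_arr[OF s] Hom_arr[OF fg(1)] Hom_arr[OF fg(2)]
  have "m \<cdot> Add C (Neg C g) f = Zero C (Dom C m) W" using a fg(3) by simp
  then obtain h where h: "h \<in> Hom C (Cod C e) W" "e \<cdot> h = Add C (Neg C g) f"
    using ses_desc[OF s, of "Add C (Neg C g) f" W] fg Add_Hom Neg_Hom by blast
  have "Add C g (e \<cdot> h) = Add C (Add C g (Neg C g)) f"
    unfolding h(2) using a by (subst Add_assoc_Arr) auto
  also have "\<dots> = f" using a by simp
  finally show ?thesis using h that by simp
qed

lemma Idn_Zero_ses:
  assumes X: "X \<in> Ob C" and zero: "zero_object C Z"
  shows "ses C (Idn C X) (Zero C X Z)"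
proof -
  have Z: "Z \<in> Ob C" using zero by (auto simp: zero_object_def)
  have "is_mono C (Idn C X)" using X by (auto simp: is_mono_def Hom_def)
  moreover have "is_cokernel C (Idn C X) (Zero C X Z)"
    unfolding is_cokernel_def
  proof (intro conjI ballI impI)
    fix W g assume W: "W \<in> Ob C" and g: "g \<in> Hom C (Cod C (Idn C X)) W"
      "Idn C X \<cdot> g = Zero C (Dom C (Idn C X)) W"
    have g0: "g = Zero C X W" using g X by (auto simp: Hom_def)
    obtain h where h: "h \<in> Hom C Z W" "\<And>h'. h' \<in> Hom C Z W \<Longrightarrow> h' = h"
      using zero W unfolding zero_object_def by blast
    have "Zero C X Z \<cdot> h = g" using Hom_arr[OF h(1)] X g0 by simp
    then show "\<exists>!h. h \<in> Hom C (Cod C (Zero C X Z)) W \<and> Zero C X Z \<cdot> h = g"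
      using h(1) X Z by (intro ex1I[of _ h] conjI h(2)) simp_all
  qed (use X Z in auto)
  ultimately show ?thesis using is_cokernel_mono_ses by blast
qed

lemma Zero_Idn_ses: "X \<in> Ob C \<Longrightarrow> zero_object C Z \<Longrightarrow> ses C (Zero C Z X) (Idn C X)"
  using abelian_category.Idn_Zero_ses[OF abelian_category_opc', of X Z] by simp

lemma is_epi_Comp:
  assumes "is_epi C e" "is_epi C q" "Cod C e = Dom C q"
  shows "is_epi C (e \<cdot> q)"
  unfolding is_epi_def
proof (intro conjI ballI impI)
  have eq: "e \<in> Arr C" "q \<in> Arr C" using assms by (auto simp: is_epi_def)
  then show "e \<cdot> q \<in> Arr C" using assms by simp
  fix V f g assume fg: "f \<in> Hom C (Cod C (e \<cdot> q)) V" "g \<in> Hom C (Cod C (e \<cdot> q)) V"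
    "e \<cdot> q \<cdot> f = e \<cdot> q \<cdot> g"
  have fg': "f \<in> Hom C (Cod C q) V" "g \<in> Hom C (Cod C q) V" using fg eq assms(3) by auto
  note a = Hom_arr(1,2,3)[OF fg'(1)] Hom_arr(1,2,3)[OF fg'(2)]
  have "e \<cdot> (q \<cdot> f) = e \<cdot> (q \<cdot> g)" using fg(3) eq a assms(3) by simp
  then have "q \<cdot> f = q \<cdot> g"
    using epiD[OF assms(1), of "q \<cdot> f" V "q \<cdot> g"] eq assms(3) a by (simp add: Hom_def)
  then show "f = g" using epiD[OF assms(2) fg'] by simp
qed

lemma is_mono_Comp:
  assumes "is_mono C q" "is_mono C e" "Cod C q = Dom C e"
  shows "is_mono C (q \<cdot> e)"
  using abelian_category.is_epi_Comp[OF abelian_category_opc', of e q] assms by simp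

text \<open>The map out of the coimage is monic: for \<open>x n = 0\<close> the cokernel
  \<open>q\<close> of \<open>x\<close> turns out to have a one-sided inverse \<open>r\<close>, so
  that \<open>x = x q r = 0\<close>.\<close>

lemma coimage_mono:
  assumes k: "is_kernel C d m" and e: "is_cokernel C m e" and n: "n \<in> Hom C (Cod C e) (Cod C d)"
    and d: "e \<cdot> n = d"
  shows "is_mono C n"
  unfolding is_mono_iff
proof (intro conjI allI ballI impI)
  define K D I F where "K = Dom C m" and "D = Cod C m" and "I = Cod C e" and "F = Cod C d"
  have a: "m \<in> Arr C" "Dom C m = K" "Cod C m = D" "e \<in> Arr C" "Dom C e = D" "Cod C e = I"
    "n \<in> Arr C" "Dom C n = I" "Cod C n = F" "d \<in> Arr C" "Dom C d = D" "Cod C d = F"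
    "D \<in> Ob C" "I \<in> Ob C" "F \<in> Ob C" "K \<in> Ob C" "m \<cdot> e = Zero C K I"
    using kernel_arr[OF k] cokernel_arr[OF e] Hom_arr[OF n] by (auto simp: K_def D_def I_def F_def)
  show "n \<in> Arr C" by (fact a)
  fix W x assume x: "x \<in> Hom C W (Dom C n)" and xn: "x \<cdot> n = Zero C W (Cod C n)"
  have ax: "x \<in> Arr C" "Dom C x = W" "Cod C x = I" "W \<in> Ob C" using Hom_arr[OF x] a by auto
  obtain q where q: "is_cokernel C x q" using ex_cokernel ax by blast
  define Q where "Q = Cod C q"
  have aq: "q \<in> Arr C" "Dom C q = I" "Cod C q = Q" "Q \<in> Ob C" "x \<cdot> q = Zero C W Q"
    using cokernel_arr[OF q] ax by (auto simp: Q_def)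
  obtain y where y: "y \<in> Hom C Q F" "q \<cdot> y = n"
    using cokernel_desc[OF q, of n F] xn ax a aq by (auto simp: Hom_def)
  have ay: "y \<in> Arr C" "Dom C y = Q" "Cod C y = F" using Hom_arr[OF y(1)] by auto
  have "is_epi C (e \<cdot> q)" using is_epi_Comp cokernel_is_epi e q a aq by simp
  then obtain z where z: "is_cokernel C z (e \<cdot> q)" using epi_cokernel by blast
  define Z where "Z = Dom C z"
  have az: "z \<in> Arr C" "Dom C z = Z" "Cod C z = D" "z \<cdot> (e \<cdot> q) = Zero C Z Q" "Z \<in> Ob C"
    using cokernel_arr[OF z] a aq by (auto simp: Z_def)
  \<comment> \<open>As \<open>n\<close> factors through \<open>q\<close>, the map \<open>z\<close>
    is killed by \<open>d\<close>, lifts to \<open>m\<close> and so is killed by \<open>e\<close>.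
    Hence \<open>e\<close> descends along \<open>e q\<close>, the cokernel of
    \<open>z\<close>.\<close>
  have "z \<cdot> d = z \<cdot> (e \<cdot> (q \<cdot> y))" using d y(2) by simp
  also have "\<dots> = (z \<cdot> (e \<cdot> q)) \<cdot> y" using ay aq a az(1-3) by simp
  also have "\<dots> = Zero C Z F" unfolding az(4) using az ay aq by simp
  finally obtain w where w: "w \<in> Hom C Z K" "w \<cdot> m = z"
    using kernel_lift[OF k, of z Z] az a by (auto simp: Hom_def)
  have aw: "w \<in> Arr C" "Dom C w = Z" "Cod C w = K" using Hom_arr[OF w(1)] by auto
  have "z \<cdot> e = w \<cdot> (m \<cdot> e)" using w(2)[symmetric] aw a(1-6) by simp
  also have "\<dots> = Zero C Z I" using a aw by simp
  finally obtain r where r: "r \<in> Hom C Q I" "(e \<cdot> q) \<cdot> r = e"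
    using cokernel_desc[OF z, of e I] az a aq by (auto simp: Hom_def)
  have ar: "r \<in> Arr C" "Dom C r = Q" "Cod C r = I" using Hom_arr[OF r(1)] by auto
  have "e \<cdot> (q \<cdot> r) = e \<cdot> Idn C I" using r(2) a aq ar by simp
  then have qr: "q \<cdot> r = Idn C I"
    using epiD[OF cokernel_is_epi[OF e], of "q \<cdot> r" I "Idn C I"] a aq ar by (simp add: Hom_def)
  have "x = x \<cdot> (q \<cdot> r)" using qr ax by simp
  also have "\<dots> = (x \<cdot> q) \<cdot> r" using ax aq(1-3) ar by simp
  also have "\<dots> = Zero C W Q \<cdot> r" by (simp only: aq(5))
  also have "\<dots> = Zero C W I" using aq(4) ar ax(4) by simp
  finally show "x = Zero C W (Dom C n)" using a by simp
qed

section \<open>Pushouts and pullbacks of short exact sequences\<close>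

text \<open>The pushout is the cokernel of the map \<open>(m, -t)\<close> into a biproduct;
  \<open>m'\<close> is monic because that map is a kernel of its cokernel.\<close>

lemma pushout_ses:
  assumes s: "ses C m e" and t: "t \<in> Hom C (Dom C m) T"
  obtains m' e' E t' where "ses C m' e'" "m' \<in> Hom C T E" "e' \<in> Hom C E (Cod C e)"
    "t' \<in> Hom C (Cod C m) E" "m \<cdot> t' = t \<cdot> m'" "t' \<cdot> e' = e"
    "\<And>W x y. \<lbrakk>x \<in> Hom C (Cod C m) W; y \<in> Hom C T W; m \<cdot> x = t \<cdot> y\<rbrakk> \<Longrightarrow>
       \<exists>z\<in>Hom C E W. t' \<cdot> z = x \<and> m' \<cdot> z = y"
    "\<And>W z z'. \<lbrakk>z \<in> Hom C E W; z' \<in> Hom C E W; t' \<cdot> z = t' \<cdot> z'; m' \<cdot> z = m' \<cdot> z'\<rbrakk> \<Longrightarrow> z = z'"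
proof -
  note a = ses_arr[OF s] Hom_arr[OF t]
  obtain P i1 i2 p1 p2 where "biproduct C (Cod C m) T P i1 i2 p1 p2"
    using ex_biproduct a by blast
  then have bp: "i1 \<in> Hom C (Cod C m) P" "i2 \<in> Hom C T P" "p1 \<in> Hom C P (Cod C m)" "p2 \<in> Hom C P T"
    "i1 \<cdot> p1 = Idn C (Cod C m)" "i2 \<cdot> p2 = Idn C T"
    "i1 \<cdot> p2 = Zero C (Cod C m) T" "i2 \<cdot> p1 = Zero C T (Cod C m)"
    "Add C (p1 \<cdot> i1) (p2 \<cdot> i2) = Idn C P"
    by (auto simp: biproduct_def)
  note b = bp(1-4)[THEN Hom_arr(1)] bp(1-4)[THEN Hom_arr(2)] bp(1-4)[THEN Hom_arr(3)]
    Hom_arr(5)[OF bp(1)]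
  note pp [simp] = bp(5-8) bp(5)[THEN post, OF bp(1,3)] bp(6)[THEN post, OF bp(2,4)]
    bp(7)[THEN post, OF bp(1,4)] bp(8)[THEN post, OF bp(2,3)]
  have split: "f = Add C (p1 \<cdot> (i1 \<cdot> f)) (p2 \<cdot> (i2 \<cdot> f))" if "f \<in> Arr C" "Dom C f = P" for f
  proof -
    have "f = Add C (p1 \<cdot> i1) (p2 \<cdot> i2) \<cdot> f" using bp(9) that by simp
    then show ?thesis using b that by simp
  qed
  \<comment> \<open>The sign makes the cokernel identify \<open>m i1\<close> with
    \<open>t i2\<close>.\<close>
  define \<phi> where "\<phi> = Add C (m \<cdot> i1) (Neg C (t \<cdot> i2))"
  have \<phi>: "\<phi> \<in> Arr C" "Dom C \<phi> = Dom C m" "Cod C \<phi> = P" "\<phi> \<cdot> p1 = m" "\<phi> \<cdot> p2 = Neg C t"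
    using a b by (auto simp: \<phi>_def)
  have \<phi>f: "\<phi> \<cdot> f = Add C (m \<cdot> (i1 \<cdot> f)) (Neg C (t \<cdot> (i2 \<cdot> f)))" if "f \<in> Arr C" "Dom C f = P" for f
    using a b that by (simp add: \<phi>_def)
  obtain c where c: "is_cokernel C \<phi> c" using ex_cokernel \<phi> by blast
  have ac: "c \<in> Arr C" "Dom C c = P" "\<phi> \<cdot> c = Zero C (Dom C m) (Cod C c)" "Cod C c \<in> Ob C"
    using cokernel_arr[OF c] \<phi> by auto
  define E where "E = Cod C c"
  define t' m' where "t' = i1 \<cdot> c" and "m' = i2 \<cdot> c"
  have t'm': "t' \<in> Arr C" "Dom C t' = Cod C m" "Cod C t' = E" "m' \<in> Arr C" "Dom C m' = T" "Cod C m' = E"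
    using b ac by (auto simp: t'_def m'_def E_def)
  have comm: "m \<cdot> t' = t \<cdot> m'"
    using Add_Neg_eq_Zero[of "m \<cdot> t'" "Dom C m" E "t \<cdot> m'"] \<phi>f[of c] ac a t'm'
    by (auto simp: t'_def[symmetric] m'_def[symmetric] E_def[symmetric] Hom_def)
  have univ: "\<exists>z\<in>Hom C E W. t' \<cdot> z = x \<and> m' \<cdot> z = y"
    if xy: "x \<in> Hom C (Cod C m) W" "y \<in> Hom C T W" "m \<cdot> x = t \<cdot> y" for W x y
  proof -
    note axy = Hom_arr[OF xy(1)] Hom_arr[OF xy(2)]
    let ?f = "Add C (p1 \<cdot> x) (p2 \<cdot> y)"
    have f: "?f \<in> Arr C" "Dom C ?f = P" "Cod C ?f = W" "i1 \<cdot> ?f = x" "i2 \<cdot> ?f = y"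
      using axy b by auto
    have "\<phi> \<cdot> ?f = Zero C (Dom C m) W" using \<phi>f[of ?f] f(1,2) xy(3) axy a unfolding f(4,5) by simp
    then obtain z where z: "z \<in> Hom C E W" "c \<cdot> z = ?f"
      using cokernel_desc[OF c, of ?f W] f \<phi> by (auto simp: Hom_def E_def)
    have "t' \<cdot> z = i1 \<cdot> ?f" "m' \<cdot> z = i2 \<cdot> ?f"
      using Hom_arr[OF z(1)] b ac by (auto simp: t'_def m'_def z(2)[symmetric] E_def)
    then show ?thesis using z f by metis
  qed
  have uniq: "z = z'" if z: "z \<in> Hom C E W" "z' \<in> Hom C E W" "t' \<cdot> z = t' \<cdot> z'" "m' \<cdot> z = m' \<cdot> z'"
    for W z z'
  proof -
    have "c \<cdot> z = c \<cdot> z'"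
      using split[of "c \<cdot> z"] split[of "c \<cdot> z'"] z(3,4) Hom_arr[OF z(1)] Hom_arr[OF z(2)] b ac
      by (auto simp: t'_def m'_def E_def)
    then show ?thesis using epiD[OF cokernel_is_epi[OF c], of z W z'] z by (auto simp: E_def)
  qed
  obtain e' where e': "e' \<in> Hom C E (Cod C e)" "t' \<cdot> e' = e" "m' \<cdot> e' = Zero C T (Cod C e)"
    using univ[of e "Cod C e" "Zero C T (Cod C e)"] a by (auto simp: Hom_def)
  note ae = Hom_arr[OF e'(1)]
  have mono\<phi>: "is_mono C \<phi>"
    unfolding is_mono_iff
  proof (intro conjI allI ballI impI)
    fix W g assume g: "g \<in> Hom C W (Dom C \<phi>)" "g \<cdot> \<phi> = Zero C W (Cod C \<phi>)"
    have "g \<cdot> m = (g \<cdot> \<phi>) \<cdot> p1" using Hom_arr[OF g(1)] \<phi> b by simp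
    also have "\<dots> = Zero C W (Cod C m)" using Hom_arr[OF g(1)] \<phi> b g(2) by simp
    finally show "g = Zero C W (Dom C \<phi>)"
      using ses_mono[OF s] g(1) \<phi> by (simp add: is_mono_iff)
  qed (use \<phi> in auto)
  have s\<phi>: "ses C \<phi> c" using is_cokernel_mono_ses[OF c mono\<phi>] .
  have monom: "is_mono C m'"
    unfolding is_mono_iff
  proof (intro conjI allI ballI impI)
    fix W g assume g: "g \<in> Hom C W (Dom C m')" "g \<cdot> m' = Zero C W (Cod C m')"
    note ag = Hom_arr[OF g(1)]
    have g': "g \<in> Arr C" "Dom C g = W" "Cod C g = T" using ag t'm' by auto
    have "(g \<cdot> i2) \<cdot> c = Zero C W (Cod C c)" using g(2) g' t'm' b ac by (simp add: m'_def)
    then obtain y where y: "y \<in> Hom C W (Dom C m)" "y \<cdot> \<phi> = g \<cdot> i2"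
      using ses_lift[OF s\<phi>, of "g \<cdot> i2" W] g' b \<phi> by (auto simp: Hom_def)
    note ay = Hom_arr[OF y(1)]
    \<comment> \<open>The first component of \<open>g i2\<close> is zero, so \<open>y\<close> is
      zero, and with it the second component, which is \<open>g\<close>.\<close>
    have "y \<cdot> m = (y \<cdot> \<phi>) \<cdot> p1" using ay \<phi> b by simp
    also have "\<dots> = Zero C W (Cod C m)" using y(2) g' b ag a by simp
    finally have y0: "y = Zero C W (Dom C m)"
      using ses_mono[OF s] y(1) by (simp add: is_mono_iff)
    have "g = (g \<cdot> i2) \<cdot> p2" using g' b by simp
    also have "\<dots> = Zero C W T" unfolding y(2)[symmetric] y0 using \<phi> b ag a by simp
    finally show "g = Zero C W (Dom C m')" using t'm' by simp
  qed (use t'm' in auto)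
  have "is_cokernel C m' e'"
    unfolding is_cokernel_def
  proof (intro conjI ballI impI)
    fix W g assume W: "W \<in> Ob C" and g: "g \<in> Hom C (Cod C m') W" "m' \<cdot> g = Zero C (Dom C m') W"
    have g': "g \<in> Arr C" "Dom C g = E" "Cod C g = W" using g t'm' by (auto simp: Hom_def)
    have "m \<cdot> (t' \<cdot> g) = t \<cdot> (m' \<cdot> g)" using comm[THEN post, of "Dom C m" "Cod C m" E g] a t'm' g'
      by (auto simp: Hom_def)
    then have "m \<cdot> (t' \<cdot> g) = Zero C (Dom C m) W" using g(2) a t'm' W by simp
    then obtain h where h: "h \<in> Hom C (Cod C e) W" "e \<cdot> h = t' \<cdot> g"
      using ses_desc[OF s, of "t' \<cdot> g" W] t'm' g' by (auto simp: Hom_def)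
    note ah = Hom_arr[OF h(1)]
    have "t' \<cdot> (e' \<cdot> h) = t' \<cdot> g" using e'(2)[THEN post, of "Cod C m" E "Cod C e" h] ah t'm' ae h(2)
      by (auto simp: Hom_def)
    moreover have "m' \<cdot> (e' \<cdot> h) = m' \<cdot> g"
      using e'(3)[THEN post, of T E "Cod C e" h] ah t'm' ae g(2) a by (auto simp: Hom_def)
    ultimately have eh: "e' \<cdot> h = g" using uniq[of "e' \<cdot> h" W g] g' ae ah by (auto simp: Hom_def)
    have hu: "h' = h" if h': "h' \<in> Hom C (Cod C e) W" "e' \<cdot> h' = g" for h'
    proof -
      have "e \<cdot> h' = t' \<cdot> (e' \<cdot> h')"
        using e'(2)[THEN post, of "Cod C m" E "Cod C e" h'] Hom_arr[OF h'(1)] ae t'm'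
        by (auto simp: Hom_def)
      then have "e \<cdot> h' = e \<cdot> h" by (simp only: h(2) h'(2))
      then show ?thesis by (rule ses_epiD[OF s h'(1) h(1)])
    qed
    show "\<exists>!h. h \<in> Hom C (Cod C e') W \<and> e' \<cdot> h = g"
      using h(1) eh ae by (intro ex1I[of _ h] conjI hu) auto
  qed (use e' ae t'm' in auto)
  then have "ses C m' e'" using is_cokernel_mono_ses monom by blast
  then show ?thesis using that[of m' e' E t'] e' comm univ uniq t'm' by (auto simp: Hom_def)
qed

lemma pullback_ses:
  assumes s: "ses C m e" and t: "t \<in> Hom C T (Cod C e)"
  obtains m' e' E t' where "ses C m' e'" "e' \<in> Hom C E T" "m' \<in> Hom C (Dom C m) E"
    "t' \<in> Hom C E (Cod C m)" "t' \<cdot> e = e' \<cdot> t" "m' \<cdot> t' = m"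
    "\<And>W x y. \<lbrakk>x \<in> Hom C W (Cod C m); y \<in> Hom C W T; x \<cdot> e = y \<cdot> t\<rbrakk> \<Longrightarrow>
       \<exists>z\<in>Hom C W E. z \<cdot> t' = x \<and> z \<cdot> e' = y"
    "\<And>W z z'. \<lbrakk>z \<in> Hom C W E; z' \<in> Hom C W E; z \<cdot> t' = z' \<cdot> t'; z \<cdot> e' = z' \<cdot> e'\<rbrakk> \<Longrightarrow> z = z'"
proof -
  obtain m' e' E t' where "ses (opc C) m' e'" "m' \<in> Hom (opc C) T E" "e' \<in> Hom (opc C) E (Cod (opc C) m)"
    "t' \<in> Hom (opc C) (Cod (opc C) e) E" "e \<cdot>\<^bsub>opc C\<^esub> t' = t \<cdot>\<^bsub>opc C\<^esub> m'" "t' \<cdot>\<^bsub>opc C\<^esub> e' = m"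
    "\<And>W x y. \<lbrakk>x \<in> Hom (opc C) (Cod (opc C) e) W; y \<in> Hom (opc C) T W; e \<cdot>\<^bsub>opc C\<^esub> x = t \<cdot>\<^bsub>opc C\<^esub> y\<rbrakk> \<Longrightarrow>
       \<exists>z\<in>Hom (opc C) E W. t' \<cdot>\<^bsub>opc C\<^esub> z = x \<and> m' \<cdot>\<^bsub>opc C\<^esub> z = y"
    "\<And>W z z'. \<lbrakk>z \<in> Hom (opc C) E W; z' \<in> Hom (opc C) E W; t' \<cdot>\<^bsub>opc C\<^esub> z = t' \<cdot>\<^bsub>opc C\<^esub> z';
       m' \<cdot>\<^bsub>opc C\<^esub> z = m' \<cdot>\<^bsub>opc C\<^esub> z'\<rbrakk> \<Longrightarrow> z = z'"
  proof (rule abelian_category.pushout_ses[OF abelian_category_opc', of e m t T], goal_cases)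
    case 1 show ?case using s by simp
  next
    case 2 show ?case using t by simp
  next
    case 3 show ?case by (rule 3(1)[OF 3(2-9)])
  qed
  then show ?thesis using that[of e' m' E t'] ses_arr[OF s] by simp
qed

end

section \<open>Chains of short exact sequences\<close>

text \<open>An exact sequence \<open>0 \<rightarrow> N \<rightarrow> E\<^sub>1 \<rightarrow> \<dots> \<rightarrow> E\<^sub>i \<rightarrow> X \<rightarrow> 0\<close> is cut into its short exact sequences
  \<open>(m, e)\<close>, listed from \<open>N\<close> to \<open>X\<close>.  In \<open>ladder C xs ys u w\<close> the arrow \<open>u\<close> goes between the initial
  objects and \<open>w\<close> between the final objects; \<open>kills C X xs t\<close> says that the class of \<open>xs\<close> becomes
  trivial when pushed out along \<open>t\<close>, and \<open>vanish C i X N\<close> is the resulting form of \<open>Ext\<^sup>i(X, N) = 0\<close>.\<close>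

fun chain :: "('o, 'm) addcat \<Rightarrow> 'o \<Rightarrow> 'o \<Rightarrow> ('m \<times> 'm) list \<Rightarrow> bool" where
  "chain C N X [] \<longleftrightarrow> N = X \<and> N \<in> Ob C"
| "chain C N X ((m, e) # xs) \<longleftrightarrow> ses C m e \<and> Dom C m = N \<and> chain C (Cod C e) X xs"

fun ladder :: "('o, 'm) addcat \<Rightarrow> ('m \<times> 'm) list \<Rightarrow> ('m \<times> 'm) list \<Rightarrow> 'm \<Rightarrow> 'm \<Rightarrow> bool" where
  "ladder C [] [] u w \<longleftrightarrow> u = w"
| "ladder C ((m, e) # xs) ((m', e') # ys) u w \<longleftrightarrow>
     (\<exists>v u'. v \<in> Hom C (Cod C m) (Cod C m') \<and> u' \<in> Hom C (Cod C e) (Cod C e') \<and>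
        m \<cdot>\<^bsub>C\<^esub> v = u \<cdot>\<^bsub>C\<^esub> m' \<and> e \<cdot>\<^bsub>C\<^esub> u' = v \<cdot>\<^bsub>C\<^esub> e' \<and> ladder C xs ys u' w)"
| "ladder C _ _ u w \<longleftrightarrow> False"

definition kills :: "('o, 'm) addcat \<Rightarrow> 'o \<Rightarrow> ('m \<times> 'm) list \<Rightarrow> 'm \<Rightarrow> bool" where
  "kills C X xs t \<longleftrightarrow> (\<exists>zs S. chain C (Cod C t) S zs \<and> ladder C xs zs t (Zero C X S))"

definition vanish :: "('o, 'm) addcat \<Rightarrow> nat \<Rightarrow> 'o \<Rightarrow> 'o \<Rightarrow> bool" where
  "vanish C i X N \<longleftrightarrow> (\<forall>xs. chain C N X xs \<and> length xs = i \<longrightarrow> kills C X xs (Idn C N))"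

lemma ladder_length: "ladder C xs ys u w \<Longrightarrow> length xs = length ys"
  by (induction C xs ys u w rule: ladder.induct) auto

lemma ladder_append:
  "length xs = length ys \<Longrightarrow>
    ladder C (xs @ xs') (ys @ ys') u w \<longleftrightarrow> (\<exists>u'. ladder C xs ys u u' \<and> ladder C xs' ys' u' w)"
proof (induction xs ys arbitrary: u rule: list_induct2)
  case (Cons x xs y ys)
  then show ?case by (cases x; cases y) auto
qed auto

section \<open>Composition and splitting of chains and ladders\<close>

context abelian_category
begin

lemma chain_Ob: "chain C N X xs \<Longrightarrow> N \<in> Ob C \<and> X \<in> Ob C"
proof (induction xs arbitrary: N)
  case (Cons x xs)
  then show ?case by (cases x) (auto dest: ses_arr)
qed auto

lemma chain_append: "chain C N X (xs @ ys) \<longleftrightarrow> (\<exists>K. chain C N K xs \<and> chain C K X ys)"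
proof (induction xs arbitrary: N)
  case Nil
  then show ?case using chain_Ob by auto
next
  case (Cons x xs)
  then show ?case by (cases x) auto
qed

lemma ladder_Hom:
  "\<lbrakk>chain C N X xs; chain C N' X' ys; u \<in> Hom C N N'; ladder C xs ys u w\<rbrakk> \<Longrightarrow> w \<in> Hom C X X'"
proof (induction C xs ys u w arbitrary: N N' rule: ladder.induct)
  case (2 C m e xs m' e' ys u w)
  then show ?case by auto
qed auto

lemma ladder_Idn: "chain C N X xs \<Longrightarrow> ladder C xs xs (Idn C N) (Idn C X)"
proof (induction xs arbitrary: N)
  case (Cons x xs)
  obtain m e where x: "x = (m, e)" by (cases x)
  have s: "ses C m e" "Dom C m = N" "chain C (Cod C e) X xs" using Cons.prems x by auto
  note a = ses_arr[OF s(1)]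
  show ?case unfolding x ladder.simps
    by (rule exI[of _ "Idn C (Cod C m)"], rule exI[of _ "Idn C (Cod C e)"])
      (use a s Cons.IH[OF s(3)] in \<open>auto intro: Idn_Hom\<close>)
qed auto

lemma ladder_comp:
  "\<lbrakk>chain C N1 X1 xs; chain C N2 X2 ys; chain C N3 X3 zs; u1 \<in> Hom C N1 N2; u2 \<in> Hom C N2 N3;
    ladder C xs ys u1 w1; ladder C ys zs u2 w2\<rbrakk> \<Longrightarrow> ladder C xs zs (u1 \<cdot> u2) (w1 \<cdot> w2)"
proof (induction xs arbitrary: N1 N2 N3 ys zs u1 u2)
  case Nil
  have "length ys = 0" "length zs = 0"
    using ladder_length[OF Nil(6)] ladder_length[OF Nil(7)] by auto
  then show ?case using Nil by auto
next
  case (Cons x xs)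
  obtain m1 e1 where x: "x = (m1, e1)" by (cases x)
  have "length ys = Suc (length xs)" "length zs = Suc (length xs)"
    using ladder_length[OF Cons.prems(6)] ladder_length[OF Cons.prems(7)] by auto
  then obtain m2 e2 ys' m3 e3 zs' where yz: "ys = (m2, e2) # ys'" "zs = (m3, e3) # zs'"
    by (metis length_Suc_conv surj_pair)
  obtain v1 u1' where 1: "v1 \<in> Hom C (Cod C m1) (Cod C m2)" "u1' \<in> Hom C (Cod C e1) (Cod C e2)"
    "m1 \<cdot> v1 = u1 \<cdot> m2" "e1 \<cdot> u1' = v1 \<cdot> e2" "ladder C xs ys' u1' w1"
    using Cons.prems(6) x yz by auto
  obtain v2 u2' where 2: "v2 \<in> Hom C (Cod C m2) (Cod C m3)" "u2' \<in> Hom C (Cod C e2) (Cod C e3)"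
    "m2 \<cdot> v2 = u2 \<cdot> m3" "e2 \<cdot> u2' = v2 \<cdot> e3" "ladder C ys' zs' u2' w2"
    using Cons.prems(7) x yz by auto
  have s: "ses C m1 e1" "Dom C m1 = N1" "ses C m2 e2" "Dom C m2 = N2" "ses C m3 e3" "Dom C m3 = N3"
    "chain C (Cod C e1) X1 xs" "chain C (Cod C e2) X2 ys'" "chain C (Cod C e3) X3 zs'"
    using Cons.prems(1-3) x yz by auto
  note a = ses_arr(1-3)[OF s(1)] ses_arr(1-3)[OF s(3)] ses_arr(1-3)[OF s(5)] s(2,4,6)
    1(1,2)[THEN Hom_arr(1)] 1(1,2)[THEN Hom_arr(2)] 1(1,2)[THEN Hom_arr(3)]
    2(1,2)[THEN Hom_arr(1)] 2(1,2)[THEN Hom_arr(2)] 2(1,2)[THEN Hom_arr(3)]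
    Cons.prems(4,5)[THEN Hom_arr(1)] Cons.prems(4,5)[THEN Hom_arr(2)] Cons.prems(4,5)[THEN Hom_arr(3)]
  have "m1 \<cdot> (v1 \<cdot> v2) = (u1 \<cdot> m2) \<cdot> v2" using a 1(3)[symmetric] by simp
  also have "\<dots> = (u1 \<cdot> u2) \<cdot> m3" using a 2(3) by simp
  finally have sq1: "m1 \<cdot> (v1 \<cdot> v2) = (u1 \<cdot> u2) \<cdot> m3" .
  have "e1 \<cdot> (u1' \<cdot> u2') = (v1 \<cdot> e2) \<cdot> u2'" using a 1(4)[symmetric] by simp
  also have "\<dots> = (v1 \<cdot> v2) \<cdot> e3" using a 2(4) by simp
  finally have sq2: "e1 \<cdot> (u1' \<cdot> u2') = (v1 \<cdot> v2) \<cdot> e3" .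
  have "ladder C xs zs' (u1' \<cdot> u2') (w1 \<cdot> w2)"
    using Cons.IH s 1 2 by blast
  then show ?case unfolding x yz ladder.simps using sq1 sq2 Comp_Hom 1 2 by blast
qed

section \<open>Enlarging targets; pushouts and pullbacks of chains\<close>

text \<open>The stand-in for injectivity: a map on a subobject extends once its target is embedded
  into the pushout.\<close>

lemma mono_extend:
  assumes s: "ses C m e" and t: "t \<in> Hom C (Dom C m) T"
  obtains E m' t' where "is_mono C m'" "m' \<in> Hom C T E" "t' \<in> Hom C (Cod C m) E" "m \<cdot> t' = t \<cdot> m'"
  by (rule pushout_ses[OF s t]) (use ses_mono that in blast)

text \<open>Two extension problems with the same target \<open>S\<close> are solved in one
  enlargement: each is pushed out separately, then both results are amalgamated over
  \<open>S\<close>.\<close>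

lemma mono_amalgam:
  assumes s: "ses C z d" "ses C y f" and a: "a1 \<in> Hom C (Dom C z) S" "a2 \<in> Hom C (Dom C y) S"
  obtains W q c1 c2 where "is_mono C q" "q \<in> Hom C S W" "c1 \<in> Hom C (Cod C z) W"
    "c2 \<in> Hom C (Cod C y) W" "z \<cdot> c1 = a1 \<cdot> q" "y \<cdot> c2 = a2 \<cdot> q"
proof -
  obtain P1 q1 d1 where 1: "is_mono C q1" "q1 \<in> Hom C S P1" "d1 \<in> Hom C (Cod C z) P1"
    "z \<cdot> d1 = a1 \<cdot> q1" using mono_extend[OF s(1) a(1)] .
  obtain P2 q2 d2 where 2: "is_mono C q2" "q2 \<in> Hom C S P2" "d2 \<in> Hom C (Cod C y) P2"
    "y \<cdot> d2 = a2 \<cdot> q2" using mono_extend[OF s(2) a(2)] .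
  obtain e1 where e1: "ses C q1 e1" using mono_ses 1 by blast
  obtain W q' c' where 3: "is_mono C q'" "q' \<in> Hom C P2 W" "c' \<in> Hom C (Cod C q1) W"
    "q1 \<cdot> c' = q2 \<cdot> q'" using mono_extend[OF e1, of q2 P2] 1 2 by (auto simp: Hom_def)
  have b: "q1 \<in> Arr C" "Dom C q1 = S" "Cod C q1 = P1" "d1 \<in> Arr C" "Dom C d1 = Cod C z" "Cod C d1 = P1"
    "q2 \<in> Arr C" "Dom C q2 = S" "Cod C q2 = P2" "d2 \<in> Arr C" "Dom C d2 = Cod C y" "Cod C d2 = P2"
    "q' \<in> Arr C" "Dom C q' = P2" "Cod C q' = W" "c' \<in> Arr C" "Dom C c' = P1" "Cod C c' = W"
    "a1 \<in> Arr C" "Dom C a1 = Dom C z" "Cod C a1 = S" "a2 \<in> Arr C" "Dom C a2 = Dom C y" "Cod C a2 = S"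
    "z \<in> Arr C" "y \<in> Arr C"
    using 1 2 3 a ses_arr(1)[OF s(1)] ses_arr(1)[OF s(2)] by (auto simp: Hom_def)
  show ?thesis
  proof (rule that[of "q2 \<cdot> q'" W "d1 \<cdot> c'" "d2 \<cdot> q'"])
    show "is_mono C (q2 \<cdot> q')" using is_mono_Comp 1 2 3 b by auto
    have "z \<cdot> (d1 \<cdot> c') = (a1 \<cdot> q1) \<cdot> c'" using b by (simp flip: 1(4))
    then show "z \<cdot> (d1 \<cdot> c') = a1 \<cdot> (q2 \<cdot> q')" using b 3(4) by simp
    have "y \<cdot> (d2 \<cdot> q') = (a2 \<cdot> q2) \<cdot> q'" using b by (simp flip: 2(4))
    then show "y \<cdot> (d2 \<cdot> q') = a2 \<cdot> (q2 \<cdot> q')" using b by simp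
  qed (use b in \<open>auto simp: Hom_def\<close>)
qed

text \<open>Only the first short exact sequence changes; a pushout keeps the quotient, so the ladder
  continues with identities.\<close>

lemma ladder_push:
  assumes "chain C N X xs" "xs \<noteq> []" "t \<in> Hom C N T"
  obtains ys where "chain C T X ys" "ladder C xs ys t (Idn C X)" "length ys = length xs" "ys \<noteq> []"
proof -
  obtain m e xs' where x: "xs = (m, e) # xs'" using assms(2) by (cases xs) auto
  have s: "ses C m e" "Dom C m = N" "chain C (Cod C e) X xs'" using assms x by auto
  obtain m' e' E t' where p: "ses C m' e'" "m' \<in> Hom C T E" "e' \<in> Hom C E (Cod C e)"
    "t' \<in> Hom C (Cod C m) E" "m \<cdot> t' = t \<cdot> m'" "t' \<cdot> e' = e"
    by (rule pushout_ses[OF s(1), of t T]) (use assms s in auto)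
  have "ladder C xs ((m', e') # xs') t (Idn C X)" unfolding x ladder.simps
    by (rule exI[of _ t'], rule exI[of _ "Idn C (Cod C e)"])
      (use p ladder_Idn[OF s(3)] ses_arr[OF s(1)] in \<open>auto simp: Hom_def\<close>)
  moreover have "chain C T X ((m', e') # xs')" using p s by (auto simp: Hom_def)
  ultimately show ?thesis using that[of "(m', e') # xs'"] x by simp
qed

text \<open>Only the last short exact sequence changes, and it keeps its kernel. The final clause is
  the universal property: it turns a factorisation of one arrow through \<open>t\<close> into a
  ladder to the pulled-back chain.\<close>

lemma ladder_pull:
  assumes "chain C N X xs" "xs \<noteq> []" "t \<in> Hom C T X"
  obtains ys where "chain C N T ys" "ladder C ys xs (Idn C N) t" "length ys = length xs"
    "\<And>zs L S u s. \<lbrakk>chain C L S zs; u \<in> Hom C L N; s \<in> Hom C S T; ladder C zs xs u (s \<cdot> t)\<rbrakk> \<Longrightarrow>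
       ladder C zs ys u s"
proof -
  have "\<exists>ys. chain C N T ys \<and> ladder C ys xs (Idn C N) t \<and> length ys = length xs \<and>
    (\<forall>zs L S u s. chain C L S zs \<and> u \<in> Hom C L N \<and> s \<in> Hom C S T \<and> ladder C zs xs u (s \<cdot> t) \<longrightarrow>
       ladder C zs ys u s)"
    using assms
  proof (induction xs arbitrary: N)
    case (Cons x xs)
    obtain m e where x: "x = (m, e)" by (cases x)
    have s: "ses C m e" "Dom C m = N" "chain C (Cod C e) X xs" using Cons.prems x by auto
    have N: "N \<in> Ob C" using ses_arr s by auto
    have t: "t \<in> Arr C" "Dom C t = T" "Cod C t = X" "T \<in> Ob C" using Hom_arr[OF Cons.prems(3)] by auto
    show ?case
    proof (cases "xs = []")
      case True
      have X: "Cod C e = X" using s True by auto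
      obtain m' e' E t' where p: "ses C m' e'" "e' \<in> Hom C E T" "m' \<in> Hom C (Dom C m) E"
        "t' \<in> Hom C E (Cod C m)" "t' \<cdot> e = e' \<cdot> t" "m' \<cdot> t' = m"
        and univ: "\<And>W x y. \<lbrakk>x \<in> Hom C W (Cod C m); y \<in> Hom C W T; x \<cdot> e = y \<cdot> t\<rbrakk> \<Longrightarrow>
          \<exists>z\<in>Hom C W E. z \<cdot> t' = x \<and> z \<cdot> e' = y"
        and uniq: "\<And>W z z'. \<lbrakk>z \<in> Hom C W E; z' \<in> Hom C W E; z \<cdot> t' = z' \<cdot> t'; z \<cdot> e' = z' \<cdot> e'\<rbrakk>
          \<Longrightarrow> z = z'"
        by (rule pullback_ses[OF s(1), of t T]) (use Cons.prems X in blast)+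
      note a = ses_arr[OF s(1)] s(2) X ses_arr[OF p(1)] p(2,3,4)[THEN Hom_arr(1)]
        p(2,3,4)[THEN Hom_arr(2)] p(2,3,4)[THEN Hom_arr(3)]
      have "chain C N T [(m', e')]" using p s a t by auto
      moreover have "ladder C [(m', e')] [(m, e)] (Idn C N) t"
        unfolding ladder.simps
        by (rule exI[of _ t'], rule exI[of _ t]) (use a p t in \<open>auto simp: Hom_def\<close>)
      moreover have "ladder C zs [(m', e')] u r"
        if z: "chain C L S zs" "u \<in> Hom C L N" "r \<in> Hom C S T" "ladder C zs [(m, e)] u (r \<cdot> t)"
        for zs L S u r
      proof -
        have "length zs = 1" using ladder_length[OF z(4)] by simp
        then obtain n f where zs: "zs = [(n, f)]" by (metis One_nat_def length_0_conv length_Suc_conv surj_pair)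
        have sn: "ses C n f" "Dom C n = L" "Cod C f = S" using z zs by auto
        obtain v where v: "v \<in> Hom C (Cod C n) (Cod C m)" "n \<cdot> v = u \<cdot> m" "f \<cdot> (r \<cdot> t) = v \<cdot> e"
          using z(4) zs by auto
        note b = ses_arr[OF sn(1)] sn(2,3) Hom_arr[OF v(1)] Hom_arr[OF z(2)] Hom_arr[OF z(3)]
        obtain y where y: "y \<in> Hom C (Cod C n) E" "y \<cdot> t' = v" "y \<cdot> e' = f \<cdot> r"
          using univ[of v "Cod C n" "f \<cdot> r"] v b t by (auto simp: Hom_def)
        note ay = Hom_arr[OF y(1)]
        \<comment> \<open>Both composites have the same projections from the pullback; the
          projection to \<open>T\<close> is zero for either.\<close>
        have ny: "n \<cdot> y = u \<cdot> m'"
        proof (rule uniq)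
          show "n \<cdot> y \<in> Hom C L E" "u \<cdot> m' \<in> Hom C L E" using a b ay by (auto simp: Hom_def)
          have "n \<cdot> y \<cdot> t' = n \<cdot> v" using a(1-14) b ay y(2) by (simp add: a)
          also have "\<dots> = u \<cdot> (m' \<cdot> t')" using v p by simp
          finally show "n \<cdot> y \<cdot> t' = u \<cdot> m' \<cdot> t'" using a b by (simp)
          have "n \<cdot> y \<cdot> e' = n \<cdot> (f \<cdot> r)" using a b ay y(3) by simp
          also have "\<dots> = n \<cdot> f \<cdot> r" using b by (subst Comp_assoc_Arr) auto
          also have "\<dots> = Zero C L T" using b a by simp
          also have "\<dots> = u \<cdot> m' \<cdot> e'" using a b by simp
          finally show "n \<cdot> y \<cdot> e' = u \<cdot> m' \<cdot> e'" .
        qed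
        show ?thesis unfolding zs ladder.simps
          by (rule exI[of _ y], rule exI[of _ r]) (use y ny a b sn in \<open>auto simp: Hom_def\<close>)
      qed
      ultimately show ?thesis unfolding True x by (intro exI[of _ "[(m', e')]"]) auto
    next
      case False
      obtain ys where ys: "chain C (Cod C e) T ys" "ladder C ys xs (Idn C (Cod C e)) t"
        "length ys = length xs"
        and univ: "\<And>zs L S u s. \<lbrakk>chain C L S zs; u \<in> Hom C L (Cod C e); s \<in> Hom C S T;
           ladder C zs xs u (s \<cdot> t)\<rbrakk> \<Longrightarrow> ladder C zs ys u s"
        using Cons.IH[OF s(3) False Cons.prems(3)] by blast
      note a = ses_arr[OF s(1)]
      have "ladder C ((m, e) # ys) ((m, e) # xs) (Idn C N) t" unfolding ladder.simps
        by (rule exI[of _ "Idn C (Cod C m)"], rule exI[of _ "Idn C (Cod C e)"])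
          (use a s ys in \<open>auto simp: Hom_def\<close>)
      moreover have "ladder C zs ((m, e) # ys) u r"
        if z: "chain C L S zs" "u \<in> Hom C L N" "r \<in> Hom C S T" "ladder C zs ((m, e) # xs) u (r \<cdot> t)"
        for zs L S u r
      proof -
        obtain n f zs' where zs: "zs = (n, f) # zs'"
          using ladder_length[OF z(4)] by (metis length_Suc_conv surj_pair list.size(4) add.commute plus_1_eq_Suc)
        obtain v u' where v: "v \<in> Hom C (Cod C n) (Cod C m)" "n \<cdot> v = u \<cdot> m" "f \<cdot> u' = v \<cdot> e"
          "u' \<in> Hom C (Cod C f) (Cod C e)" "ladder C zs' xs u' (r \<cdot> t)"
          using z(4) zs by auto
        have "ladder C zs' ys u' r" using univ v z zs by auto
        then show ?thesis using v zs by auto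
      qed
      ultimately show ?thesis unfolding x
        by (intro exI[of _ "(m, e) # ys"]) (use ys s in auto)
    qed
  qed simp
  then show ?thesis using that by blast
qed

section \<open>Homotopies and the comparison of coresolutions\<close>

text \<open>Here \<open>h\<close> acts as a homotopy: adding \<open>e h\<close> to the last middle
  arrow leaves the square on its left unchanged, because \<open>m e = 0\<close>.\<close>

lemma ladder_add:
  assumes "chain C N X xs" "chain C N' X' ys" "u \<in> Hom C N N'" "ladder C xs ys u w" "xs \<noteq> []"
    "h \<in> Hom C X (Cod C (fst (last ys)))"
  shows "ladder C xs ys u (Add C w (h \<cdot> snd (last ys)))"
  using assms
proof (induction xs arbitrary: N N' ys u)
  case (Cons x xs)
  obtain m e where x: "x = (m, e)" by (cases x)
  have "length ys = Suc (length xs)" using Cons.prems(4) ladder_length by force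
  then obtain m2 e2 ys' where y: "ys = (m2, e2) # ys'" by (metis length_Suc_conv surj_pair)
  obtain v u' where 1: "v \<in> Hom C (Cod C m) (Cod C m2)" "u' \<in> Hom C (Cod C e) (Cod C e2)"
    "m \<cdot> v = u \<cdot> m2" "e \<cdot> u' = v \<cdot> e2" "ladder C xs ys' u' w"
    using Cons.prems(4) x y by auto
  have s: "ses C m e" "Dom C m = N" "ses C m2 e2" "Dom C m2 = N'"
    "chain C (Cod C e) X xs" "chain C (Cod C e2) X' ys'"
    using Cons.prems(1,2) x y by auto
  show ?case
  proof (cases "xs = []")
    case True
    then have ys': "ys' = []" using ladder_length[OF 1(5)] by simp
    have X: "Cod C e = X" "u' = w" "h \<in> Hom C X (Cod C m2)" using s True ys' 1 Cons.prems(6) y by auto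
    note a = ses_arr[OF s(1)] ses_arr[OF s(3)] Hom_arr[OF 1(1)] Hom_arr[OF 1(2)] s(2,4)
      Hom_arr[OF Cons.prems(3)] Hom_arr[OF X(3)] X(1)
    have *: "m \<cdot> (e \<cdot> h) = Zero C N (Cod C m2)"
      using a(4)[THEN post, of N "Cod C m" "Cod C e" h] a by (auto simp: Hom_def)
    have "m \<cdot> Add C v (e \<cdot> h) = u \<cdot> m2" using a * 1(3) by simp
    moreover have "e \<cdot> Add C u' (h \<cdot> e2) = Add C v (e \<cdot> h) \<cdot> e2" using a 1(4) by simp
    moreover have "Add C v (e \<cdot> h) \<in> Hom C (Cod C m) (Cod C m2)"
      "Add C u' (h \<cdot> e2) \<in> Hom C (Cod C e) (Cod C e2)"
      using a by (auto simp: Hom_def)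
    ultimately show ?thesis unfolding x y True ys' using X by auto
  next
    case False
    then have "ys' \<noteq> []" using ladder_length[OF 1(5)] by auto
    then show ?thesis using Cons.IH[OF s(5,6) 1(2,5) False] Cons.prems(6) 1 unfolding x y by auto
  qed
qed simp

text \<open>One square of the comparison. The maps \<open>c1\<close> and \<open>c2\<close> descend
  to the cokernels, and so does the homotopy equation: the term through \<open>q\<close> dies
  against \<open>r\<close>, while \<open>g\<close> survives as the homotopy of the next
  square.\<close>

lemma comparison_step:
  assumes s: "ses C m e" "ses C z d" "ses C y f"
    and v: "v1 \<in> Hom C (Cod C m) (Cod C z)" "v2 \<in> Hom C (Cod C m) (Cod C y)"
    and u: "u1 \<in> Hom C (Cod C e) (Cod C d)" "u2 \<in> Hom C (Cod C e) (Cod C f)"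
    and sq: "e \<cdot> u1 = v1 \<cdot> d" "e \<cdot> u2 = v2 \<cdot> f"
    and c: "c1 \<in> Hom C (Cod C z) W" "c2 \<in> Hom C (Cod C y) W"
    and a: "a1 \<in> Hom C (Dom C z) S" "a2 \<in> Hom C (Dom C y) S"
    and q: "ses C q r" "q \<in> Hom C S W" and zq: "z \<cdot> c1 = a1 \<cdot> q" "y \<cdot> c2 = a2 \<cdot> q"
    and h: "h \<in> Hom C (Cod C m) S" and g: "g \<in> Hom C (Cod C e) W"
    and eq: "v1 \<cdot> c1 = Add C (Add C (v2 \<cdot> c2) (h \<cdot> q)) (e \<cdot> g)"
  obtains b1 b2 where "b1 \<in> Hom C (Cod C d) (Cod C r)" "b2 \<in> Hom C (Cod C f) (Cod C r)"
    "d \<cdot> b1 = c1 \<cdot> r" "f \<cdot> b2 = c2 \<cdot> r" "u1 \<cdot> b1 = Add C (u2 \<cdot> b2) (g \<cdot> r)"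
proof -
  note A = ses_arr[OF s(1)] ses_arr[OF s(2)] ses_arr[OF s(3)]
    v[THEN Hom_arr(1)] v[THEN Hom_arr(2)] v[THEN Hom_arr(3)]
    u[THEN Hom_arr(1)] u[THEN Hom_arr(2)] u[THEN Hom_arr(3)]
    c[THEN Hom_arr(1)] c[THEN Hom_arr(2)] c[THEN Hom_arr(3)]
    a[THEN Hom_arr(1)] a[THEN Hom_arr(2)] a[THEN Hom_arr(3)]
    h[THEN Hom_arr(1)] h[THEN Hom_arr(2)] h[THEN Hom_arr(3)]
    g[THEN Hom_arr(1)] g[THEN Hom_arr(2)] g[THEN Hom_arr(3)]
    q(2)[THEN Hom_arr(1)] q(2)[THEN Hom_arr(2)] q(2)[THEN Hom_arr(3)]
  have R: "r \<in> Arr C" "Dom C r = W" "q \<cdot> r = Zero C S (Cod C r)" "Cod C r \<in> Ob C"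
    using ses_arr[OF q(1)] A by auto
  have desc: "\<exists>b\<in>Hom C (Cod C d) (Cod C r). d \<cdot> b = c \<cdot> r"
    if "ses C z d" "c \<in> Hom C (Cod C z) W" "a \<in> Hom C (Dom C z) S" "z \<cdot> c = a \<cdot> q" for z d c a
  proof -
    note B = ses_arr[OF that(1)] Hom_arr[OF that(2)] Hom_arr[OF that(3)]
    have "z \<cdot> (c \<cdot> r) = a \<cdot> (q \<cdot> r)"
      using that(4)[THEN post, of "Dom C z" "Cod C z" W r] B R(1,2) A by (auto simp: Hom_def)
    then have "z \<cdot> (c \<cdot> r) = Zero C (Dom C z) (Cod C r)" using B R by simp
    then show ?thesis using ses_desc[OF that(1), of "c \<cdot> r" "Cod C r"] B R by (auto simp: Hom_def)
  qed
  obtain b1 where b1: "b1 \<in> Hom C (Cod C d) (Cod C r)" "d \<cdot> b1 = c1 \<cdot> r"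
    using desc[OF s(2) c(1) a(1) zq(1)] by blast
  obtain b2 where b2: "b2 \<in> Hom C (Cod C f) (Cod C r)" "f \<cdot> b2 = c2 \<cdot> r"
    using desc[OF s(3) c(2) a(2) zq(2)] by blast
  note B = Hom_arr[OF b1(1)] Hom_arr[OF b2(1)]
  have "e \<cdot> (u1 \<cdot> b1) = v1 \<cdot> (d \<cdot> b1)"
    using sq(1)[THEN post, of "Cod C m" "Cod C e" "Cod C d" b1] A B by (auto simp: Hom_def)
  also have "\<dots> = (v1 \<cdot> c1) \<cdot> r" unfolding b1(2) using A R by simp
  also have "\<dots> = Add C (v2 \<cdot> (c2 \<cdot> r)) (e \<cdot> (g \<cdot> r))" unfolding eq using A R by simp
  also have "v2 \<cdot> (c2 \<cdot> r) = e \<cdot> (u2 \<cdot> b2)" unfolding b2(2)[symmetric]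
    using sq(2)[THEN post, of "Cod C m" "Cod C e" "Cod C f" b2] A B by (auto simp: Hom_def)
  finally have *: "e \<cdot> (u1 \<cdot> b1) = e \<cdot> Add C (u2 \<cdot> b2) (g \<cdot> r)" using A B R by simp
  have "u1 \<cdot> b1 \<in> Hom C (Cod C e) (Cod C r)" "Add C (u2 \<cdot> b2) (g \<cdot> r) \<in> Hom C (Cod C e) (Cod C r)"
    using A B R by (auto simp: Hom_def)
  then have "u1 \<cdot> b1 = Add C (u2 \<cdot> b2) (g \<cdot> r)" using ses_epiD[OF s(1) _ _ *] by blast
  then show ?thesis using that b1 b2 by blast
qed

text \<open>The comparison lemma of homological algebra: any two coresolutions receiving the chain \<open>xs\<close>
  map to a common one, up to a homotopy whose last component is \<open>k\<close>.\<close>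

lemma comparison:
  assumes "chain C N X xs" "xs \<noteq> []" "chain C T1 S1 zs" "chain C T2 S2 ys"
    "t1 \<in> Hom C N T1" "t2 \<in> Hom C N T2" "ladder C xs zs t1 w1" "ladder C xs ys t2 w2"
    "a1 \<in> Hom C T1 S" "a2 \<in> Hom C T2 S" "h \<in> Hom C (Cod C (fst (hd xs))) S"
    "t1 \<cdot> a1 = Add C (t2 \<cdot> a2) (fst (hd xs) \<cdot> h)"
  shows "\<exists>ws R b1 b2 k. chain C S R ws \<and> ladder C zs ws a1 b1 \<and> ladder C ys ws a2 b2 \<and>
    k \<in> Hom C X (Cod C (fst (last ws))) \<and> ws \<noteq> [] \<and> b1 \<in> Hom C S1 R \<and> b2 \<in> Hom C S2 R \<and>
    w1 \<cdot> b1 = Add C (w2 \<cdot> b2) (k \<cdot> snd (last ws))"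
  using assms
proof (induction xs arbitrary: N T1 T2 S zs ys t1 t2 a1 a2 h)
  case (Cons x xs)
  obtain m e where x: "x = (m, e)" by (cases x)
  have "length zs = Suc (length xs)" "length ys = Suc (length xs)"
    using ladder_length[OF Cons.prems(7)] ladder_length[OF Cons.prems(8)] by auto
  then obtain z d zs' y f ys' where zy: "zs = (z, d) # zs'" "ys = (y, f) # ys'"
    by (metis length_Suc_conv surj_pair)
  obtain v1 u1 where 1: "v1 \<in> Hom C (Cod C m) (Cod C z)" "u1 \<in> Hom C (Cod C e) (Cod C d)"
    "m \<cdot> v1 = t1 \<cdot> z" "e \<cdot> u1 = v1 \<cdot> d" "ladder C xs zs' u1 w1"
    using Cons.prems(7) x zy by auto
  obtain v2 u2 where 2: "v2 \<in> Hom C (Cod C m) (Cod C y)" "u2 \<in> Hom C (Cod C e) (Cod C f)"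
    "m \<cdot> v2 = t2 \<cdot> y" "e \<cdot> u2 = v2 \<cdot> f" "ladder C xs ys' u2 w2"
    using Cons.prems(8) x zy by auto
  have s: "ses C m e" "Dom C m = N" "ses C z d" "Dom C z = T1" "ses C y f" "Dom C y = T2"
    "chain C (Cod C e) X xs" "chain C (Cod C d) S1 zs'" "chain C (Cod C f) S2 ys'"
    using Cons.prems(1,3,4) x zy by auto
  have h: "h \<in> Hom C (Cod C m) S" "t1 \<cdot> a1 = Add C (t2 \<cdot> a2) (m \<cdot> h)"
    using Cons.prems(11,12) x by auto
  obtain W0 q0 p1 p2 where am: "is_mono C q0" "q0 \<in> Hom C S W0" "p1 \<in> Hom C (Cod C z) W0"
    "p2 \<in> Hom C (Cod C y) W0" "z \<cdot> p1 = a1 \<cdot> q0" "y \<cdot> p2 = a2 \<cdot> q0"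
    by (rule mono_amalgam[OF s(3,5), of a1 S a2]) (use Cons.prems s in auto)
  note a = ses_arr[OF s(1)] ses_arr[OF s(3)] ses_arr[OF s(5)] s(2,4,6)
    Cons.prems(5,6,9,10)[THEN Hom_arr(1)] Cons.prems(5,6,9,10)[THEN Hom_arr(2)]
    Cons.prems(5,6,9,10)[THEN Hom_arr(3)] Hom_arr[OF h(1)]
    1(1,2)[THEN Hom_arr(1)] 1(1,2)[THEN Hom_arr(2)] 1(1,2)[THEN Hom_arr(3)]
    2(1,2)[THEN Hom_arr(1)] 2(1,2)[THEN Hom_arr(2)] 2(1,2)[THEN Hom_arr(3)]
    am(2-4)[THEN Hom_arr(1)] am(2-4)[THEN Hom_arr(2)] am(2-4)[THEN Hom_arr(3)]
  \<comment> \<open>On \<open>m\<close> the map \<open>v1 p1\<close> agrees with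
    \<open>v2 p2 + h q0\<close>, so the two differ by a map \<open>g0\<close> on the quotient, the
    next component of the homotopy.\<close>
  have "m \<cdot> (v1 \<cdot> p1) = (m \<cdot> v1) \<cdot> p1" using a by (subst Comp_assoc_Arr) auto
  also have "\<dots> = t1 \<cdot> (z \<cdot> p1)" unfolding 1(3) using a by simp
  also have "\<dots> = (t1 \<cdot> a1) \<cdot> q0" unfolding am(5) using a by simp
  also have "\<dots> = Add C (t2 \<cdot> (a2 \<cdot> q0)) (m \<cdot> (h \<cdot> q0))" unfolding h(2) using a by simp
  also have "t2 \<cdot> (a2 \<cdot> q0) = (t2 \<cdot> y) \<cdot> p2" unfolding am(6)[symmetric] using a by simp
  also have "\<dots> = m \<cdot> (v2 \<cdot> p2)" unfolding 2(3)[symmetric] using a by simp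
  finally have *: "m \<cdot> (v1 \<cdot> p1) = m \<cdot> Add C (v2 \<cdot> p2) (h \<cdot> q0)" using a by simp
  have "v1 \<cdot> p1 \<in> Hom C (Cod C m) W0" "Add C (v2 \<cdot> p2) (h \<cdot> q0) \<in> Hom C (Cod C m) W0"
    using a by (auto simp: Hom_def)
  then obtain g0 where g0: "g0 \<in> Hom C (Cod C e) W0"
    "v1 \<cdot> p1 = Add C (Add C (v2 \<cdot> p2) (h \<cdot> q0)) (e \<cdot> g0)"
    using ses_desc_diff[OF s(1) _ _ *] by blast
  show ?case
  \<comment> \<open>At the end of \<open>xs\<close> the map \<open>g0\<close> itself is the
    component \<open>k\<close>; otherwise it has to be extended along the next monomorphism.\<close>
  proof (cases xs)
    case Nil
    then have zy': "zs' = []" "ys' = []" using ladder_length[OF 1(5)] ladder_length[OF 2(5)] by auto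
    have e: "u1 = w1" "u2 = w2" "Cod C e = X" "Cod C d = S1" "Cod C f = S2"
      using 1 2 Nil zy' s by auto
    obtain r where r: "ses C q0 r" using mono_ses am by blast
    obtain b1 b2 where b: "b1 \<in> Hom C (Cod C d) (Cod C r)" "b2 \<in> Hom C (Cod C f) (Cod C r)"
      "d \<cdot> b1 = p1 \<cdot> r" "f \<cdot> b2 = p2 \<cdot> r" "u1 \<cdot> b1 = Add C (u2 \<cdot> b2) (g0 \<cdot> r)"
      by (rule comparison_step[OF s(1,3,5) 1(1) 2(1) 1(2) 2(2) 1(4) 2(4) am(3,4) _ _ r am(2) am(5,6)
          h(1) g0]) (use Cons.prems(9,10) s in auto)
    have "chain C S (Cod C r) [(q0, r)]" using r a ses_arr[OF r] by auto
    moreover have "ladder C zs [(q0, r)] a1 b1" "ladder C ys [(q0, r)] a2 b2"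
      unfolding zy zy' ladder.simps using b am a by auto
    ultimately show ?thesis using b e g0 a
      by (intro exI[of _ "[(q0, r)]"] exI[of _ "Cod C r"] exI[of _ b1] exI[of _ b2] exI[of _ g0]) auto
  next
    case (Cons x2 xs2)
    obtain m' e' where x2: "x2 = (m', e')" by (cases x2)
    have s': "ses C m' e'" "Dom C m' = Cod C e" using s Cons x2 by auto
    \<comment> \<open>Extending \<open>g0\<close> from the source of \<open>m'\<close> to its target
      costs a further enlargement \<open>j\<close>, so \<open>q0 j\<close> replaces
      \<open>q0\<close>.\<close>
    obtain W j g' where j: "is_mono C j" "j \<in> Hom C W0 W" "g' \<in> Hom C (Cod C m') W" "m' \<cdot> g' = g0 \<cdot> j"
      by (rule mono_extend[OF s'(1), of g0 W0]) (use g0 s' in auto)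
    note a' = a Hom_arr[OF j(2)] Hom_arr[OF j(3)] Hom_arr[OF g0(1)] ses_arr[OF s'(1)] s'(2)
    have "is_mono C (q0 \<cdot> j)" using is_mono_Comp am j a' by auto
    then obtain r where r: "ses C (q0 \<cdot> j) r" using mono_ses by blast
    have qj: "q0 \<cdot> j \<in> Hom C S W" "p1 \<cdot> j \<in> Hom C (Cod C z) W" "p2 \<cdot> j \<in> Hom C (Cod C y) W"
      "g0 \<cdot> j \<in> Hom C (Cod C e) W"
      using a' by (auto simp: Hom_def)
    have zj: "z \<cdot> (p1 \<cdot> j) = a1 \<cdot> (q0 \<cdot> j)" "y \<cdot> (p2 \<cdot> j) = a2 \<cdot> (q0 \<cdot> j)"
      using am(5)[THEN post, of T1 "Cod C z" W0 j] am(6)[THEN post, of T2 "Cod C y" W0 j] a'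
      by (auto simp: Hom_def)
    have "v1 \<cdot> (p1 \<cdot> j) = (v1 \<cdot> p1) \<cdot> j" using a' by simp
    then have gj: "v1 \<cdot> (p1 \<cdot> j) = Add C (Add C (v2 \<cdot> (p2 \<cdot> j)) (h \<cdot> (q0 \<cdot> j))) (e \<cdot> (g0 \<cdot> j))"
      unfolding g0(2) using a' by simp
    obtain b1 b2 where b: "b1 \<in> Hom C (Cod C d) (Cod C r)" "b2 \<in> Hom C (Cod C f) (Cod C r)"
      "d \<cdot> b1 = (p1 \<cdot> j) \<cdot> r" "f \<cdot> b2 = (p2 \<cdot> j) \<cdot> r" "u1 \<cdot> b1 = Add C (u2 \<cdot> b2) ((g0 \<cdot> j) \<cdot> r)"
      by (rule comparison_step[OF s(1,3,5) 1(1) 2(1) 1(2) 2(2) 1(4) 2(4) qj(2,3) _ _ r qj(1) zj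
          h(1) qj(4) gj]) (use Cons.prems(9,10) s in auto)
    have ar: "r \<in> Arr C" "Dom C r = W" "Cod C r \<in> Ob C" using ses_arr[OF r] a' by auto
    have "(g0 \<cdot> j) \<cdot> r = m' \<cdot> (g' \<cdot> r)" unfolding j(4)[symmetric] using a' ar by simp
    then have ub: "u1 \<cdot> b1 = Add C (u2 \<cdot> b2) (fst (hd xs) \<cdot> (g' \<cdot> r))" using b(5) Cons x2 by simp
    have g'r: "g' \<cdot> r \<in> Hom C (Cod C (fst (hd xs))) (Cod C r)" using a' ar Cons x2 by (auto simp: Hom_def)
    obtain ws R c1 c2 k where w: "chain C (Cod C r) R ws" "ladder C zs' ws b1 c1" "ladder C ys' ws b2 c2"
      "k \<in> Hom C X (Cod C (fst (last ws)))" "ws \<noteq> []" "c1 \<in> Hom C S1 R" "c2 \<in> Hom C S2 R"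
      "w1 \<cdot> c1 = Add C (w2 \<cdot> c2) (k \<cdot> snd (last ws))"
      using Cons.IH[OF s(7) _ s(8,9) 1(2) 2(2) 1(5) 2(5) b(1,2) g'r ub] Cons by blast
    have "chain C S R ((q0 \<cdot> j, r) # ws)" using r w a' by auto
    moreover have "ladder C zs ((q0 \<cdot> j, r) # ws) a1 c1" "ladder C ys ((q0 \<cdot> j, r) # ws) a2 c2"
      unfolding zy ladder.simps using b(1-4) qj zj w(2,3) a' by (auto intro: exI)
    ultimately show ?thesis using w
      by (intro exI[of _ "(q0 \<cdot> j, r) # ws"] exI[of _ R] exI[of _ c1] exI[of _ c2] exI[of _ k]) auto
  qed
qed simp

section \<open>Triviality of extension classes\<close>

lemma killsI: "\<lbrakk>chain C T S zs; t \<in> Hom C N T; ladder C xs zs t (Zero C X S)\<rbrakk> \<Longrightarrow> kills C X xs t"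
  unfolding kills_def by (auto simp: Hom_def)

lemma killsE:
  assumes "kills C X xs t" "t \<in> Hom C N T"
  obtains zs S where "chain C T S zs" "ladder C xs zs t (Zero C X S)"
  using assms unfolding kills_def by (auto simp: Hom_def)

text \<open>The ladder composes with the one that witnesses triviality, and zero absorbs its final
  arrow.\<close>

lemma kills_forward:
  assumes "chain C N X xs" "chain C N' X' ys" "u \<in> Hom C N N'" "t \<in> Hom C N' T" "ladder C xs ys u w"
    "kills C X' ys t"
  shows "kills C X xs (u \<cdot> t)"
proof -
  obtain zs S where z: "chain C T S zs" "ladder C ys zs t (Zero C X' S)"
    using killsE[OF assms(6,4)] .
  have w: "w \<in> Hom C X X'" using ladder_Hom assms by blast
  have "S \<in> Ob C" using chain_Ob z by blast
  then have "w \<cdot> Zero C X' S = Zero C X S" using Hom_arr[OF w] by simp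
  then show ?thesis
    using killsI[OF z(1), of "u \<cdot> t" N] ladder_comp[OF assms(1,2) z(1) assms(3,4,5) z(2)]
      Comp_Hom[OF assms(3,4)] by simp
qed

text \<open>Subtracting the homotopy \<open>h\<close> makes the final arrow zero, so a
  null-homotopic final arrow suffices for triviality.\<close>

lemma kills_homotopic:
  assumes "chain C N X xs" "chain C T S zs" "xs \<noteq> []" "t \<in> Hom C N T" "ladder C xs zs t (h \<cdot> snd (last zs))"
    "h \<in> Hom C X (Cod C (fst (last zs)))"
  shows "ladder C xs zs t (Zero C X S)"
proof -
  have ls: "zs \<noteq> []" using ladder_length[OF assms(5)] assms(3) by auto
  then obtain zs' m e where zs: "zs = zs' @ [(m, e)]" by (metis rev_exhaust surj_pair)
  have s: "ses C m e" "Cod C e = S" using assms(2) zs by (auto simp: chain_append)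
  note a = ses_arr[OF s(1)] s(2) Hom_arr[OF assms(6)]
  have h: "h \<in> Hom C X (Cod C m)" using assms(6) zs by simp
  have "ladder C xs zs t (Add C (h \<cdot> snd (last zs)) (Neg C h \<cdot> snd (last zs)))"
    using ladder_add[OF assms(1,2,4,5,3)] Neg_Hom assms(6) by blast
  moreover have "Add C (h \<cdot> snd (last zs)) (Neg C h \<cdot> snd (last zs)) = Zero C X S"
    using a zs Hom_arr[OF h] by simp
  ultimately show ?thesis by simp
qed

text \<open>Killing is tested against the class of the extension, so it does not distinguish
  equivalent extensions; the two chain maps to compare are the given one and zero.\<close>

lemma kills_backward:
  assumes xs: "chain C N X xs" "xs \<noteq> []" and ys: "chain C N' X ys" and u: "u \<in> Hom C N N'"
    and t: "t \<in> Hom C N' T" and lad: "ladder C xs ys u (Idn C X)" and k: "kills C X xs (u \<cdot> t)"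
  shows "kills C X ys t"
proof -
  have ysne: "ys \<noteq> []" using ladder_length[OF lad] xs by auto
  \<comment> \<open>\<open>ps\<close> represents the class of \<open>ys\<close> pushed out along
    \<open>t\<close>. Starting from the same \<open>u t\<close>, the chain \<open>xs\<close> maps to
    \<open>ps\<close> with final identity and to \<open>zs\<close> with final zero.\<close>
  obtain ps where p: "chain C T X ps" "ladder C ys ps t (Idn C X)"
    using ladder_push[OF ys ysne t] by blast
  have ut: "u \<cdot> t \<in> Hom C N T" using Comp_Hom u t by blast
  obtain zs S where z: "chain C T S zs" "ladder C xs zs (u \<cdot> t) (Zero C X S)"
    using killsE[OF k ut] .
  have X: "X \<in> Ob C" "T \<in> Ob C" "S \<in> Ob C" using chain_Ob xs z by blast+
  have xp: "ladder C xs ps (u \<cdot> t) (Idn C X)"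
    using ladder_comp[OF xs(1) ys p(1) u t lad p(2)] X by simp
  obtain m e xs' where x: "xs = (m, e) # xs'" using xs(2) by (metis neq_Nil_conv surj_pair)
  have m: "ses C m e" "Dom C m = N" using xs x by auto
  \<comment> \<open>Since both ladders start with \<open>u t\<close>, the comparison begins with the
    zero homotopy.\<close>
  have "u \<cdot> t \<cdot> Idn C T = Add C (u \<cdot> t \<cdot> Idn C T) (fst (hd xs) \<cdot> Zero C (Cod C m) T)"
    using x ses_arr[OF m(1)] m(2) X Hom_arr[OF ut] by simp
  moreover have "Zero C (Cod C m) T \<in> Hom C (Cod C (fst (hd xs))) T"
    using x ses_arr[OF m(1)] X Zero_Hom by simp
  ultimately obtain ws R b1 b2 h where w: "chain C T R ws" "ladder C ps ws (Idn C T) b1"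
    "ladder C zs ws (Idn C T) b2"
    "h \<in> Hom C X (Cod C (fst (last ws)))" "ws \<noteq> []" "b1 \<in> Hom C X R" "b2 \<in> Hom C S R"
    "Idn C X \<cdot> b1 = Add C (Zero C X S \<cdot> b2) (h \<cdot> snd (last ws))"
    using comparison[OF xs p(1) z(1) ut ut xp z(2) Idn_Hom[OF X(2)] Idn_Hom[OF X(2)]] by blast
  obtain ws' q r where ws: "ws = ws' @ [(q, r)]" by (metis w(5) rev_exhaust surj_pair)
  have q: "ses C q r" "Cod C r = R" using w(1) ws by (auto simp: chain_append)
  \<comment> \<open>The contribution of \<open>zs\<close> is zero, so the image of \<open>X\<close>
    in \<open>R\<close> is a pure boundary.\<close>
  have "b1 = h \<cdot> snd (last ws)"
    using w(8) Hom_arr[OF w(6)] Hom_arr[OF w(7)] Hom_arr[OF w(4)] X ws ses_arr[OF q(1)] q(2) by simp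
  moreover have "ladder C ys ws (t \<cdot> Idn C T) (Idn C X \<cdot> b1)"
    using ladder_comp[OF ys p(1) w(1) t Idn_Hom[OF X(2)] p(2) w(2)] .
  ultimately have "ladder C ys ws t (h \<cdot> snd (last ws))"
    using Hom_arr[OF t] Hom_arr[OF w(6)] by simp
  then have "ladder C ys ws t (Zero C X R)" using kills_homotopic[OF ys w(1) ysne t _ w(4)] by blast
  then show ?thesis using killsI w t by blast
qed

text \<open>The pushout of \<open>xs\<close> along \<open>t\<close> represents an element of
  \<open>Ext^i(X, T)\<close>, and \<open>xs\<close> maps to it by a ladder starting with
  \<open>t\<close>.\<close>

lemma vanish_kills:
  assumes "vanish C i X T" "chain C N X xs" "length xs = i" "i \<ge> 1" "t \<in> Hom C N T"
  shows "kills C X xs t"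
proof -
  have ne: "xs \<noteq> []" using assms by auto
  obtain ys where y: "chain C T X ys" "ladder C xs ys t (Idn C X)" "length ys = length xs"
    using ladder_push[OF assms(2) ne assms(5)] by blast
  have "kills C X ys (Idn C T)" using assms y by (simp add: vanish_def)
  then have "kills C X xs (t \<cdot> Idn C T)"
    using kills_forward[OF assms(2) y(1) assms(5) _ y(2)] Idn_Hom Hom_arr[OF assms(5)] by blast
  then show ?thesis using Hom_arr[OF assms(5)] by simp
qed

lemma Add_Neg_cancel:
  assumes "f \<in> Hom C X Y" "g \<in> Hom C X Y"
  shows "Add C (Add C f g) (Neg C f) = g"
proof -
  have "Add C (Add C f g) (Neg C f) = Add C g (Add C f (Neg C f))"
    using assms Hom_arr(1-3)[OF assms(1)] Hom_arr(1-3)[OF assms(2)]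
    by (subst Add_commute[OF assms]) (simp add: Add_assoc_Arr)
  then show ?thesis using Hom_arr[OF assms(1)] Hom_arr[OF assms(2)] by simp
qed

lemma ladder_comp_Idn:
  assumes "chain C N X1 xs" "chain C N X2 ys" "chain C N X3 zs"
    "ladder C xs ys (Idn C N) w1" "ladder C ys zs (Idn C N) w2"
  shows "ladder C xs zs (Idn C N) (w1 \<cdot> w2)"
proof -
  have N: "N \<in> Ob C" using chain_Ob assms by blast
  then show ?thesis
    using ladder_comp[OF assms(1-3) Idn_Hom[OF N] Idn_Hom[OF N] assms(4,5)] by simp
qed

section \<open>Adding and removing the last short exact sequence\<close>

text \<open>With \<open>kills_snocI\<close> this replaces exactness of
  \<open>Ext^j(E, T) -> Ext^j(K, T) -> Ext^(j+1)(X, T)\<close> for \<open>j = length xs\<close>: a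
  class that dies when spliced with \<open>(m, e)\<close> is represented by a map on
  \<open>K\<close> that factors through \<open>m\<close>.\<close>

lemma kills_snocE:
  assumes xs: "chain C N K xs" and s: "ses C m e" "Dom C m = K" and t: "t \<in> Hom C N T"
    and k: "kills C (Cod C e) (xs @ [(m, e)]) t"
  obtains zs D v where "chain C T D zs" "length zs = length xs" "v \<in> Hom C (Cod C m) D"
    "ladder C xs zs t (m \<cdot> v)"
proof -
  obtain ws S where w: "chain C T S ws" "ladder C (xs @ [(m, e)]) ws t (Zero C (Cod C e) S)"
    using killsE[OF k t] .
  have "length ws = Suc (length xs)" using ladder_length[OF w(2)] by simp
  then obtain zs z p where ws: "ws = zs @ [(z, p)]" "length zs = length xs"
    by (metis length_Suc_conv_rev surj_pair)
  obtain u where u: "ladder C xs zs t u" "ladder C [(m, e)] [(z, p)] u (Zero C (Cod C e) S)"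
    using w(2) ladder_append[OF ws(2)[symmetric]] ws(1) by metis
  have z: "chain C T (Dom C z) zs" "ses C z p" "Cod C p = S"
    using w(1) ws by (auto simp: chain_append)
  have uH: "u \<in> Hom C K (Dom C z)" using ladder_Hom[OF xs z(1) t u(1)] .
  obtain v where v: "v \<in> Hom C (Cod C m) (Cod C z)" "m \<cdot> v = u \<cdot> z" "e \<cdot> Zero C (Cod C e) S = v \<cdot> p"
    using u(2) by auto
  note a = ses_arr[OF s(1)] s(2) ses_arr[OF z(2)] z(3) Hom_arr[OF v(1)] Hom_arr[OF uH]
  \<comment> \<open>The last square ends in zero, so \<open>p\<close> kills \<open>v\<close> and
    \<open>v\<close> lifts to the kernel \<open>z\<close>.\<close>
  have "v \<cdot> p = Zero C (Cod C m) (Cod C p)" using v(3)[symmetric] a by simp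
  then obtain v' where v': "v' \<in> Hom C (Cod C m) (Dom C z)" "v' \<cdot> z = v"
    using ses_lift[OF z(2) v(1)] by blast
  note a' = a Hom_arr[OF v'(1)]
  have "(m \<cdot> v') \<cdot> z = u \<cdot> z" using v(2) v'(2) a' by simp
  then have "m \<cdot> v' = u" using ses_monoD[OF z(2), of "m \<cdot> v'" K u] a' by (auto simp: Hom_def)
  then show ?thesis using that z(1) ws(2) v'(1) u(1) by blast
qed

text \<open>Prolonging \<open>zs\<close> by the trivial sequence \<open>D -> D -> 0\<close> leaves
  only zero as final arrow.\<close>

lemma kills_snocI:
  assumes xs: "chain C N K xs" and s: "ses C m e" "Dom C m = K" and t: "t \<in> Hom C N T"
    and zs: "chain C T D zs" and v: "v \<in> Hom C (Cod C m) D" and l: "ladder C xs zs t (m \<cdot> v)"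
  shows "kills C (Cod C e) (xs @ [(m, e)]) t"
proof -
  obtain Z where Z: "zero_object C Z" using ex_zero_object by blast
  then have ZO: "Z \<in> Ob C" by (simp add: zero_object_def)
  have D: "D \<in> Ob C" using chain_Ob zs by blast
  have i: "ses C (Idn C D) (Zero C D Z)" using Idn_Zero_ses[OF D Z] .
  note a = ses_arr[OF s(1)] s(2) Hom_arr[OF v]
  have "ladder C [(m, e)] [(Idn C D, Zero C D Z)] (m \<cdot> v) (Zero C (Cod C e) Z)"
    unfolding ladder.simps
    by (rule exI[of _ v], rule exI[of _ "Zero C (Cod C e) Z"])
      (use a ZO in \<open>auto simp: Hom_def\<close>)
  then have "ladder C (xs @ [(m, e)]) (zs @ [(Idn C D, Zero C D Z)]) t (Zero C (Cod C e) Z)"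
    using ladder_append[OF ladder_length[OF l]] l by blast
  moreover have "chain C T Z (zs @ [(Idn C D, Zero C D Z)])"
    using zs i D ZO by (auto simp: chain_append)
  ultimately show ?thesis using killsI t by blast
qed

text \<open>Dimension shifting for a single class: \<open>xs\<close> maps to a coresolution of
  \<open>T\<close> with final arrow \<open>m v\<close>, hence to its pullback along
  \<open>v\<close>. That is an extension of \<open>Cod C m\<close> by \<open>T\<close>, trivial by
  \<open>V\<close>.\<close>

lemma kills_butlast:
  assumes xs: "chain C N K xs" "xs \<noteq> []" and s: "ses C m e" "Dom C m = K" and t: "t \<in> Hom C N T"
    and k: "kills C (Cod C e) (xs @ [(m, e)]) t" and V: "vanish C (length xs) (Cod C m) T"
  shows "kills C K xs t"
proof -
  obtain zs D v where z: "chain C T D zs" "length zs = length xs" "v \<in> Hom C (Cod C m) D"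
    "ladder C xs zs t (m \<cdot> v)"
    using kills_snocE[OF xs(1) s t k] .
  have zne: "zs \<noteq> []" using z(2) xs(2) by auto
  obtain ys where y: "chain C T (Cod C m) ys" "length ys = length zs"
    and univ: "\<And>zs' L S u s. \<lbrakk>chain C L S zs'; u \<in> Hom C L T; s \<in> Hom C S (Cod C m);
       ladder C zs' zs u (s \<cdot> v)\<rbrakk> \<Longrightarrow> ladder C zs' ys u s"
    using ladder_pull[OF z(1) zne z(3)] by metis
  have m: "m \<in> Hom C K (Cod C m)" using ses_arr[OF s(1)] s(2) by (simp add: Hom_def)
  have "ladder C xs ys t m" using univ[OF xs(1) t m z(4)] .
  moreover have "kills C (Cod C m) ys (Idn C T)" using V y z(2) by (simp add: vanish_def)
  ultimately have "kills C K xs (t \<cdot> Idn C T)"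
    using kills_forward[OF xs(1) y(1) t] Idn_Hom Hom_arr[OF t] by blast
  then show ?thesis using Hom_arr[OF t] by simp
qed

text \<open>In degree one the pushed-out class is the obstruction to extending \<open>t\<close>. In
  \<open>kills_snocE\<close> the chain \<open>xs\<close> is empty, so \<open>zs\<close> is empty too
  and \<open>D = T\<close>.\<close>

lemma kills_extends:
  assumes "ses C m e" "t \<in> Hom C (Dom C m) T" "kills C (Cod C e) [(m, e)] t"
  obtains s where "s \<in> Hom C (Cod C m) T" "m \<cdot> s = t"
proof -
  have "chain C (Dom C m) (Dom C m) []" using ses_arr[OF assms(1)] by simp
  then obtain zs D v where "chain C T D zs" "length zs = length ([] :: ('b \<times> 'b) list)"
    "v \<in> Hom C (Cod C m) D" "ladder C [] zs t (m \<cdot> v)"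
    using kills_snocE[of "Dom C m" "Dom C m" "[]" m e t T] assms by auto
  then show ?thesis using that by simp
qed

lemma ladder_Zero:
  "\<lbrakk>chain C N X xs; chain C T S zs; length xs = length zs\<rbrakk> \<Longrightarrow>
    ladder C xs zs (Zero C N T) (Zero C X S)"
proof (induction xs arbitrary: N T zs)
  case (Cons x xs)
  obtain m e where x: "x = (m, e)" by (cases x)
  obtain z p zs' where zs: "zs = (z, p) # zs'" using Cons.prems(3) by (metis length_Suc_conv surj_pair)
  have s: "ses C m e" "Dom C m = N" "chain C (Cod C e) X xs" "ses C z p" "Dom C z = T"
    "chain C (Cod C p) S zs'" using Cons.prems x zs by auto
  note a = ses_arr[OF s(1)] ses_arr[OF s(4)] s(2,5)
  show ?case unfolding x zs ladder.simps
    by (rule exI[of _ "Zero C (Cod C m) (Cod C z)"], rule exI[of _ "Zero C (Cod C e) (Cod C p)"])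
      (use a Cons.IH[OF s(3,6)] Cons.prems(3) x zs in \<open>auto simp: Hom_def\<close>)
qed auto

text \<open>Take \<open>s z\<close> as first middle arrow; \<open>p\<close> kills it, so all later
  arrows may be zero. It will be applied to chains whose first monomorphism splits.\<close>

lemma ladder_extends:
  assumes "chain C N X ((m, e) # xs)" "chain C T S zs" "length zs = Suc (length xs)"
    "s \<in> Hom C (Cod C m) T"
  shows "ladder C ((m, e) # xs) zs (m \<cdot> s) (Zero C X S)"
proof -
  obtain z p zs' where zs: "zs = (z, p) # zs'" using assms(3) by (metis length_Suc_conv surj_pair)
  have c: "ses C m e" "Dom C m = N" "chain C (Cod C e) X xs" "ses C z p" "Dom C z = T"
    "chain C (Cod C p) S zs'" using assms zs by auto
  note a = ses_arr[OF c(1)] ses_arr[OF c(4)] c(2,5) Hom_arr[OF assms(4)]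
  show ?thesis unfolding zs ladder.simps
    by (rule exI[of _ "s \<cdot> z"], rule exI[of _ "Zero C (Cod C e) (Cod C p)"])
      (use a ladder_Zero[OF c(3,6)] assms(3) zs in \<open>auto simp: Hom_def\<close>)
qed

text \<open>By pullback, a map \<open>c\<close> into the last term of a coresolution of
  \<open>T\<close> represents a class in \<open>Ext^i(L, T)\<close>. If that class is trivial,
  \<open>c\<close> becomes a boundary in a larger coresolution.\<close>

lemma ladder_coboundary:
  assumes zs: "chain C T S zs" "zs \<noteq> []" and c: "c \<in> Hom C L S" and V: "vanish C (length zs) L T"
  obtains ws R w h where "chain C T R ws" "ladder C zs ws (Idn C T) w" "w \<in> Hom C S R" "ws \<noteq> []"
    "h \<in> Hom C L (Cod C (fst (last ws)))" "c \<cdot> w = h \<cdot> snd (last ws)"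
proof -
  have T: "T \<in> Ob C" using chain_Ob zs by blast
  obtain xs where x: "chain C T L xs" "length xs = length zs" "ladder C xs zs (Idn C T) c"
    using ladder_pull[OF zs c] by metis
  have xne: "xs \<noteq> []" using x zs by auto
  have "kills C L xs (Idn C T)" using V x by (simp add: vanish_def)
  then obtain ys R' where y: "chain C T R' ys" "ladder C xs ys (Idn C T) (Zero C L R')"
    using killsE Idn_Hom[OF T] by blast
  obtain m e xs' where x': "xs = (m, e) # xs'" using xne by (metis neq_Nil_conv surj_pair)
  have m: "ses C m e" "Dom C m = T" using x x' by auto
  note I = Idn_Hom[OF T]
  \<comment> \<open>The two ladders out of \<open>xs\<close>, ending in \<open>c\<close> and in
    zero, both start with the identity, so the homotopy starts with zero.\<close>
  have h: "Zero C (Cod C m) T \<in> Hom C (Cod C (fst (hd xs))) T"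
    "Idn C T \<cdot> Idn C T = Add C (Idn C T \<cdot> Idn C T) (fst (hd xs) \<cdot> Zero C (Cod C m) T)"
    using x' ses_arr[OF m(1)] m(2) T Zero_Hom by simp_all
  obtain ws R b1 b2 k where w: "chain C T R ws" "ladder C zs ws (Idn C T) b1"
    "k \<in> Hom C L (Cod C (fst (last ws)))" "ws \<noteq> []" "b1 \<in> Hom C S R" "b2 \<in> Hom C R' R"
    "c \<cdot> b1 = Add C (Zero C L R' \<cdot> b2) (k \<cdot> snd (last ws))"
    using comparison[OF x(1) xne zs(1) y(1) I I x(3) y(2) I I h] by blast
  obtain ws' q r where ws: "ws = ws' @ [(q, r)]" by (metis w(4) rev_exhaust surj_pair)
  have q: "ses C q r" "Cod C r = R" using w(1) ws by (auto simp: chain_append)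
  have "c \<cdot> b1 = k \<cdot> snd (last ws)"
    using w(7) Hom_arr[OF w(6)] Hom_arr[OF w(3)] Hom_arr[OF c] ws ses_arr[OF q(1)] q(2) by simp
  then show ?thesis using that w by blast
qed

section \<open>Dimension shifting\<close>

text \<open>\<open>E1\<close> and \<open>E2\<close> are two copies of the pullback of
  \<open>e\<close> and \<open>b\<close>, formed from \<open>(m, e)\<close> and from
  \<open>(a, b)\<close>, so that each exhibits one of the kernels. The map \<open>\<theta>\<close>
  compares them, and \<open>m2\<close> includes the other kernel in \<open>E2\<close>.\<close>

lemma bicartesian:
  assumes s: "ses C m e" "ses C a b" "Cod C e = Cod C b"
  obtains m1 e1 E1 E2 \<kappa> \<pi> \<theta> m2 where "ses C m1 e1" "m1 \<in> Hom C (Dom C m) E1" "e1 \<in> Hom C E1 (Cod C a)"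
    "ses C \<kappa> \<pi>" "\<kappa> \<in> Hom C (Dom C a) E2" "\<pi> \<in> Hom C E2 (Cod C m)" "\<theta> \<in> Hom C E2 E1"
    "m2 \<in> Hom C (Dom C m) E2" "m2 \<cdot> \<pi> = m" "m2 \<cdot> \<theta> = m1" "\<kappa> \<cdot> (\<theta> \<cdot> e1) = a" "m2 \<cdot> (\<theta> \<cdot> e1) = Zero C (Dom C m) (Cod C a)"
proof -
  note A = ses_arr[OF s(1)] ses_arr[OF s(2)]
  obtain m1 e1 E1 p1 where 1: "ses C m1 e1" "e1 \<in> Hom C E1 (Cod C a)" "m1 \<in> Hom C (Dom C m) E1"
    "p1 \<in> Hom C E1 (Cod C m)" "p1 \<cdot> e = e1 \<cdot> b" "m1 \<cdot> p1 = m"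
    and univ1: "\<And>W x y. \<lbrakk>x \<in> Hom C W (Cod C m); y \<in> Hom C W (Cod C a); x \<cdot> e = y \<cdot> b\<rbrakk> \<Longrightarrow>
      \<exists>z\<in>Hom C W E1. z \<cdot> p1 = x \<and> z \<cdot> e1 = y"
    and uniq1: "\<And>W z z'. \<lbrakk>z \<in> Hom C W E1; z' \<in> Hom C W E1; z \<cdot> p1 = z' \<cdot> p1; z \<cdot> e1 = z' \<cdot> e1\<rbrakk>
      \<Longrightarrow> z = z'"
    by (rule pullback_ses[OF s(1), of b "Cod C a"]) (use A s(3) in \<open>auto simp: Hom_def\<close>)
  obtain \<kappa> \<pi> E2 e2 where 2: "ses C \<kappa> \<pi>" "\<pi> \<in> Hom C E2 (Cod C m)" "\<kappa> \<in> Hom C (Dom C a) E2"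
    "e2 \<in> Hom C E2 (Cod C a)" "e2 \<cdot> b = \<pi> \<cdot> e" "\<kappa> \<cdot> e2 = a"
    and univ2: "\<And>W x y. \<lbrakk>x \<in> Hom C W (Cod C a); y \<in> Hom C W (Cod C m); x \<cdot> b = y \<cdot> e\<rbrakk> \<Longrightarrow>
      \<exists>z\<in>Hom C W E2. z \<cdot> e2 = x \<and> z \<cdot> \<pi> = y"
    by (rule pullback_ses[OF s(2), of e "Cod C m"]) (use A s(3) in \<open>auto simp: Hom_def\<close>)
  obtain \<theta> where th: "\<theta> \<in> Hom C E2 E1" "\<theta> \<cdot> p1 = \<pi>" "\<theta> \<cdot> e1 = e2"
    using univ1[OF 2(2,4)] 2(5) by auto
  obtain m2 where m2: "m2 \<in> Hom C (Dom C m) E2" "m2 \<cdot> e2 = Zero C (Dom C m) (Cod C a)" "m2 \<cdot> \<pi> = m"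
    using univ2[of "Zero C (Dom C m) (Cod C a)" "Dom C m" m] A s(3) by (auto simp: Hom_def)
  note B = A ses_arr[OF 1(1)] Hom_arr[OF 1(2)] Hom_arr[OF 1(3)] Hom_arr[OF 1(4)] Hom_arr[OF 2(4)]
    Hom_arr[OF 2(2)] Hom_arr[OF 2(3)] Hom_arr[OF th(1)] Hom_arr[OF m2(1)]
  have "m2 \<cdot> \<theta> = m1"
  proof (rule uniq1)
    show "m2 \<cdot> \<theta> \<in> Hom C (Dom C m) E1" "m1 \<in> Hom C (Dom C m) E1" using B by (auto simp: Hom_def)
    have "m2 \<cdot> \<theta> \<cdot> p1 = m2 \<cdot> (\<theta> \<cdot> p1)" using B by (subst Comp_assoc_Arr) auto
    then show "m2 \<cdot> \<theta> \<cdot> p1 = m1 \<cdot> p1" unfolding th(2) m2(3) 1(6) .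
    have "m2 \<cdot> \<theta> \<cdot> e1 = m2 \<cdot> (\<theta> \<cdot> e1)" using B by (subst Comp_assoc_Arr) auto
    then show "m2 \<cdot> \<theta> \<cdot> e1 = m1 \<cdot> e1" unfolding th(3) m2(2) using B by simp
  qed
  then show ?thesis using that 1 2 th m2 by simp
qed

text \<open>The next two lemmas are dimension shifting along \<open>Ext\<^sup>i(L, N) \<rightarrow> Ext\<^bsup>i+1\<^esup>(L', N) \<rightarrow> Ext\<^bsup>i+1\<^esup>(E, N)\<close>
  for a short exact sequence \<open>0 \<rightarrow> L \<rightarrow> E \<rightarrow> L' \<rightarrow> 0\<close>.\<close>

lemma vanish_shift_one:
  assumes s: "ses C a b" and V: "vanish C 1 (Cod C a) N"
    and ext: "\<And>g. g \<in> Hom C (Dom C a) N \<Longrightarrow> \<exists>h\<in>Hom C (Cod C a) N. g = a \<cdot> h"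
  shows "vanish C 1 (Cod C b) N"
  unfolding vanish_def
proof (intro allI impI, elim conjE)
  fix xs assume xs: "chain C N (Cod C b) xs" "length xs = 1"
  obtain m e where x: "xs = [(m, e)]" using xs(2) by (metis One_nat_def length_0_conv length_Suc_conv surj_pair)
  have m: "ses C m e" "Dom C m = N" "Cod C e = Cod C b" using xs x by auto
  have N: "N \<in> Ob C" using ses_arr m by auto
  obtain m1 e1 E1 E2 \<kappa> \<pi> \<theta> m2 where b: "ses C m1 e1" "m1 \<in> Hom C (Dom C m) E1" "e1 \<in> Hom C E1 (Cod C a)"
    "ses C \<kappa> \<pi>" "\<kappa> \<in> Hom C (Dom C a) E2" "\<pi> \<in> Hom C E2 (Cod C m)" "\<theta> \<in> Hom C E2 E1"
    "m2 \<in> Hom C (Dom C m) E2" "m2 \<cdot> \<pi> = m" "m2 \<cdot> \<theta> = m1" "\<kappa> \<cdot> (\<theta> \<cdot> e1) = a"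
    "m2 \<cdot> (\<theta> \<cdot> e1) = Zero C (Dom C m) (Cod C a)"
    using bicartesian[OF m(1) s m(3)] .
  note A = ses_arr[OF m(1)] ses_arr[OF s] ses_arr[OF b(1)] ses_arr[OF b(4)] m(2)
    b(2,3,5-8)[THEN Hom_arr(1)] b(2,3,5-8)[THEN Hom_arr(2)] b(2,3,5-8)[THEN Hom_arr(3)] N
  have "kills C (Cod C a) [(m1, e1)] (Idn C N)" using V A b(1) by (auto simp: vanish_def)
  then obtain r where r: "r \<in> Hom C E1 N" "m1 \<cdot> r = Idn C N"
    using kills_extends[OF b(1), of "Idn C N" N] A by (auto simp: Hom_def)
  \<comment> \<open>The retraction \<open>r\<close> of \<open>m1\<close> may be nonzero on the
    kernel of \<open>\<pi>\<close>. Its restriction there extends over \<open>a\<close> by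
    \<open>ext\<close>, and subtracting the extension leaves a map that descends to
    \<open>y\<close>.\<close>
  have "\<kappa> \<cdot> (\<theta> \<cdot> r) \<in> Hom C (Dom C a) N" using A Hom_arr[OF r(1)] by (auto simp: Hom_def)
  then obtain h where h: "h \<in> Hom C (Cod C a) N" "\<kappa> \<cdot> (\<theta> \<cdot> r) = a \<cdot> h" using ext by blast
  note B = A Hom_arr[OF r(1)] Hom_arr[OF h(1)]
  have "\<kappa> \<cdot> (\<theta> \<cdot> r) = \<kappa> \<cdot> ((\<theta> \<cdot> e1) \<cdot> h)" unfolding h(2) b(11)[symmetric] using B by simp
  moreover have "\<theta> \<cdot> r \<in> Hom C (Cod C \<kappa>) N" "(\<theta> \<cdot> e1) \<cdot> h \<in> Hom C (Cod C \<kappa>) N"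
    using B by (auto simp: Hom_def)
  ultimately obtain y where y: "y \<in> Hom C (Cod C \<pi>) N" "\<theta> \<cdot> r = Add C ((\<theta> \<cdot> e1) \<cdot> h) (\<pi> \<cdot> y)"
    using ses_desc_diff[OF b(4)] by blast
  note D = B Hom_arr[OF y(1)]
  \<comment> \<open>The correction through \<open>Cod C a\<close> is zero on \<open>m2\<close>, so
    \<open>y\<close> retracts \<open>m\<close>.\<close>
  have "Idn C N = (m2 \<cdot> \<theta>) \<cdot> r" using r(2) b(10) by simp
  also have "\<dots> = m2 \<cdot> (\<theta> \<cdot> r)" using D by simp
  also have "\<dots> = Add C ((m2 \<cdot> (\<theta> \<cdot> e1)) \<cdot> h) ((m2 \<cdot> \<pi>) \<cdot> y)" unfolding y(2) using D by simp
  also have "\<dots> = m \<cdot> y" unfolding b(12,9) using D by simp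
  finally have "ladder C [] [] (Idn C N) (m \<cdot> y)" by simp
  then show "kills C (Cod C b) xs (Idn C N)"
    using kills_snocI[of N N "[]" m e "Idn C N" N N "[]" y] m x D Idn_Hom[OF N] y by simp
qed

lemma vanish_shift:
  assumes s: "ses C a b" and i: "i \<ge> 1" and VL: "vanish C i (Dom C a) N"
    and VE: "vanish C (Suc i) (Cod C a) N"
  shows "vanish C (Suc i) (Cod C b) N"
  unfolding vanish_def
proof (intro allI impI, elim conjE)
  fix xs' assume xs': "chain C N (Cod C b) xs'" "length xs' = Suc i"
  obtain xs m e where x: "xs' = xs @ [(m, e)]" "length xs = i"
    using xs'(2) by (metis length_Suc_conv_rev surj_pair)
  have m: "chain C N (Dom C m) xs" "ses C m e" "Cod C e = Cod C b" using xs' x by (auto simp: chain_append)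
  have xne: "xs \<noteq> []" using x i by auto
  have N: "N \<in> Ob C" using chain_Ob m by blast
  note I = Idn_Hom[OF N]
  obtain m1 e1 E1 E2 \<kappa> \<pi> \<theta> m2 where b: "ses C m1 e1" "m1 \<in> Hom C (Dom C m) E1" "e1 \<in> Hom C E1 (Cod C a)"
    "ses C \<kappa> \<pi>" "\<kappa> \<in> Hom C (Dom C a) E2" "\<pi> \<in> Hom C E2 (Cod C m)" "\<theta> \<in> Hom C E2 E1"
    "m2 \<in> Hom C (Dom C m) E2" "m2 \<cdot> \<pi> = m" "m2 \<cdot> \<theta> = m1"
    using bicartesian[OF m(2) s m(3)] .
  note A = ses_arr[OF m(2)] ses_arr[OF s] ses_arr[OF b(1)] ses_arr[OF b(4)]
    b(2,3,5-8)[THEN Hom_arr(1)] b(2,3,5-8)[THEN Hom_arr(2)] b(2,3,5-8)[THEN Hom_arr(3)] N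
  \<comment> \<open>Pulled back to \<open>Cod C a\<close> the class is trivial by \<open>VE\<close>;
    this yields a map \<open>v\<close> through which the final arrow of \<open>xs\<close> extends
    over \<open>m1\<close>.\<close>
  have "chain C N (Cod C a) (xs @ [(m1, e1)])" using m A b(1) by (auto simp: chain_append)
  then have "kills C (Cod C a) (xs @ [(m1, e1)]) (Idn C N)" using VE x by (simp add: vanish_def)
  moreover have e1: "Cod C e1 = Cod C a" "Dom C m1 = Dom C m" "Cod C m1 = E1" using A by auto
  ultimately obtain zs D v where z: "chain C N D zs" "length zs = length xs" "v \<in> Hom C E1 D"
    "ladder C xs zs (Idn C N) (m1 \<cdot> v)"
    using kills_snocE[OF m(1) b(1) _ I] by metis
  have zne: "zs \<noteq> []" using z xne by auto
  \<comment> \<open>The restriction of \<open>v\<close> to \<open>Dom C a\<close> represents a class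
    in degree \<open>i\<close>. By \<open>VL\<close> it becomes a boundary \<open>h r\<close> once
    \<open>zs\<close> is enlarged to \<open>ws\<close>.\<close>
  have c: "\<kappa> \<cdot> (\<theta> \<cdot> v) \<in> Hom C (Dom C a) D" using A Hom_arr[OF z(3)] by (auto simp: Hom_def)
  obtain ws R w h where w: "chain C N R ws" "ladder C zs ws (Idn C N) w" "w \<in> Hom C D R" "ws \<noteq> []"
    "h \<in> Hom C (Dom C a) (Cod C (fst (last ws)))" "\<kappa> \<cdot> (\<theta> \<cdot> v) \<cdot> w = h \<cdot> snd (last ws)"
    by (rule ladder_coboundary[OF z(1) zne c]) (use VL z x in auto)
  obtain us q r where ws: "ws = us @ [(q, r)]" by (metis w(4) rev_exhaust surj_pair)
  have q: "chain C N (Dom C q) us" "ses C q r" "Cod C r = R" using w(1) ws by (auto simp: chain_append)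
  have h: "h \<in> Hom C (Dom C a) (Cod C q)" "\<kappa> \<cdot> (\<theta> \<cdot> v) \<cdot> w = h \<cdot> r" using w(5,6) ws by auto
  \<comment> \<open>To subtract that boundary on all of \<open>E2\<close>, the map \<open>h\<close>
    must be extended along \<open>\<kappa>\<close>; for this \<open>Cod C q\<close> is enlarged by
    \<open>j\<close>.\<close>
  obtain W j k where j: "is_mono C j" "j \<in> Hom C (Cod C q) W" "k \<in> Hom C (Cod C \<kappa>) W" "\<kappa> \<cdot> k = h \<cdot> j"
    by (rule mono_extend[OF b(4), of h "Cod C q"]) (use h A in auto)
  note B = A ses_arr[OF q(2)] q(3) Hom_arr[OF z(3)] Hom_arr[OF w(3)] Hom_arr[OF h(1)] Hom_arr[OF j(2)]
    Hom_arr[OF j(3)]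
  have "is_mono C (q \<cdot> j)" using is_mono_Comp[of q j] ses_mono[OF q(2)] j(1) B by simp
  then obtain r' where r': "ses C (q \<cdot> j) r'" using mono_ses by blast
  have ar': "r' \<in> Arr C" "Dom C r' = W" "(q \<cdot> j) \<cdot> r' = Zero C (Dom C q) (Cod C r')" "Cod C r' \<in> Ob C"
    using ses_arr[OF r'] B by auto
  have "q \<cdot> (j \<cdot> r') = Zero C (Dom C q) (Cod C r')" using ar' B by simp
  then obtain l where l: "l \<in> Hom C (Cod C r) (Cod C r')" "r \<cdot> l = j \<cdot> r'"
    using ses_desc[OF q(2), of "j \<cdot> r'" "Cod C r'"] B ar' by (auto simp: Hom_def)
  note D = B ar' Hom_arr[OF l(1)]
  define ws' where "ws' = us @ [(q \<cdot> j, r')]"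
  have last: "fst (last ws') = q \<cdot> j" "snd (last ws') = r'" by (auto simp: ws'_def)
  have chws: "chain C N (Cod C r') ws'" using q r' D by (auto simp: ws'_def chain_append)
  have "ladder C [(q, r)] [(q \<cdot> j, r')] (Idn C (Dom C q)) l" unfolding ladder.simps
    by (rule exI[of _ j], rule exI[of _ l]) (use D l in \<open>auto simp: Hom_def\<close>)
  then have "ladder C ws ws' (Idn C N) l"
    unfolding ws ws'_def using ladder_append[of us us] ladder_Idn[OF q(1)] by blast
  then have lad: "ladder C xs ws' (Idn C N) (m1 \<cdot> v \<cdot> w \<cdot> l)"
    using ladder_comp_Idn[OF m(1) w(1) chws ladder_comp_Idn[OF m(1) z(1) w(1) z(4) w(2)]] by simp
  have "\<kappa> \<cdot> (\<theta> \<cdot> (v \<cdot> (w \<cdot> l))) = (\<kappa> \<cdot> (\<theta> \<cdot> v) \<cdot> w) \<cdot> l" using D by simp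
  also have "\<dots> = h \<cdot> (r \<cdot> l)" unfolding h(2) using D by simp
  also have "\<dots> = (h \<cdot> j) \<cdot> r'" unfolding l(2) using D by simp
  also have "\<dots> = \<kappa> \<cdot> (k \<cdot> r')" unfolding j(4)[symmetric] using D by simp
  finally have eq: "\<kappa> \<cdot> (\<theta> \<cdot> (v \<cdot> (w \<cdot> l))) = \<kappa> \<cdot> (k \<cdot> r')" .
  have "\<theta> \<cdot> (v \<cdot> (w \<cdot> l)) \<in> Hom C (Cod C \<kappa>) (Cod C r')" "k \<cdot> r' \<in> Hom C (Cod C \<kappa>) (Cod C r')"
    using D by (auto simp: Hom_def)
  \<comment> \<open>After subtracting \<open>k r'\<close> the map vanishes on
    \<open>\<kappa>\<close>, so it descends along \<open>\<pi>\<close>.\<close>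
  then obtain y where y: "y \<in> Hom C (Cod C \<pi>) (Cod C r')"
    "\<theta> \<cdot> (v \<cdot> (w \<cdot> l)) = Add C (k \<cdot> r') (\<pi> \<cdot> y)"
    using ses_desc_diff[OF b(4) _ _ eq] by blast
  note F = D Hom_arr[OF y(1)]
  have "m1 \<cdot> v \<cdot> w \<cdot> l = m2 \<cdot> (\<theta> \<cdot> (v \<cdot> (w \<cdot> l)))" unfolding b(10)[symmetric] using F by simp
  also have "\<dots> = Add C ((m2 \<cdot> k) \<cdot> r') ((m2 \<cdot> \<pi>) \<cdot> y)" unfolding y(2) using F by simp
  finally have eq2: "m1 \<cdot> v \<cdot> w \<cdot> l = Add C ((m2 \<cdot> k) \<cdot> r') (m \<cdot> y)" unfolding b(9) .
  \<comment> \<open>The leftover \<open>m2 k r'\<close> is itself a boundary for \<open>xs\<close>.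
    Once it is removed, the final arrow factors through \<open>m\<close>, as
    \<open>kills_snocI\<close> requires.\<close>
  have "Neg C (m2 \<cdot> k) \<in> Hom C (Dom C m) (Cod C (fst (last ws')))"
    unfolding last using F by (auto simp: Hom_def)
  then have "ladder C xs ws' (Idn C N) (Add C (m1 \<cdot> v \<cdot> w \<cdot> l) (Neg C (m2 \<cdot> k) \<cdot> snd (last ws')))"
    using ladder_add[OF m(1) chws I lad xne] by blast
  moreover have "Add C (m1 \<cdot> v \<cdot> w \<cdot> l) (Neg C (m2 \<cdot> k) \<cdot> snd (last ws')) = m \<cdot> y"
    unfolding eq2 last
    using Add_Neg_cancel[of "(m2 \<cdot> k) \<cdot> r'" "Dom C m" "Cod C r'" "m \<cdot> y"] F by (simp add: Hom_def)
  ultimately have "ladder C xs ws' (Idn C N) (m \<cdot> y)" by simp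
  then show "kills C (Cod C b) xs' (Idn C N)"
    using kills_snocI[OF m(1,2) _ I chws] y F x m(3) by simp
qed

section \<open>Retracts and biproducts\<close>

text \<open>The final identity of \<open>xs\<close> factors as \<open>s r\<close>, so
  \<open>xs\<close> maps to its own pullback along \<open>r\<close>, whose class lies in
  \<open>Ext^i(Y, N)\<close>.\<close>

lemma vanish_retract:
  assumes V: "vanish C i Y N" and s: "s \<in> Hom C X Y" and r: "r \<in> Hom C Y X"
    and sr: "s \<cdot> r = Idn C X" and i: "i \<ge> 1"
  shows "vanish C i X N"
  unfolding vanish_def
proof (intro allI impI, elim conjE)
  fix xs assume xs: "chain C N X xs" "length xs = i"
  have N: "N \<in> Ob C" using chain_Ob xs by blast
  note I = Idn_Hom[OF N]
  have xne: "xs \<noteq> []" using xs i by auto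
  obtain ys where y: "chain C N Y ys" "length ys = length xs"
    and univ: "\<And>zs' L S u s. \<lbrakk>chain C L S zs'; u \<in> Hom C L N; s \<in> Hom C S Y;
       ladder C zs' xs u (s \<cdot> r)\<rbrakk> \<Longrightarrow> ladder C zs' ys u s"
    using ladder_pull[OF xs(1) xne r] by metis
  have "ladder C xs ys (Idn C N) s" using univ[OF xs(1) I s] ladder_Idn[OF xs(1)] sr by simp
  moreover have "kills C Y ys (Idn C N)" using V y xs by (simp add: vanish_def)
  ultimately have "kills C X xs (Idn C N \<cdot> Idn C N)" using kills_forward[OF xs(1) y(1) I I] by blast
  then show "kills C X xs (Idn C N)" using N by simp
qed

text \<open>The identity of \<open>P\<close> is made a boundary on one summand after the other, with
  an enlargement of the coresolution each time.\<close>

lemma vanish_biproduct: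
  assumes VX: "vanish C i X N" and VY: "vanish C i Y N" and b: "biproduct C X Y P i1 i2 p1 p2"
    and i: "i \<ge> 1"
  shows "vanish C i P N"
  unfolding vanish_def
proof (intro allI impI, elim conjE)
  fix xs assume xs: "chain C N P xs" "length xs = i"
  have N: "N \<in> Ob C" using chain_Ob xs by blast
  note I = Idn_Hom[OF N]
  have xne: "xs \<noteq> []" using xs i by auto
  have bp: "i1 \<in> Hom C X P" "i2 \<in> Hom C Y P" "p1 \<in> Hom C P X" "p2 \<in> Hom C P Y"
    "i1 \<cdot> p1 = Idn C X" "Add C (p1 \<cdot> i1) (p2 \<cdot> i2) = Idn C P"
    using b by (auto simp: biproduct_def)
  note A = bp(1-4)[THEN Hom_arr(1)] bp(1-4)[THEN Hom_arr(2)] bp(1-4)[THEN Hom_arr(3)]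
    Hom_arr(4)[OF bp(1)] Hom_arr(5)[OF bp(1)]
  obtain ws R w h where w: "chain C N R ws" "ladder C xs ws (Idn C N) w" "w \<in> Hom C P R" "ws \<noteq> []"
    "h \<in> Hom C X (Cod C (fst (last ws)))" "i1 \<cdot> w = h \<cdot> snd (last ws)"
    by (rule ladder_coboundary[OF xs(1) xne bp(1)]) (use VX xs in auto)
  obtain us q r where ws: "ws = us @ [(q, r)]" by (metis w(4) rev_exhaust surj_pair)
  have q: "ses C q r" "Cod C r = R" using w(1) ws by (auto simp: chain_append)
  have h: "h \<in> Hom C X (Cod C q)" "i1 \<cdot> w = h \<cdot> r" using w(5,6) ws by auto
  note B = A ses_arr[OF q(1)] q(2) Hom_arr[OF w(3)] Hom_arr[OF h(1)]
  \<comment> \<open>The homotopy \<open>h\<close> on \<open>X\<close> is extended to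
    \<open>P\<close> by \<open>p1\<close>. Subtracting it makes the final arrow zero on
    \<open>X\<close>, so that it factors through \<open>p2\<close>.\<close>
  define w' where "w' = Add C w (Neg C (p1 \<cdot> h) \<cdot> r)"
  have w': "w' \<in> Hom C P R" using B by (auto simp: w'_def Hom_def)
  have "Neg C (p1 \<cdot> h) \<in> Hom C P (Cod C (fst (last ws)))" using B ws by (auto simp: Hom_def)
  then have lad: "ladder C xs ws (Idn C N) w'"
    using ladder_add[OF xs(1) w(1) I w(2) xne] ws by (simp add: w'_def)
  have "i1 \<cdot> w' = Add C (i1 \<cdot> w) (Neg C ((i1 \<cdot> p1) \<cdot> (h \<cdot> r)))" using B by (simp add: w'_def)
  also have "\<dots> = Zero C X R" unfolding h(2) bp(5) using B by simp
  finally have 0: "i1 \<cdot> w' = Zero C X R" .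
  have "w' = Idn C P \<cdot> w'" using Hom_arr[OF w'] by simp
  also have "\<dots> = Add C (p1 \<cdot> (i1 \<cdot> w')) (p2 \<cdot> (i2 \<cdot> w'))"
    unfolding bp(6)[symmetric] using B Hom_arr[OF w'] by simp
  also have "\<dots> = p2 \<cdot> (i2 \<cdot> w')" unfolding 0 using B Hom_arr[OF w'] by simp
  finally have w'eq: "w' = p2 \<cdot> (i2 \<cdot> w')" .
  have len: "length ws = i" using ladder_length[OF lad] xs by simp
  have c: "i2 \<cdot> w' \<in> Hom C Y R" using Comp_Hom bp w' by blast
  \<comment> \<open>Now \<open>ws\<close> is enlarged for the summand \<open>Y\<close>; since
    \<open>w'\<close> factors through \<open>p2\<close>, all of it becomes a boundary there.\<close>
  obtain ws2 R2 w2 h2 where 2: "chain C N R2 ws2" "ladder C ws ws2 (Idn C N) w2" "w2 \<in> Hom C R R2"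
    "ws2 \<noteq> []" "h2 \<in> Hom C Y (Cod C (fst (last ws2)))" "i2 \<cdot> w' \<cdot> w2 = h2 \<cdot> snd (last ws2)"
    by (rule ladder_coboundary[OF w(1,4) c]) (use VY len in auto)
  obtain us2 q2 r2 where ws2: "ws2 = us2 @ [(q2, r2)]" by (metis 2(4) rev_exhaust surj_pair)
  have q2: "ses C q2 r2" using 2(1) ws2 by (auto simp: chain_append)
  have h2: "h2 \<in> Hom C Y (Cod C q2)" "i2 \<cdot> w' \<cdot> w2 = h2 \<cdot> r2" using 2(5,6) ws2 by auto
  note D = B ses_arr[OF q2(1)] Hom_arr[OF 2(3)] Hom_arr[OF h2(1)] Hom_arr[OF w']
  have "w' \<cdot> w2 = (p2 \<cdot> (i2 \<cdot> w')) \<cdot> w2" using w'eq by simp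
  also have "\<dots> = p2 \<cdot> (i2 \<cdot> w' \<cdot> w2)" using D by simp
  also have "\<dots> = (p2 \<cdot> h2) \<cdot> snd (last ws2)" unfolding h2(2) using D ws2 by simp
  finally have eq: "w' \<cdot> w2 = (p2 \<cdot> h2) \<cdot> snd (last ws2)" .
  have "ladder C xs ws2 (Idn C N) ((p2 \<cdot> h2) \<cdot> snd (last ws2))"
    using ladder_comp_Idn[OF xs(1) w(1) 2(1) lad 2(2)] eq by simp
  moreover have "p2 \<cdot> h2 \<in> Hom C P (Cod C (fst (last ws2)))" using D ws2 by (auto simp: Hom_def)
  ultimately have "ladder C xs ws2 (Idn C N) (Zero C P R2)"
    using kills_homotopic[OF xs(1) 2(1) xne I] by blast
  then show "kills C P xs (Idn C N)" using killsI 2(1) I by blast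
qed

end

section \<open>Comparison with Yoneda extensions\<close>

text \<open>\<open>yoneda_splice p xs\<close> recovers the arrows of a Yoneda extension from its short exact sequences; the
  arrow \<open>p\<close> enters the bottom object of the chain \<open>xs\<close>, and is an identity for the extension
  itself.\<close>

fun yoneda_splice :: "('o, 'm) addcat \<Rightarrow> 'm \<Rightarrow> ('m \<times> 'm) list \<Rightarrow> 'm list" where
  "yoneda_splice C p [] = [p]"
| "yoneda_splice C p ((m, e) # xs) = (p \<cdot>\<^bsub>C\<^esub> m) # yoneda_splice C e xs"

lemma length_splice [simp]: "length (yoneda_splice C p xs) = Suc (length xs)"
  by (induction C p xs rule: yoneda_splice.induct) auto

lemma splice_last: "xs \<noteq> [] \<Longrightarrow> yoneda_splice C p xs ! length xs = snd (last xs)"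
proof (induction C p xs rule: yoneda_splice.induct)
  case (2 C p m e xs)
  then show ?case by (cases "xs = []") auto
qed simp

lemma all_le_Suc: "(\<forall>j\<le>Suc k. P j) \<longleftrightarrow> P 0 \<and> (\<forall>j\<le>k. P (Suc j))"
  using All_less_Suc2[of "Suc k" P] by (simp add: less_Suc_eq_le)

context abelian_category
begin

lemma biproduct_ses:
  assumes "biproduct C X Y P i1 i2 p1 p2"
  shows "ses C i1 p2"
proof -
  have b: "i1 \<in> Hom C X P" "i2 \<in> Hom C Y P" "p1 \<in> Hom C P X" "p2 \<in> Hom C P Y"
    "i1 \<cdot> p1 = Idn C X" "i2 \<cdot> p2 = Idn C Y" "i1 \<cdot> p2 = Zero C X Y"
    "Add C (p1 \<cdot> i1) (p2 \<cdot> i2) = Idn C P"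
    using assms by (auto simp: biproduct_def)
  note a = b(1-4)[THEN Hom_arr(1)] b(1-4)[THEN Hom_arr(2)] b(1-4)[THEN Hom_arr(3)]
    Hom_arr(4)[OF b(1)] Hom_arr(5)[OF b(1)]
  have "is_mono C i1" unfolding is_mono_iff
  proof (intro conjI allI ballI impI)
    fix W g assume g: "g \<in> Hom C W (Dom C i1)" "g \<cdot> i1 = Zero C W (Cod C i1)"
    have "g = (g \<cdot> i1) \<cdot> p1" using b(5) Hom_arr[OF g(1)] a by simp
    then show "g = Zero C W (Dom C i1)" unfolding g(2) using a Hom_arr[OF g(1)] by simp
  qed (use a in simp)
  moreover have "is_cokernel C i1 p2" unfolding is_cokernel_def
  proof (intro conjI ballI impI)
    fix W g assume W: "W \<in> Ob C" and g: "g \<in> Hom C (Cod C i1) W" "i1 \<cdot> g = Zero C (Dom C i1) W"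
    note c = a Hom_arr[OF g(1)]
    have "g = Idn C P \<cdot> g" using c by simp
    also have "\<dots> = Add C (p1 \<cdot> (i1 \<cdot> g)) (p2 \<cdot> (i2 \<cdot> g))" unfolding b(8)[symmetric] using c by simp
    also have "\<dots> = p2 \<cdot> (i2 \<cdot> g)" unfolding g(2) using c by simp
    finally have 1: "p2 \<cdot> (i2 \<cdot> g) = g" by simp
    have 2: "h = i2 \<cdot> g" if "h \<in> Hom C (Cod C p2) W \<and> p2 \<cdot> h = g" for h
    proof -
      have "i2 \<cdot> g = (i2 \<cdot> p2) \<cdot> h" using that a by (auto simp: Hom_def)
      then show ?thesis unfolding b(6) using that a by (auto simp: Hom_def)
    qed
    show "\<exists>!h. h \<in> Hom C (Cod C p2) W \<and> p2 \<cdot> h = g"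
      by (rule ex1I[of _ "i2 \<cdot> g"]) (use 1 2 c in \<open>auto simp: Hom_def\<close>)
  qed (use a b in simp_all)
  ultimately show ?thesis using is_cokernel_mono_ses by blast
qed

section \<open>A split extension in every degree\<close>

text \<open>The base point of \<open>Ext\<close>: a biproduct in degree one, and above that
  \<open>N -> N -> 0\<close> followed by zeros and \<open>0 -> X -> X\<close>.\<close>

lemma split_chain_exists:
  assumes "N \<in> Ob C" "X \<in> Ob C"
  obtains m e xs s where "chain C N X ((m, e) # xs)" "length xs = k" "s \<in> Hom C (Cod C m) N"
    "m \<cdot> s = Idn C N"
proof (cases k)
  case 0
  obtain P i1 i2 p1 p2 where b: "biproduct C N X P i1 i2 p1 p2" using ex_biproduct assms by blast
  have "chain C N X [(i1, p2)]" using biproduct_ses[OF b] b assms by (auto simp: biproduct_def Hom_def)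
  then show ?thesis using that[of i1 p2 "[]" p1] b 0 by (auto simp: biproduct_def Hom_def)
next
  case (Suc k')
  obtain Z where Z: "zero_object C Z" using ex_zero_object by blast
  then have ZO: "Z \<in> Ob C" by (simp add: zero_object_def)
  have "\<exists>xs. chain C Z X xs \<and> length xs = Suc k'" for k'
  proof (induction k')
    case 0
    have "chain C Z X [(Zero C Z X, Idn C X)]" using Zero_Idn_ses[OF assms(2) Z] ZO assms by simp
    then show ?case by (metis length_Cons list.size(3))
  next
    case (Suc k')
    then obtain xs where "chain C Z X xs" "length xs = Suc k'" by blast
    then have "chain C Z X ((Idn C Z, Zero C Z Z) # xs)" "length ((Idn C Z, Zero C Z Z) # xs) = Suc (Suc k')"
      using Idn_Zero_ses[OF ZO Z] ZO by simp_all
    then show ?case by blast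
  qed
  then obtain xs where "chain C Z X xs" "length xs = k" using Suc by blast
  then show ?thesis using that[of "Idn C N" "Zero C N Z" xs "Idn C N"]
      Idn_Zero_ses[OF assms(1) Z] assms ZO by (simp add: Idn_Hom)
qed

section \<open>From chains to Yoneda extensions\<close>

lemma is_cokernel_epi_Comp:
  assumes c: "is_cokernel C m e" and p: "is_epi C p" "Cod C p = Dom C m"
  shows "is_cokernel C (p \<cdot> m) e"
  unfolding is_cokernel_def
proof (intro conjI ballI impI)
  note a = cokernel_arr[OF c] p(2)
  have ap: "p \<in> Arr C" using p by (simp add: is_epi_def)
  show "p \<cdot> m \<in> Arr C" "e \<in> Arr C" "Dom C e = Cod C (p \<cdot> m)" using a ap by simp_all
  have "p \<cdot> (m \<cdot> e) = Zero C (Dom C p) (Cod C e)" using a ap by simp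
  then show "p \<cdot> m \<cdot> e = Zero C (Dom C (p \<cdot> m)) (Cod C e)" using a ap by simp
  fix W g assume W: "W \<in> Ob C" and g: "g \<in> Hom C (Cod C (p \<cdot> m)) W" "p \<cdot> m \<cdot> g = Zero C (Dom C (p \<cdot> m)) W"
  have g': "g \<in> Hom C (Cod C m) W" using g a ap by simp
  have "p \<cdot> (m \<cdot> g) = p \<cdot> Zero C (Dom C m) W" using g(2) a ap Hom_arr[OF g'] by simp
  then have "m \<cdot> g = Zero C (Dom C m) W"
    using epiD[OF p(1), of "m \<cdot> g" W "Zero C (Dom C m) W"] a ap Hom_arr[OF g'] by (simp add: Hom_def)
  then show "\<exists>!h. h \<in> Hom C (Cod C e) W \<and> e \<cdot> h = g" using c g' W unfolding is_cokernel_def by blast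
qed

lemma is_kernel_mono_Comp:
  "\<lbrakk>is_kernel C e m; is_mono C n; Cod C e = Dom C n\<rbrakk> \<Longrightarrow> is_kernel C (e \<cdot> n) m"
  using abelian_category.is_cokernel_epi_Comp[OF abelian_category_opc', of e m n] by simp

text \<open>The witnesses are \<open>e\<close> and \<open>m\<close>: the outer epimorphism does not
  affect the cokernel, nor the outer monomorphism the kernel.\<close>

lemma exact_pair_ses:
  assumes s: "ses C m e" and p: "is_epi C p" "Cod C p = Dom C m" and n: "is_mono C n" "Cod C e = Dom C n"
  shows "exact_pair C (p \<cdot> m) (e \<cdot> n)"
proof -
  have "p \<in> Arr C" "n \<in> Arr C" using p n by (auto simp: is_epi_def is_mono_def)
  then have "Cod C (p \<cdot> m) = Dom C (e \<cdot> n)" using ses_arr[OF s] p n by simp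
  then show ?thesis
    using is_cokernel_epi_Comp[OF _ p, of e] is_kernel_mono_Comp[OF _ n, of m] s
    unfolding exact_pair_def ses_def by blast
qed

lemma is_mono_Idn: "X \<in> Ob C \<Longrightarrow> is_mono C (Idn C X)"
  by (auto simp: is_mono_def Hom_def)

lemma is_epi_Idn: "X \<in> Ob C \<Longrightarrow> is_epi C (Idn C X)"
  by (auto simp: is_epi_def Hom_def)

lemma splice_exact:
  "\<lbrakk>chain C N X xs; is_epi C p; Cod C p = N; j < length xs\<rbrakk> \<Longrightarrow>
    exact_pair C (yoneda_splice C p xs ! j) (yoneda_splice C p xs ! Suc j)"
proof (induction xs arbitrary: N p j)
  case (Cons x xs)
  obtain m e where x: "x = (m, e)" by (cases x)
  have s: "ses C m e" "Dom C m = N" "chain C (Cod C e) X xs" using Cons.prems x by auto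
  show ?case
  proof (cases j)
    case 0
    show ?thesis
    proof (cases xs)
      case Nil
      \<comment> \<open>Nothing follows the last epimorphism; an identity stands in for the missing
        monomorphism.\<close>
      have "exact_pair C (p \<cdot> m) (e \<cdot> Idn C (Cod C e))"
        by (rule exact_pair_ses) (use s Cons.prems ses_arr[OF s(1)] is_mono_Idn in auto)
      then show ?thesis using 0 x Nil ses_arr[OF s(1)] by simp
    next
      case (Cons y ys)
      obtain m' e' where y: "y = (m', e')" by (cases y)
      have "exact_pair C (p \<cdot> m) (e \<cdot> m')"
        by (rule exact_pair_ses) (use s Cons.prems y Cons ses_mono in auto)
      then show ?thesis using 0 x y Cons by simp
    qed
  next
    case (Suc j')
    then show ?thesis using Cons.IH[OF s(3) ses_epi[OF s(1)]] Cons.prems x by simp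
  qed
qed simp

lemma splice_extension:
  assumes "chain C N X xs" "xs \<noteq> []"
  shows "yoneda_splice C (Idn C N) xs \<in> extensions C (length xs) X N"
proof -
  obtain m e xs' where x: "xs = (m, e) # xs'" using assms(2) by (metis neq_Nil_conv surj_pair)
  obtain us q r where u: "xs = us @ [(q, r)]" by (metis assms(2) rev_exhaust surj_pair)
  have m: "ses C m e" "Dom C m = N" using assms x by auto
  have q: "ses C q r" "Cod C r = X" using assms u by (auto simp: chain_append)
  have N: "N \<in> Ob C" using chain_Ob assms by blast
  have "yoneda_splice C (Idn C N) xs ! 0 = m" using x ses_arr[OF m(1)] m(2) by simp
  moreover have "yoneda_splice C (Idn C N) xs ! length xs = r" using splice_last[OF assms(2)] u by simp
  ultimately show ?thesis
    using splice_exact[OF assms(1) is_epi_Idn[OF N]] N m q ses_mono[OF m(1)] ses_epi[OF q(1)]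
    unfolding extensions_def by simp
qed

section \<open>From Yoneda extensions to chains\<close>

text \<open>The witnesses \<open>c\<close> and \<open>k\<close> are arbitrary choices. As
  \<open>p\<close> is epic, \<open>c\<close> kills \<open>m\<close>, which therefore factors through
  \<open>k\<close>; conversely the cokernel of \<open>m\<close> factors through \<open>c\<close>, so
  a map that lifts to \<open>k\<close> lifts to \<open>m\<close>.\<close>

lemma exact_pair_kernel:
  assumes x: "exact_pair C (p \<cdot> m) d" and p: "is_epi C p" and m: "is_mono C m" "Cod C p = Dom C m"
  shows "is_kernel C d m"
proof -
  obtain c k where ck: "is_cokernel C (p \<cdot> m) c" "is_kernel C c k" "is_kernel C d k"
    using x by (auto simp: exact_pair_def)
  have a: "p \<in> Arr C" "m \<in> Arr C" using p m by (auto simp: is_epi_def is_mono_def)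
  note b = a m(2) cokernel_arr[OF ck(1)] kernel_arr[OF ck(2)] kernel_arr[OF ck(3)]
  obtain e where e: "ses C m e" using mono_ses m by blast
  note ae = ses_arr[OF e]
  have dk: "Cod C m = Cod C k" "Dom C d = Cod C k" "Dom C c = Cod C k" "k \<in> Arr C" "d \<in> Arr C" "c \<in> Arr C"
    using b by auto
  have pm: "is_cokernel C (p \<cdot> m) e" using is_cokernel_epi_Comp[OF _ p m(2)] e by (auto simp: ses_def)
  have "p \<cdot> (m \<cdot> c) = p \<cdot> Zero C (Dom C m) (Cod C c)"
    using cokernel_arr(4)[OF ck(1)] a m(2) dk Cod_Ob Dom_Ob by simp
  then have mc: "m \<cdot> c = Zero C (Dom C m) (Cod C c)"
    using epiD[OF p, of "m \<cdot> c" "Cod C c" "Zero C (Dom C m) (Cod C c)"] a m(2) dk Cod_Ob Dom_Ob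
    by (auto simp: Hom_def)
  obtain g where g: "g \<in> Hom C (Dom C m) (Dom C k)" "g \<cdot> k = m"
    using kernel_lift[OF ck(2), of m "Dom C m"] mc a dk by (auto simp: Hom_def)
  have "g \<cdot> (k \<cdot> d) = Zero C (Dom C m) (Cod C d)"
    using kernel_arr(4)[OF ck(3)] Hom_arr[OF g(1)] dk Cod_Ob by simp
  then have md: "m \<cdot> d = Zero C (Dom C m) (Cod C d)"
    unfolding g(2)[symmetric] using Hom_arr[OF g(1)] dk by simp
  show ?thesis unfolding is_kernel_def
  proof (intro conjI ballI impI)
    show "m \<cdot> d = Zero C (Dom C m) (Cod C d)" by (fact md)
    fix W h assume W: "W \<in> Ob C" and h: "h \<in> Hom C W (Dom C d)" "h \<cdot> d = Zero C W (Cod C d)"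
    obtain y where y: "y \<in> Hom C W (Dom C k)" "y \<cdot> k = h" using kernel_lift[OF ck(3) h] .
    obtain l where l: "l \<in> Hom C (Cod C c) (Cod C e)" "c \<cdot> l = e"
      using cokernel_desc[OF ck(1), of e "Cod C e"] cokernel_arr[OF pm] ae by (auto simp: Hom_def)
    have "h \<cdot> e = (y \<cdot> (k \<cdot> c)) \<cdot> l"
      unfolding y(2)[symmetric] l(2)[symmetric] using Hom_arr[OF y(1)] Hom_arr[OF l(1)] dk by simp
    also have "\<dots> = Zero C W (Cod C e)"
      unfolding kernel_arr(4)[OF ck(2)] using Hom_arr[OF y(1)] Hom_arr[OF l(1)] dk by simp
    finally obtain z where z: "z \<in> Hom C W (Dom C m)" "z \<cdot> m = h"
      using ses_lift[OF e, of h W] h dk by auto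
    have "z' = z" if "z' \<in> Hom C W (Dom C m) \<and> z' \<cdot> m = h" for z'
      using monoD[OF m(1), of z' W z] z that by auto
    then show "\<exists>!z. z \<in> Hom C W (Dom C m) \<and> z \<cdot> m = h" using z by blast
  qed (use a dk in auto)
qed

text \<open>The first arrow comes already factored as \<open>p m\<close>. The invariant is passed on
  by factoring \<open>d\<close> through the cokernel of its kernel \<open>m\<close>;
  \<open>coimage_mono\<close> makes the second factor monic.\<close>

lemma extension_is_splice_aux:
  "\<lbrakk>is_epi C p; is_mono C m; Cod C p = Dom C m; ds \<noteq> [];
    \<forall>j<length ds. exact_pair C ((p \<cdot> m # ds) ! j) (ds ! j); is_epi C (last ds); Cod C (last ds) = X\<rbrakk> \<Longrightarrow>
    \<exists>xs. chain C (Dom C m) X xs \<and> length xs = length ds \<and> p \<cdot> m # ds = yoneda_splice C p xs"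
proof (induction ds arbitrary: p m)
  case (Cons d ds)
  have k: "is_kernel C d m" using exact_pair_kernel Cons.prems(1-3,5) by fastforce
  have X: "X \<in> Ob C" using Cons.prems(6,7) Cod_Ob by (auto simp: is_epi_def)
  show ?case
  proof (cases "ds = []")
    case True
    then have "ses C m d" using is_kernel_epi_ses k Cons.prems(6) by simp
    then have "chain C (Dom C m) X [(m, d)]" using Cons.prems(7) True X by simp
    moreover have "p \<cdot> m # d # ds = yoneda_splice C p [(m, d)]" using True by simp
    ultimately show ?thesis using True X by (intro exI[of _ "[(m, d)]"]) simp
  next
    case False
    obtain e where e: "ses C m e" using mono_ses Cons.prems by blast
    obtain n where n: "n \<in> Hom C (Cod C e) (Cod C d)" "e \<cdot> n = d"
      using ses_desc[OF e, of d "Cod C d"] kernel_arr[OF k] by (auto simp: Hom_def)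
    have "is_mono C n" using coimage_mono[OF k _ n] e by (auto simp: ses_def)
    moreover have "\<forall>j<length ds. exact_pair C ((e \<cdot> n # ds) ! j) (ds ! j)"
      using Cons.prems(5) n(2) by auto
    ultimately obtain xs where xs: "chain C (Dom C n) X xs" "length xs = length ds"
      "e \<cdot> n # ds = yoneda_splice C e xs"
      using Cons.IH[of e n] ses_epi[OF e] False Cons.prems(6,7) Hom_arr[OF n(1)] by auto
    have "chain C (Dom C m) X ((m, e) # xs)" using xs e Hom_arr[OF n(1)] by simp
    moreover have "p \<cdot> m # d # ds = yoneda_splice C p ((m, e) # xs)" using xs(3) n(2) by simp
    ultimately show ?thesis using xs(2) by (intro exI[of _ "(m, e) # xs"]) simp
  qed
qed simp

lemma extension_is_splice:
  assumes ds: "ds \<in> extensions C i X N" and i: "i \<ge> 1"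
  obtains xs where "chain C N X xs" "length xs = i" "ds = yoneda_splice C (Idn C N) xs"
proof -
  have d: "length ds = Suc i" "is_mono C (ds ! 0)" "Dom C (ds ! 0) = N" "is_epi C (ds ! i)"
    "Cod C (ds ! i) = X" "\<And>j. j < i \<Longrightarrow> exact_pair C (ds ! j) (ds ! Suc j)"
    using ds by (auto simp: extensions_def)
  obtain d0 ds' where ds': "ds = d0 # ds'" using d(1) by (cases ds) auto
  have N: "N \<in> Ob C" "d0 \<in> Arr C" using d(2,3) ds' Dom_Ob by (auto simp: is_mono_def)
  have id: "Idn C N \<cdot> d0 = d0" using N d(3) ds' by simp
  have l: "length ds' = i" "ds' \<noteq> []" using d(1) ds' i by auto
  then have "ds ! i = last ds'" using ds' i by (simp add: last_conv_nth nth_Cons')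
  note l = l this
  have "\<exists>xs. chain C (Dom C d0) X xs \<and> length xs = length ds' \<and> Idn C N \<cdot> d0 # ds' = yoneda_splice C (Idn C N) xs"
    by (rule extension_is_splice_aux) (use d l ds' N is_epi_Idn id in auto)
  then show ?thesis using that id l d(3) ds' by auto
qed

section \<open>Ladders as morphisms of extensions\<close>

text \<open>\<open>F\<close> is given on the middle objects only. The arrows between the images are
  recovered by descending to cokernels, and the squares on the monic side by cancelling the
  epimorphism \<open>p\<close>.\<close>

lemma splice_ladder:
  "\<lbrakk>chain C N X xs; chain C N' X' ys; length xs = length ys; is_epi C p; Cod C p = N; p' \<in> Arr C; Cod C p' = N';
    u \<in> Hom C N N'; F 0 \<in> Hom C (Dom C p) (Dom C p'); p \<cdot> u = F 0 \<cdot> p';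
    \<forall>j\<le>length xs. F (Suc j) \<in> Hom C (Cod C (yoneda_splice C p xs ! j)) (Cod C (yoneda_splice C p' ys ! j)) \<and>
      yoneda_splice C p xs ! j \<cdot> F (Suc j) = F j \<cdot> yoneda_splice C p' ys ! j\<rbrakk> \<Longrightarrow>
    ladder C xs ys u (F (Suc (length xs)))"
proof (induction xs arbitrary: N N' ys p p' u F)
  case Nil
  then have "F (Suc 0) \<in> Hom C (Cod C p) N'" "p \<cdot> F (Suc 0) = p \<cdot> u" "u \<in> Hom C (Cod C p) N'"
    by auto
  then have "F (Suc 0) = u" using epiD[OF Nil.prems(4)] by blast
  then show ?case using Nil by simp
next
  case (Cons x xs)
  obtain m e where x: "x = (m, e)" by (cases x)
  obtain m' e' ys' where y: "ys = (m', e') # ys'" using Cons.prems(3) by (metis length_Suc_conv surj_pair)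
  have s: "ses C m e" "Dom C m = N" "chain C (Cod C e) X xs"
    "ses C m' e'" "Dom C m' = N'" "chain C (Cod C e') X' ys'" using Cons.prems x y by auto
  have pA: "p \<in> Arr C" using Cons.prems(4) by (simp add: is_epi_def)
  note a = ses_arr[OF s(1)] ses_arr[OF s(4)] s(2,5) Hom_arr[OF Cons.prems(8)] Hom_arr[OF Cons.prems(9)]
    Cons.prems(5,6,7) pA
  have all: "F (Suc 0) \<in> Hom C (Cod C (p \<cdot> m)) (Cod C (p' \<cdot> m'))" "p \<cdot> m \<cdot> F (Suc 0) = F 0 \<cdot> (p' \<cdot> m')"
    "\<forall>j\<le>length xs. F (Suc (Suc j)) \<in> Hom C (Cod C (yoneda_splice C e xs ! j)) (Cod C (yoneda_splice C e' ys' ! j)) \<and>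
      yoneda_splice C e xs ! j \<cdot> F (Suc (Suc j)) = F (Suc j) \<cdot> yoneda_splice C e' ys' ! j"
    using Cons.prems(11) unfolding x y by (simp_all add: all_le_Suc)
  have F1: "F (Suc 0) \<in> Hom C (Cod C m) (Cod C m')" using all(1) a by simp
  note b = a Hom_arr[OF F1]
  have "p \<cdot> (m \<cdot> F (Suc 0)) = F 0 \<cdot> (p' \<cdot> m')" using all(2) b by simp
  also have "\<dots> = (p \<cdot> u) \<cdot> m'" unfolding Cons.prems(10) using b by simp
  finally have "p \<cdot> (m \<cdot> F (Suc 0)) = p \<cdot> (u \<cdot> m')" using b by simp
  moreover have "m \<cdot> F (Suc 0) \<in> Hom C (Cod C p) (Cod C m')" "u \<cdot> m' \<in> Hom C (Cod C p) (Cod C m')"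
    using b by (auto simp: Hom_def)
  ultimately have sq: "m \<cdot> F (Suc 0) = u \<cdot> m'" using epiD[OF Cons.prems(4)] by blast
  have "m \<cdot> (F (Suc 0) \<cdot> e') = u \<cdot> (m' \<cdot> e')"
    using sq[THEN post, of N "Cod C m" "Cod C m'" e'] b by (auto simp: Hom_def)
  then have "m \<cdot> (F (Suc 0) \<cdot> e') = Zero C (Dom C m) (Cod C e')" using b by simp
  then obtain u' where u': "u' \<in> Hom C (Cod C e) (Cod C e')" "e \<cdot> u' = F (Suc 0) \<cdot> e'"
    using ses_desc[OF s(1), of "F (Suc 0) \<cdot> e'" "Cod C e'"] b by (auto simp: Hom_def)
  have "ladder C xs ys' u' (F (Suc (Suc (length xs))))"
    using Cons.IH[OF s(3,6) _ ses_epi[OF s(1)] _ _ _ u'(1), of e' "\<lambda>j. F (Suc j)"] all(3) u'(2) F1 b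
      Cons.prems(3) y by auto
  then show ?case unfolding x y using F1 u' sq by auto
qed

lemma ladder_splice:
  "\<lbrakk>chain C N X xs; chain C N' X' ys; ladder C xs ys u w; Cod C p = N; p \<in> Arr C; p' \<in> Arr C; Cod C p' = N';
    u \<in> Hom C N N'; f \<in> Hom C (Dom C p) (Dom C p'); p \<cdot> u = f \<cdot> p'\<rbrakk> \<Longrightarrow>
    \<exists>fs. length fs = Suc (Suc (length xs)) \<and> fs ! 0 = f \<and> fs ! Suc (length xs) = w \<and>
      (\<forall>j\<le>length xs. fs ! j \<in> Hom C (Dom C (yoneda_splice C p xs ! j)) (Dom C (yoneda_splice C p' ys ! j)) \<and>
        fs ! Suc j \<in> Hom C (Cod C (yoneda_splice C p xs ! j)) (Cod C (yoneda_splice C p' ys ! j)) \<and>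
        yoneda_splice C p xs ! j \<cdot> fs ! Suc j = fs ! j \<cdot> yoneda_splice C p' ys ! j)"
proof (induction xs arbitrary: N N' ys p p' u f)
  case Nil
  then have "ys = []" using ladder_length by force
  then show ?case using Nil by (intro exI[of _ "[f, u]"]) auto
next
  case (Cons x xs)
  obtain m e where x: "x = (m, e)" by (cases x)
  obtain m' e' ys' where y: "ys = (m', e') # ys'"
    using ladder_length[OF Cons.prems(3)] by (metis length_Suc_conv surj_pair)
  have s: "ses C m e" "Dom C m = N" "chain C (Cod C e) X xs"
    "ses C m' e'" "Dom C m' = N'" "chain C (Cod C e') X' ys'" using Cons.prems x y by auto
  obtain v u' where l: "v \<in> Hom C (Cod C m) (Cod C m')" "u' \<in> Hom C (Cod C e) (Cod C e')"
    "m \<cdot> v = u \<cdot> m'" "e \<cdot> u' = v \<cdot> e'" "ladder C xs ys' u' w"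
    using Cons.prems(3) x y by auto
  note a = ses_arr[OF s(1)] ses_arr[OF s(4)] s(2,5) Hom_arr[OF Cons.prems(8)] Hom_arr[OF Cons.prems(9)]
    Cons.prems(4-7) Hom_arr[OF l(1)] Hom_arr[OF l(2)]
  obtain fs where fs: "length fs = Suc (Suc (length xs))" "fs ! 0 = v" "fs ! Suc (length xs) = w"
      "\<forall>j\<le>length xs. fs ! j \<in> Hom C (Dom C (yoneda_splice C e xs ! j)) (Dom C (yoneda_splice C e' ys' ! j)) \<and>
        fs ! Suc j \<in> Hom C (Cod C (yoneda_splice C e xs ! j)) (Cod C (yoneda_splice C e' ys' ! j)) \<and>
        yoneda_splice C e xs ! j \<cdot> fs ! Suc j = fs ! j \<cdot> yoneda_splice C e' ys' ! j"
    using Cons.IH[OF s(3,6) l(5), of e e' v] l a by auto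
  have "p \<cdot> (m \<cdot> v) = (p \<cdot> u) \<cdot> m'" unfolding l(3) using a by simp
  also have "\<dots> = f \<cdot> (p' \<cdot> m')" unfolding Cons.prems(10) using a by simp
  finally have "p \<cdot> m \<cdot> v = f \<cdot> (p' \<cdot> m')" using a by simp
  then show ?case
    unfolding x y using fs l(1) Cons.prems(9) a
    by (intro exI[of _ "f # fs"]) (auto simp: all_le_Suc)
qed

lemma extension_morphism_splice:
  assumes xs: "chain C N X xs" "xs \<noteq> []" and ys: "chain C N X ys" "length ys = length xs"
  shows "(\<exists>fs. extension_morphism C (length xs) X N (yoneda_splice C (Idn C N) xs) (yoneda_splice C (Idn C N) ys) fs)
    \<longleftrightarrow> ladder C xs ys (Idn C N) (Idn C X)"
proof
  have N: "N \<in> Ob C" "X \<in> Ob C" using chain_Ob xs by blast+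
  note I = Idn_Hom[OF N(1)]
  {
    assume "\<exists>fs. extension_morphism C (length xs) X N (yoneda_splice C (Idn C N) xs) (yoneda_splice C (Idn C N) ys) fs"
    then obtain fs where fs: "fs ! 0 = Idn C N" "fs ! Suc (length xs) = Idn C X"
      "\<forall>j\<le>length xs. fs ! Suc j \<in> Hom C (Cod C (yoneda_splice C (Idn C N) xs ! j)) (Cod C (yoneda_splice C (Idn C N) ys ! j)) \<and>
        yoneda_splice C (Idn C N) xs ! j \<cdot> fs ! Suc j = fs ! j \<cdot> yoneda_splice C (Idn C N) ys ! j"
      unfolding extension_morphism_def by auto
    have "ladder C xs ys (Idn C N) (fs ! Suc (length xs))"
      by (rule splice_ladder[OF xs(1) ys(1), where F = "(!) fs" and p = "Idn C N" and p' = "Idn C N"])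
        (use ys fs N I is_epi_Idn in auto)
    then show "ladder C xs ys (Idn C N) (Idn C X)" using fs(2) by simp
  }
  assume l: "ladder C xs ys (Idn C N) (Idn C X)"
  obtain fs where "length fs = Suc (Suc (length xs))" "fs ! 0 = Idn C N" "fs ! Suc (length xs) = Idn C X"
      "\<forall>j\<le>length xs. fs ! j \<in> Hom C (Dom C (yoneda_splice C (Idn C N) xs ! j)) (Dom C (yoneda_splice C (Idn C N) ys ! j)) \<and>
        fs ! Suc j \<in> Hom C (Cod C (yoneda_splice C (Idn C N) xs ! j)) (Cod C (yoneda_splice C (Idn C N) ys ! j)) \<and>
        yoneda_splice C (Idn C N) xs ! j \<cdot> fs ! Suc j = fs ! j \<cdot> yoneda_splice C (Idn C N) ys ! j"
    using ladder_splice[OF xs(1) ys(1) l, of "Idn C N" "Idn C N" "Idn C N"] N I by auto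
  moreover have "yoneda_splice C (Idn C N) xs \<in> extensions C (length xs) X N"
    "yoneda_splice C (Idn C N) ys \<in> extensions C (length xs) X N"
    using splice_extension[OF xs] splice_extension[OF ys(1)] ys(2) xs(2) by fastforce+
  ultimately show "\<exists>fs. extension_morphism C (length xs) X N (yoneda_splice C (Idn C N) xs) (yoneda_splice C (Idn C N) ys) fs"
    unfolding extension_morphism_def by (intro exI[of _ fs]) simp
qed

text \<open>The middle chain is the pullback along \<open>X \<rightarrow> S\<close> of a chain ending in \<open>S\<close> that receives both
  given extensions with final component zero.\<close>

lemma vanish_cospan:
  assumes V: "vanish C i X N" and i: "i \<ge> 1" and xs: "chain C N X xs" "length xs = i"
    and y: "chain C N X ((m, e) # ys)" "Suc (length ys) = i" "s \<in> Hom C (Cod C m) N" "m \<cdot> s = Idn C N"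
  obtains ps where "chain C N X ps" "length ps = i" "ladder C xs ps (Idn C N) (Idn C X)"
    "ladder C ((m, e) # ys) ps (Idn C N) (Idn C X)"
proof -
  have N: "N \<in> Ob C" "X \<in> Ob C" using chain_Ob xs by blast+
  note I = Idn_Hom[OF N(1)] Idn_Hom[OF N(2)]
  have "kills C X xs (Idn C N)" using V xs by (simp add: vanish_def)
  then obtain zs S where z: "chain C N S zs" "ladder C xs zs (Idn C N) (Zero C X S)"
    using killsE I by blast
  have l: "length zs = i" "zs \<noteq> []" using ladder_length[OF z(2)] xs i by auto
  have S: "S \<in> Ob C" using chain_Ob z by blast
  obtain ps where p: "chain C N X ps" "length ps = length zs"
    and univ: "\<And>zs' L S' u s. \<lbrakk>chain C L S' zs'; u \<in> Hom C L N; s \<in> Hom C S' X;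
       ladder C zs' zs u (s \<cdot> Zero C X S)\<rbrakk> \<Longrightarrow> ladder C zs' ps u s"
    using ladder_pull[OF z(1) l(2) Zero_Hom[OF N(2) S]] by metis
  have "ladder C xs ps (Idn C N) (Idn C X)" using univ[OF xs(1) I] z(2) N S by simp
  moreover have "ladder C ((m, e) # ys) zs (Idn C N) (Zero C X S)"
    using ladder_extends[OF y(1) z(1) _ y(3)] l y by simp
  then have "ladder C ((m, e) # ys) ps (Idn C N) (Idn C X)" using univ[OF y(1) I] N S by simp
  ultimately show ?thesis using that p l by simp
qed

section \<open>The quotient \<open>Ext\<close> and its vanishing\<close>

lemma Ext_vanishes_iff_equiv:
  "Ext_vanishes C i X N \<longleftrightarrow> extensions C i X N \<noteq> {} \<and>
    (\<forall>ds\<in>extensions C i X N. \<forall>es\<in>extensions C i X N.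
      equivclp (\<lambda>ds es. \<exists>fs. extension_morphism C i X N ds es fs) ds es)"
    (is "?L \<longleftrightarrow> ?A \<noteq> {} \<and> (\<forall>ds\<in>?A. \<forall>es\<in>?A. ?R ds es)")
proof
  have img: "extension_equiv C i X N `` {ds} = {es \<in> ?A. ?R ds es}" if "ds \<in> ?A" for ds
    using that by (auto simp: extension_equiv_def)
  {
    assume ?L
    then obtain c where c: "?A // extension_equiv C i X N = {c}"
      by (auto simp: Ext_vanishes_def Ext_def is_singleton_def)
    have "es \<in> c \<and> c = {es' \<in> ?A. ?R es es'}" if "es \<in> ?A" for es
    proof -
      have "extension_equiv C i X N `` {es} = c" using c that by (auto simp: quotient_def)
      then have "c = {es' \<in> ?A. ?R es es'}" using img[OF that] by simp
      then show ?thesis using that by simp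
    qed
    moreover have "?A \<noteq> {}" using c by (auto simp: quotient_def)
    ultimately show "?A \<noteq> {} \<and> (\<forall>ds\<in>?A. \<forall>es\<in>?A. ?R ds es)" by blast
  }
  assume *: "?A \<noteq> {} \<and> (\<forall>ds\<in>?A. \<forall>es\<in>?A. ?R ds es)"
  then have "extension_equiv C i X N `` {ds} = ?A" if "ds \<in> ?A" for ds using img[OF that] that by auto
  then have "?A // extension_equiv C i X N = {?A}" using * by (auto simp: quotient_def)
  then show ?L by (simp add: Ext_vanishes_def Ext_def)
qed

text \<open>If all classes are trivial, a cospan joins each extension to the split one. Conversely,
  triviality passes along every link of a zigzag and holds for the split extension.\<close>

lemma Ext_vanishes_iff:
  assumes i: "i \<ge> 1" and Ob: "X \<in> Ob C" "N \<in> Ob C"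
  shows "Ext_vanishes C i X N \<longleftrightarrow> vanish C i X N"
proof -
  let ?S = "yoneda_splice C (Idn C N)" and ?A = "extensions C i X N"
  let ?r = "\<lambda>ds es. \<exists>fs. extension_morphism C i X N ds es fs"
  note I = Idn_Hom[OF Ob(2)]
  obtain m e ys s where y: "chain C N X ((m, e) # ys)" "length ys = i - 1"
    "s \<in> Hom C (Cod C m) N" "m \<cdot> s = Idn C N"
    using split_chain_exists[OF Ob(2,1)] .
  let ?y = "(m, e) # ys"
  have yl: "length ?y = i" "?y \<noteq> []" using y i by auto
  have lad: "?r (?S xs) (?S zs) \<longleftrightarrow> ladder C xs zs (Idn C N) (Idn C X)"
    if "chain C N X xs" "length xs = i" "chain C N X zs" "length zs = i" for xs zs
    using extension_morphism_splice[OF that(1) _ that(3)] that i by fastforce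
  have ext: "?S xs \<in> ?A" if "chain C N X xs" "length xs = i" for xs
    using splice_extension[OF that(1)] that i by fastforce
  show ?thesis
  proof
    assume V: "vanish C i X N"
    have to_y: "equivclp ?r ds (?S ?y)" if ds: "ds \<in> ?A" for ds
    proof -
      obtain xs where xs: "chain C N X xs" "length xs = i" "ds = ?S xs"
        using extension_is_splice[OF ds i] .
      obtain ps where p: "chain C N X ps" "length ps = i" "ladder C xs ps (Idn C N) (Idn C X)"
        "ladder C ?y ps (Idn C N) (Idn C X)"
        using vanish_cospan[OF V i xs(1,2) y(1) _ y(3,4)] yl by auto
      have "?r ds (?S ps)" unfolding xs(3) using lad[OF xs(1,2) p(1,2)] p(3) by blast
      then have 1: "equivclp ?r ds (?S ps)" by (rule r_into_equivclp)
      have "?r (?S ?y) (?S ps)" using lad[OF y(1) yl(1) p(1,2)] p(4) by blast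
      then have "equivclp ?r (?S ?y) (?S ps)" by (rule r_into_equivclp)
      then show ?thesis by (rule equivclp_trans[OF 1 equivclp_sym])
    qed
    then have "equivclp ?r ds es" if "ds \<in> ?A" "es \<in> ?A" for ds es
      using equivclp_trans[OF to_y equivclp_sym[OF to_y]] that by blast
    then show "Ext_vanishes C i X N" using ext[OF y(1) yl(1)] by (auto simp: Ext_vanishes_iff_equiv)
  next
    assume "Ext_vanishes C i X N"
    then have all: "equivclp ?r ds es" if "ds \<in> ?A" "es \<in> ?A" for ds es
      using that by (auto simp: Ext_vanishes_iff_equiv)
    \<comment> \<open>Cutting an extension into short exact sequences involves choices, so
      \<open>K\<close> asks for some chain with the given arrows. The fact \<open>K\<close> below
      shows independence of the choice, by means of the identity morphism of the extension.\<close>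
    define K where "K ds \<longleftrightarrow> (\<exists>xs. chain C N X xs \<and> length xs = i \<and> ds = ?S xs \<and> kills C X xs (Idn C N))"
      for ds
    have K_lad: "kills C X xs (Idn C N) \<longleftrightarrow> kills C X zs (Idn C N)"
      if c: "chain C N X xs" "length xs = i" "chain C N X zs" "length zs = i"
        and l: "ladder C xs zs (Idn C N) (Idn C X)" for xs zs
    proof -
      have "xs \<noteq> []" using c i by auto
      then show ?thesis
        using kills_forward[OF c(1,3) I I l] kills_backward[OF c(1) _ c(3) I I l] Ob by auto
    qed
    have K: "K (?S us) \<longleftrightarrow> kills C X us (Idn C N)" if us: "chain C N X us" "length us = i" for us
    proof
      assume "K (?S us)"
      then obtain vs where v: "chain C N X vs" "length vs = i" "?S us = ?S vs" "kills C X vs (Idn C N)"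
        unfolding K_def by blast
      have "?r (?S vs) (?S vs)" using lad[OF v(1,2) v(1,2)] ladder_Idn[OF v(1)] by blast
      then have "ladder C vs us (Idn C N) (Idn C X)" using lad[OF v(1,2) us] v(3) by simp
      then show "kills C X us (Idn C N)" using K_lad[OF v(1,2) us] v(4) by blast
    qed (use us K_def in blast)
    have K_step: "K ds \<longleftrightarrow> K es" if "?r ds es" for ds es
    proof -
      have "ds \<in> ?A" "es \<in> ?A" using that by (auto simp: extension_morphism_def)
      then obtain xs zs where xz: "chain C N X xs" "length xs = i" "ds = ?S xs"
        "chain C N X zs" "length zs = i" "es = ?S zs"
        using extension_is_splice[OF _ i] by metis
      have "ladder C xs zs (Idn C N) (Idn C X)" using lad[OF xz(1,2,4,5)] that xz by simp
      then show ?thesis using K_lad[OF xz(1,2,4,5)] K[OF xz(1,2)] K[OF xz(4,5)] xz by simp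
    qed
    have K_equiv: "K ds \<longleftrightarrow> K es" if "equivclp ?r ds es" for ds es
      using that
    proof (induction rule: equivclp_induct)
      case (step es' es)
      then show ?case using K_step by blast
    qed simp
    \<comment> \<open>The splitting \<open>s\<close> contracts the split chain: it maps to itself
      with final arrow zero.\<close>
    have "ladder C ?y ?y (Idn C N) (Zero C X X)"
      using ladder_extends[OF y(1) y(1) _ y(3)] y(4) by simp
    then have Ky: "K (?S ?y)" using K[OF y(1) yl(1)] killsI[OF y(1) I] by blast
    show "vanish C i X N" unfolding vanish_def
    proof (intro allI impI, elim conjE)
      fix xs assume xs: "chain C N X xs" "length xs = i"
      have "K (?S xs)" using K_equiv[OF all[OF ext[OF y(1) yl(1)] ext[OF xs]]] Ky by blast
      then show "kills C X xs (Idn C N)" using K[OF xs] by blast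
    qed
  qed
qed

end

section \<open>Duality\<close>

context abelian_category
begin

text \<open>\<open>exact_pair\<close> compares kernels, its dual cokernels. They agree because
  \<open>c\<close>, being epic with kernel \<open>k\<close>, is a cokernel of \<open>k\<close>; the
  two witnesses trade places.\<close>

lemma exact_pair_opc: "exact_pair C f g \<Longrightarrow> exact_pair (opc C) g f"
  using is_kernel_epi_ses cokernel_is_epi unfolding exact_pair_def ses_def by auto metis

lemma extensions_opc:
  assumes "ds \<in> extensions C i X Y"
  shows "rev ds \<in> extensions (opc C) i Y X"
proof -
  have d: "length ds = Suc i" "is_mono C (ds ! 0)" "Dom C (ds ! 0) = Y" "is_epi C (ds ! i)"
    "Cod C (ds ! i) = X" "\<And>j. j < i \<Longrightarrow> exact_pair C (ds ! j) (ds ! Suc j)"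
    using assms by (auto simp: extensions_def)
  have "exact_pair (opc C) (rev ds ! j) (rev ds ! Suc j)" if "j < i" for j
  proof -
    have "rev ds ! j = ds ! (i - j)" "rev ds ! Suc j = ds ! (i - Suc j)" "Suc (i - Suc j) = i - j"
      using d(1) that by (auto simp: rev_nth)
    then show ?thesis using exact_pair_opc[OF d(6), of "i - Suc j"] that by simp
  qed
  then show ?thesis using d by (simp add: extensions_def rev_nth)
qed

lemma extension_morphism_opc:
  assumes "extension_morphism C i X Y ds es fs"
  shows "extension_morphism (opc C) i Y X (rev es) (rev ds) (rev fs)"
proof -
  have e: "ds \<in> extensions C i X Y" "es \<in> extensions C i X Y"
    and f: "length fs = Suc (Suc i)" "fs ! 0 = Idn C Y" "fs ! Suc i = Idn C X"
    "\<And>j. j \<le> i \<Longrightarrow> fs ! j \<in> Hom C (Dom C (ds ! j)) (Dom C (es ! j)) \<and>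
            fs ! Suc j \<in> Hom C (Cod C (ds ! j)) (Cod C (es ! j)) \<and>
            ds ! j \<cdot> fs ! Suc j = fs ! j \<cdot> es ! j"
    using assms by (auto simp: extension_morphism_def)
  have l: "length ds = Suc i" "length es = Suc i" using e by (auto simp: extensions_def)
  \<comment> \<open>The list \<open>fs\<close> is longer by one than the extensions, hence the
    shifted indices in its reversal.\<close>
  have "rev ds ! j = ds ! (i - j) \<and> rev es ! j = es ! (i - j) \<and> rev fs ! j = fs ! Suc (i - j) \<and>
    rev fs ! Suc j = fs ! (i - j)" if "j \<le> i" for j
    using f(1) l that by (auto simp: rev_nth Suc_diff_le)
  then show ?thesis
    using e[THEN extensions_opc] f l unfolding extension_morphism_def by (auto simp: rev_nth)
qed

text \<open>Reversal sends a morphism of extensions to one in the opposite direction, which the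
  equivalence closure does not see.\<close>

lemma Ext_vanishes_opc_imp:
  assumes "Ext_vanishes C i X Y"
  shows "Ext_vanishes (opc C) i Y X"
proof -
  interpret op: abelian_category "opc C" by (rule abelian_category_opc')
  have E: "rev ds \<in> extensions C i X Y" if "ds \<in> extensions (opc C) i Y X" for ds
    using op.extensions_opc[OF that] by simp
  have "equivclp (\<lambda>ds es. \<exists>fs. extension_morphism (opc C) i Y X ds es fs) (rev ds) (rev es)"
    if "equivclp (\<lambda>ds es. \<exists>fs. extension_morphism C i X Y ds es fs) ds es" for ds es
    using that
  proof (induction rule: equivclp_induct)
    case (step y z)
    then have "(\<exists>fs. extension_morphism (opc C) i Y X (rev y) (rev z) fs) \<or>
      (\<exists>fs. extension_morphism (opc C) i Y X (rev z) (rev y) fs)"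
      using extension_morphism_opc by blast
    then show ?case using step(3) by (metis (mono_tags, lifting) equivclp_into_equivclp)
  qed simp
  then have "equivclp (\<lambda>ds es. \<exists>fs. extension_morphism (opc C) i Y X ds es fs) ds es"
    if "ds \<in> extensions (opc C) i Y X" "es \<in> extensions (opc C) i Y X" for ds es
    using assms that E[OF that(1)] E[OF that(2)] unfolding Ext_vanishes_iff_equiv
    by (metis (no_types, lifting) rev_rev_ident)
  then show ?thesis using assms extensions_opc unfolding op.Ext_vanishes_iff_equiv Ext_vanishes_iff_equiv
    by blast
qed

lemma Ext_vanishes_opc [simp]: "Ext_vanishes (opc C) i Y X \<longleftrightarrow> Ext_vanishes C i X Y"
  using Ext_vanishes_opc_imp abelian_category.Ext_vanishes_opc_imp[OF abelian_category_opc', of i Y X]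
  by auto

lemma left_approximation_opc [simp]:
  "left_approximation (opc C) M X f \<longleftrightarrow> right_approximation C M X f"
  by (auto simp: left_approximation_def right_approximation_def)

lemma right_approximation_opc [simp]:
  "right_approximation (opc C) M X f \<longleftrightarrow> left_approximation C M X f"
  by (auto simp: left_approximation_def right_approximation_def)

lemma n_cluster_tilting_opc:
  assumes "n_cluster_tilting C n M"
  shows "n_cluster_tilting (opc C) n M"
proof -
  have "generating (opc C) M \<longleftrightarrow> cogenerating C M" "cogenerating (opc C) M \<longleftrightarrow> generating C M"
    "functorially_finite (opc C) M \<longleftrightarrow> functorially_finite C M"
    by (auto simp: generating_def cogenerating_def functorially_finite_def covariantly_finite_def
        contravariantly_finite_def)
  then show ?thesis using assms unfolding n_cluster_tilting_def by simp
qed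

end

section \<open>Full subcategories; sequences of arrows and their reversal\<close>

lemma full_subcat_sel [simp]:
  "Ob (full_subcat C M) = M" "Dom (full_subcat C M) = Dom C" "Cod (full_subcat C M) = Cod C"
  "Idn (full_subcat C M) = Idn C" "Comp (full_subcat C M) = Comp C" "Add (full_subcat C M) = Add C"
  "Zero (full_subcat C M) = Zero C"
  "f \<in> Arr (full_subcat C M) \<longleftrightarrow> f \<in> Arr C \<and> Dom C f \<in> M \<and> Cod C f \<in> M"
  by (auto simp: full_subcat_def)

lemma full_subcat_opc: "full_subcat (opc C) M = opc (full_subcat C M)"
  by (auto simp: full_subcat_def opc_def)

lemma Hom_full_subcat: "f \<in> Hom (full_subcat C M) X Y \<longleftrightarrow> f \<in> Hom C X Y \<and> X \<in> M \<and> Y \<in> M"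
  by (auto simp: Hom_def)

lemma Hom_full_subcat_eq [simp]: "X \<in> M \<Longrightarrow> Y \<in> M \<Longrightarrow> Hom (full_subcat C M) X Y = Hom C X Y"
  by (auto simp: Hom_full_subcat)

lemma arrow_seq_Cons:
  "arrow_seq C (d # ds) \<longleftrightarrow> d \<in> Arr C \<and> (ds \<noteq> [] \<longrightarrow> Cod C d = Dom C (hd ds) \<and> arrow_seq C ds)"
proof (cases ds)
  case (Cons d' ds')
  have "(\<forall>j. Suc j < Suc (length ds) \<longrightarrow> Cod C ((d # ds) ! j) = Dom C ((d # ds) ! Suc j)) \<longleftrightarrow>
    Cod C d = Dom C (ds ! 0) \<and> (\<forall>j. Suc j < length ds \<longrightarrow> Cod C (ds ! j) = Dom C (ds ! Suc j))"
    using Cons by (auto simp: nth_Cons split: nat.splits)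
  then show ?thesis using Cons by (auto simp: arrow_seq_def)
qed (simp add: arrow_seq_def)

lemma arrow_seq_opc:
  assumes "arrow_seq C ds"
  shows "arrow_seq (opc C) (rev ds)"
  unfolding arrow_seq_def
proof (intro conjI allI impI)
  fix j assume j: "j + 1 < length (rev ds)"
  have "rev ds ! j = ds ! Suc (length ds - Suc (Suc j))" "rev ds ! (j + 1) = ds ! (length ds - Suc (Suc j))"
    using j by (auto simp: rev_nth Suc_diff_Suc)
  then show "Cod (opc C) (rev ds ! j) = Dom (opc C) (rev ds ! (j + 1))"
    using assms j by (auto simp: arrow_seq_def)
qed (use assms in \<open>auto simp: arrow_seq_def\<close>)

lemma seq_objects_rev:
  assumes "arrow_seq C ds"
  shows "map (Dom C) ds @ [Cod C (last ds)] = seq_objects C ds"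
  using assms
proof (induction ds)
  case (Cons d ds)
  then show ?case by (cases "ds = []") (auto simp: arrow_seq_Cons seq_objects_def)
qed (simp add: arrow_seq_def)

lemma co_hom_exact_opc:
  assumes "arrow_seq C ds"
  shows "co_hom_exact C ds Y \<longleftrightarrow> contra_hom_exact (opc C) (rev ds) Y"
proof -
  have "rev (seq_objects C ds) = seq_objects (opc C) (rev ds)"
    unfolding seq_objects_rev[OF assms, symmetric]
    using assms by (simp add: seq_objects_def rev_map hd_rev arrow_seq_def)
  moreover have "last (rev ds) = hd ds" using assms by (simp add: last_rev arrow_seq_def)
  ultimately show ?thesis by (simp add: co_hom_exact_def contra_hom_exact_def)
qed

lemma n_kernel_opc: "n_kernel C n f ds \<longleftrightarrow> n_cokernel (opc C) n f (rev ds)"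
proof -
  have "arrow_seq (opc C) (f # rev ds) \<longleftrightarrow> arrow_seq C (ds @ [f])"
    using arrow_seq_opc[of C "ds @ [f]"] arrow_seq_opc[of "opc C" "f # rev ds"] by auto
  then show ?thesis using co_hom_exact_opc[of C "ds @ [f]"]
    by (auto simp: n_kernel_def n_cokernel_def)
qed

lemma is_complex_opc:
  assumes "is_complex C ds"
  shows "is_complex (opc C) (rev ds)"
  unfolding is_complex_def
proof (intro conjI allI impI)
  fix j assume j: "j + 1 < length (rev ds)"
  have "rev ds ! j = ds ! Suc (length ds - Suc (Suc j))" "rev ds ! (j + 1) = ds ! (length ds - Suc (Suc j))"
    using j by (auto simp: rev_nth Suc_diff_Suc)
  then show "rev ds ! j \<cdot>\<^bsub>opc C\<^esub> rev ds ! (j + 1) =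
      Zero (opc C) (Dom (opc C) (rev ds ! j)) (Cod (opc C) (rev ds ! (j + 1)))"
    using assms j by (auto simp: is_complex_def)
qed (use assms arrow_seq_opc in \<open>auto simp: is_complex_def\<close>)

lemma n_exact_opc:
  assumes "n_exact C n ds"
  shows "n_exact (opc C) n (rev ds)"
proof -
  have "ds \<noteq> []" using assms by (auto simp: n_exact_def)
  moreover have "butlast (rev ds) = rev (tl ds)" by (cases ds) auto
  moreover have "tl (rev ds) = rev (butlast ds)" by (cases ds rule: rev_cases) auto
  ultimately have "butlast (rev ds) = rev (tl ds)" "tl (rev ds) = rev (butlast ds)"
    "last (rev ds) = hd ds" "hd (rev ds) = last ds"
    by (simp_all add: last_rev hd_rev)
  then show ?thesis
    using assms is_complex_opc[of C ds] n_kernel_opc[of "opc C" n "hd ds" "rev (tl ds)"]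
      n_kernel_opc[of C n "last ds" "butlast ds"] by (simp add: n_exact_def)
qed

section \<open>Elementwise form of the exactness conditions\<close>

context preadditive_category
begin

lemma comp_hom:
  assumes "d \<in> Hom C X Z" "Y \<in> Ob C"
  shows "(\<lambda>g. d \<cdot> g) \<in> hom (hom_group C Z Y) (hom_group C X Y)"
  using assms Comp_Hom Comp_Add by (auto simp: hom_def)

text \<open>The final \<open>id\<close> is the inclusion of the zero subgroup, so exactness there is
  injectivity of composition with \<open>d\<close>.\<close>

lemma contra_hom_exact_single:
  assumes "d \<in> Arr C" "Y \<in> Ob C"
  shows "contra_hom_exact C [d] Y \<longleftrightarrow>
    (\<forall>g\<in>Hom C (Cod C d) Y. d \<cdot> g = Zero C (Dom C d) Y \<longrightarrow> g = Zero C (Cod C d) Y)"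
proof -
  interpret G: comm_group "hom_group C (Cod C d) Y" using hom_comm_group assms Cod_Ob by blast
  interpret H: comm_group "hom_group C (Dom C d) Y" using hom_comm_group assms Dom_Ob by blast
  have "group_hom (singleton_group (Zero C (Cod C d) Y)) (hom_group C (Cod C d) Y) id"
    using G.one_closed G.r_one[OF G.one_closed]
    by (intro group_hom.intro group_hom_axioms.intro singleton_group G.is_group)
      (auto simp: hom_def singleton_group_def)
  moreover have "(\<lambda>g. d \<cdot> g) \<in> hom (hom_group C (Cod C d) Y) (hom_group C (Dom C d) Y)"
    using comp_hom assms by (auto simp: Hom_def)
  ultimately show ?thesis
    using H.is_group assms Cod_Ob
    by (auto simp: contra_hom_exact_def seq_objects_def kernel_def singleton_group_def Zero_Hom)
qed

text \<open>\<open>exact_seq\<close> grows at the head of its lists, so prefixing \<open>d\<close>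
  adds just the condition at \<open>Hom C (Cod C d) Y\<close>.\<close>

lemma contra_hom_exact_Cons:
  assumes "arrow_seq C (d # d' # ds)" "Y \<in> Ob C"
  shows "contra_hom_exact C (d # d' # ds) Y \<longleftrightarrow>
    (\<forall>g\<in>Hom C (Cod C d) Y. d \<cdot> g = Zero C (Dom C d) Y \<longleftrightarrow> (\<exists>h\<in>Hom C (Cod C d') Y. g = d' \<cdot> h)) \<and>
    contra_hom_exact C (d' # ds) Y"
proof -
  have d: "d \<in> Hom C (Dom C d) (Dom C d')" "d' \<in> Hom C (Dom C d') (Cod C d')" "Cod C d = Dom C d'"
    using assms by (auto simp: arrow_seq_Cons Hom_def split: if_splits)
  interpret H: comm_group "hom_group C (Dom C d) Y"
    using hom_comm_group assms(2) Hom_arr[OF d(1)] by blast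
  have "(\<lambda>g. d \<cdot> g) \<in> hom (hom_group C (Dom C d') Y) (hom_group C (Dom C d) Y)"
    using comp_hom d assms by auto
  moreover have "kernel (hom_group C (Dom C d') Y) (hom_group C (Dom C d) Y) (\<lambda>g. d \<cdot> g) =
      (\<lambda>g. d' \<cdot> g) ` carrier (hom_group C (Cod C d') Y) \<longleftrightarrow>
    (\<forall>g\<in>Hom C (Cod C d) Y. d \<cdot> g = Zero C (Dom C d) Y \<longleftrightarrow> (\<exists>h\<in>Hom C (Cod C d') Y. g = d' \<cdot> h))"
    using d Comp_Hom[OF d(2)] by (auto simp: kernel_def set_eq_iff)
  ultimately show ?thesis
    using H.is_group d(3) by (auto simp: contra_hom_exact_def seq_objects_def)
qed

lemma contra_hom_exact_iff:
  assumes "arrow_seq C ds" "Y \<in> Ob C"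
  shows "contra_hom_exact C ds Y \<longleftrightarrow>
    (\<forall>j. Suc j < length ds \<longrightarrow> (\<forall>g\<in>Hom C (Cod C (ds ! j)) Y. ds ! j \<cdot> g = Zero C (Dom C (ds ! j)) Y \<longleftrightarrow>
      (\<exists>h\<in>Hom C (Cod C (ds ! Suc j)) Y. g = ds ! Suc j \<cdot> h))) \<and>
    (\<forall>g\<in>Hom C (Cod C (last ds)) Y. last ds \<cdot> g = Zero C (Dom C (last ds)) Y \<longrightarrow>
      g = Zero C (Cod C (last ds)) Y)"
  using assms(1)
proof (induction ds)
  case (Cons d ds)
  show ?case
  proof (cases ds)
    case Nil
    then show ?thesis using contra_hom_exact_single Cons.prems assms(2) by (auto simp: arrow_seq_def)
  next
    case (Cons d' ds')
    have s: "arrow_seq C ds" using Cons.prems Cons by (simp add: arrow_seq_Cons)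
    have *: "(\<forall>j. Suc j < length (d # ds) \<longrightarrow> P j) \<longleftrightarrow> P 0 \<and> (\<forall>j. Suc j < length ds \<longrightarrow> P (Suc j))" for P
      using Cons by (auto simp: gr0_conv_Suc less_Suc_eq_0_disj)
    show ?thesis
      using contra_hom_exact_Cons[of d d' ds' Y] Cons.prems assms(2) Cons.IH[OF s] Cons
      unfolding * by simp
  qed
qed (simp add: arrow_seq_def)

lemma preadditive_category_op: "preadditive_category (opc C)"
  by (rule preadditive_category_opc) unfold_locales

lemma co_hom_exact_iff:
  assumes "arrow_seq C ds" "Y \<in> Ob C"
  shows "co_hom_exact C ds Y \<longleftrightarrow>
    (\<forall>j. Suc j < length ds \<longrightarrow> (\<forall>g\<in>Hom C Y (Dom C (ds ! Suc j)). g \<cdot> ds ! Suc j = Zero C Y (Cod C (ds ! Suc j)) \<longleftrightarrow>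
      (\<exists>h\<in>Hom C Y (Dom C (ds ! j)). g = h \<cdot> ds ! j))) \<and>
    (\<forall>g\<in>Hom C Y (Dom C (hd ds)). g \<cdot> hd ds = Zero C Y (Cod C (hd ds)) \<longrightarrow> g = Zero C Y (Dom C (hd ds)))"
proof -
  \<comment> \<open>Reversal swaps consecutive arrows and sends index \<open>j\<close> to
    \<open>length ds - 2 - j\<close>, a bijection of the range.\<close>
  have *: "(\<forall>j. Suc j < length ds \<longrightarrow> P (rev ds ! j) (rev ds ! Suc j)) \<longleftrightarrow>
    (\<forall>j. Suc j < length ds \<longrightarrow> P (ds ! Suc j) (ds ! j))" for P
  proof -
    have "P (rev ds ! j) (rev ds ! Suc j) \<longleftrightarrow> P (ds ! Suc (length ds - Suc (Suc j))) (ds ! (length ds - Suc (Suc j)))"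
      if "Suc j < length ds" for j
      using that by (simp add: rev_nth Suc_diff_Suc)
    then have 1: "(\<forall>j. Suc j < length ds \<longrightarrow> P (rev ds ! j) (rev ds ! Suc j)) \<longleftrightarrow>
      (\<forall>j. Suc j < length ds \<longrightarrow> P (ds ! Suc (length ds - Suc (Suc j))) (ds ! (length ds - Suc (Suc j))))"
      by blast
    have "length ds - Suc (Suc (length ds - Suc (Suc j))) = j" "Suc (length ds - Suc (Suc j)) < length ds"
      if "Suc j < length ds" for j
      using that by auto
    then show ?thesis unfolding 1 by metis
  qed
  have "last (rev ds) = hd ds" using assms by (simp add: last_rev arrow_seq_def)
  then show ?thesis
    unfolding co_hom_exact_opc[OF assms(1)]
    using preadditive_category.contra_hom_exact_iff[OF preadditive_category_op arrow_seq_opc[OF assms(1)], of Y] assms(2)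
    using *[of "\<lambda>d d'. \<forall>g\<in>Hom C Y (Dom C d). g \<cdot> d = Zero C Y (Cod C d) \<longleftrightarrow> (\<exists>h\<in>Hom C Y (Dom C d'). g = h \<cdot> d')"]
    by simp
qed

end

section \<open>Cluster-tilting subcategories\<close>

text \<open>The hypotheses are self-dual, so cokernels and epimorphisms are treated here, and
  interpreting the locale at the opposite category gives the dual axioms.\<close>

locale n_ct_abelian = abelian_category C for C :: "('o, 'm) addcat" (structure) +
  fixes n :: nat and M :: "'o set"
  assumes nct: "n_cluster_tilting C n M"
begin

abbreviation sub :: "('o, 'm) addcat" where "sub \<equiv> full_subcat C M"

lemma M_Ob: "X \<in> M \<Longrightarrow> X \<in> Ob C"
  using nct by (auto simp: n_cluster_tilting_def)

lemma M_vanish: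
  assumes "X \<in> M" "N \<in> M" "1 \<le> i" "i \<le> n - 1"
  shows "vanish C i X N"
proof -
  have "M = {X \<in> Ob C. \<forall>i. 1 \<le> i \<and> i \<le> n - 1 \<longrightarrow> (\<forall>N\<in>M. Ext_vanishes C i X N)}"
    using nct unfolding n_cluster_tilting_def by blast
  then have "Ext_vanishes C i X N" using assms by blast
  then show ?thesis using Ext_vanishes_iff assms M_Ob by blast
qed

lemma M_memI:
  assumes "X \<in> Ob C" "\<And>i N. \<lbrakk>1 \<le> i; i \<le> n - 1; N \<in> M\<rbrakk> \<Longrightarrow> vanish C i X N"
  shows "X \<in> M"
proof -
  have "Ext_vanishes C i X N" if "1 \<le> i" "i \<le> n - 1" "N \<in> M" for i N
    using Ext_vanishes_iff assms M_Ob that by blast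
  moreover have "M = {X \<in> Ob C. \<forall>i. 1 \<le> i \<and> i \<le> n - 1 \<longrightarrow> (\<forall>N\<in>M. Ext_vanishes C i X N)}"
    using nct unfolding n_cluster_tilting_def by blast
  ultimately show ?thesis using assms(1) by blast
qed

lemma generatingE:
  assumes "X \<in> Ob C"
  obtains Y f where "Y \<in> M" "f \<in> Hom C Y X" "is_epi C f"
  using nct assms unfolding n_cluster_tilting_def generating_def by blast

lemma cogeneratingE:
  assumes "X \<in> Ob C"
  obtains Y f where "Y \<in> M" "f \<in> Hom C X Y" "is_mono C f"
  using nct assms unfolding n_cluster_tilting_def cogenerating_def by blast

text \<open>Since \<open>M\<close> is cogenerating, \<open>X\<close> embeds into an object of
  \<open>M\<close>; the embedding factors through the approximation, which is therefore
  monic.\<close>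

lemma left_approximationE:
  assumes "X \<in> Ob C"
  obtains Y l where "Y \<in> M" "l \<in> Hom C X Y" "is_mono C l"
    "\<And>Y' g. \<lbrakk>Y' \<in> M; g \<in> Hom C X Y'\<rbrakk> \<Longrightarrow> \<exists>h\<in>Hom C Y Y'. g = l \<cdot> h"
proof -
  obtain l where "left_approximation C M X l"
    using nct assms unfolding n_cluster_tilting_def functorially_finite_def covariantly_finite_def
    by blast
  then obtain Y where l: "Y \<in> M" "l \<in> Hom C X Y"
    "\<And>Y' g. \<lbrakk>Y' \<in> M; g \<in> Hom C X Y'\<rbrakk> \<Longrightarrow> \<exists>h\<in>Hom C Y Y'. g = l \<cdot> h"
    unfolding left_approximation_def by (auto simp: Hom_def)
  obtain I f where f: "I \<in> M" "f \<in> Hom C X I" "is_mono C f" using cogeneratingE assms by blast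
  obtain h where h: "h \<in> Hom C Y I" "f = l \<cdot> h" using l(3) f by blast
  have "is_mono C l" unfolding is_mono_iff
  proof (intro conjI allI ballI impI)
    fix W g assume g: "g \<in> Hom C W (Dom C l)" "g \<cdot> l = Zero C W (Cod C l)"
    note a = Hom_arr[OF g(1)] Hom_arr[OF l(2)] Hom_arr[OF h(1)]
    have "g \<cdot> f = (g \<cdot> l) \<cdot> h" using h(2) a by simp
    also have "\<dots> = Zero C W I" unfolding g(2) using a by simp
    finally show "g = Zero C W (Dom C l)"
      using f(3) g(1) a Hom_arr[OF f(2)] by (simp add: is_mono_iff)
  qed (use Hom_arr[OF l(2)] in simp)
  then show ?thesis using that l by blast
qed

section \<open>The additive structure of \<open>M\<close>\<close>

lemma retract_in_M:
  assumes "Y \<in> M" "s \<in> Hom C X Y" "r \<in> Hom C Y X" "s \<cdot> r = Idn C X"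
  shows "X \<in> M"
  using M_memI Hom_arr[OF assms(2)] vanish_retract[OF M_vanish[OF assms(1)] assms(2-4)] by blast

lemma sub_additive: "additive_category sub"
proof -
  have cat: "category sub"
    by unfold_locales (auto simp: Hom_full_subcat M_Ob Idn_Hom Comp_Hom Comp_assoc Idn_Comp Comp_Idn
        intro: Comp_assoc)
  have hg: "hom_group sub X Y = hom_group C X Y" if "X \<in> M" "Y \<in> M" for X Y
    using that by (simp add: hom_group_def)
  have pre: "preadditive_category sub"
    by (intro preadditive_category.intro cat preadditive_category_axioms.intro)
      (auto simp: hg hom_comm_group M_Ob Hom_full_subcat Comp_Add Add_Comp)
  have "\<exists>Z. zero_object sub Z"
  proof -
    obtain Z where Z: "zero_object C Z" using ex_zero_object by blast
    then have ZO: "Z \<in> Ob C" by (simp add: zero_object_def)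
    \<comment> \<open>\<open>M\<close> is nonempty because it is generating, and a zero object is a
      retract of any object.\<close>
    obtain Y f where "Y \<in> M" using generatingE[OF ZO] by blast
    have "Zero C Z Y \<cdot> Zero C Y Z \<in> Hom C Z Z" "Idn C Z \<in> Hom C Z Z"
      using Comp_Hom Zero_Hom ZO M_Ob[OF \<open>Y \<in> M\<close>] Idn_Hom by blast+
    then have "Zero C Z Y \<cdot> Zero C Y Z = Idn C Z" using Z ZO by (auto simp: zero_object_def)
    then have "Z \<in> M" using retract_in_M[OF \<open>Y \<in> M\<close>] Zero_Hom ZO M_Ob[OF \<open>Y \<in> M\<close>] by blast
    then have "zero_object sub Z" using Z M_Ob by (simp add: zero_object_def)
    then show ?thesis by blast
  qed
  moreover have "\<exists>P i1 i2 p1 p2. biproduct sub X Y P i1 i2 p1 p2" if "X \<in> M" "Y \<in> M" for X Y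
  proof -
    obtain P i1 i2 p1 p2 where b: "biproduct C X Y P i1 i2 p1 p2"
      using ex_biproduct M_Ob \<open>X \<in> M\<close> \<open>Y \<in> M\<close> by blast
    have "P \<in> Ob C" using b Hom_arr(5) unfolding biproduct_def by blast
    then have "P \<in> M" using M_memI vanish_biproduct[OF _ _ b] M_vanish that by blast
    then have "biproduct sub X Y P i1 i2 p1 p2" using b that by (simp add: biproduct_def)
    then show ?thesis by blast
  qed
  ultimately show ?thesis
    by (intro additive_category.intro pre additive_category_axioms.intro) simp_all
qed

text \<open>The kernel of \<open>1 - e\<close> splits \<open>e\<close>, and as a retract of
  \<open>X\<close> it lies in \<open>M\<close>.\<close>

lemma sub_idempotent_complete: "idempotent_complete sub"
  unfolding idempotent_complete_def
proof (intro ballI impI)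
  fix X e assume X: "X \<in> Ob sub" and e': "e \<in> Hom sub X X" "e \<cdot>\<^bsub>sub\<^esub> e = e"
  have XM: "X \<in> M" "X \<in> Ob C" and e: "e \<in> Hom C X X" "e \<cdot> e = e" using X e' M_Ob by auto
  note a = Hom_arr[OF e(1)]
  let ?d = "Add C (Idn C X) (Neg C e)"
  have d: "?d \<in> Arr C" "Dom C ?d = X" "Cod C ?d = X" using a by auto
  obtain k where k: "is_kernel C ?d k" using ex_kernel d by blast
  have b: "k \<in> Arr C" "Cod C k = X" "k \<cdot> ?d = Zero C (Dom C k) X" "Dom C k \<in> Ob C"
    using kernel_arr[OF k] d by auto
  have "e \<cdot> ?d = Zero C X X" using a e(2) by simp
  then obtain r where r: "r \<in> Hom C X (Dom C k)" "r \<cdot> k = e"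
    using kernel_lift[OF k, of e X] d e by auto
  note c = Hom_arr[OF r(1)]
  have "Add C k (Neg C (k \<cdot> e)) = Zero C (Dom C k) X" using b a by simp
  then have ke: "k = k \<cdot> e"
    using Add_Neg_eq_Zero[of k "Dom C k" X "k \<cdot> e"] a b by (simp add: Hom_def)
  have "(k \<cdot> r) \<cdot> k = k \<cdot> e" unfolding r(2)[symmetric] using b c by simp
  also have "\<dots> = Idn C (Dom C k) \<cdot> k" using ke b by simp
  finally have kr: "k \<cdot> r = Idn C (Dom C k)"
    using monoD[OF kernel_is_mono[OF k], of "k \<cdot> r" "Dom C k" "Idn C (Dom C k)"] b c
    by (simp add: Hom_def)
  have "Dom C k \<in> M" by (rule retract_in_M[OF XM(1) _ r(1) kr]) (use b in \<open>simp add: Hom_def\<close>)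
  then show "\<exists>Y\<in>Ob sub. \<exists>r\<in>Hom sub X Y. \<exists>s\<in>Hom sub Y X. r \<cdot>\<^bsub>sub\<^esub> s = e \<and> s \<cdot>\<^bsub>sub\<^esub> r = Idn sub Y"
    using r kr b XM by (intro bexI[of _ "Dom C k"] bexI[of _ r] bexI[of _ k]) (auto simp: Hom_def)
qed

interpretation sub: additive_category sub
  by (rule sub_additive)

section \<open>Existence of \<open>n\<close>-cokernels\<close>

text \<open>\<open>k\<close> counts the approximations still to be made;
  \<open>Ext^i(Cod C c, M)\<close> is known to vanish for \<open>i\<close> from one to
  \<open>n - 1 - k\<close>. Each step replaces \<open>f\<close> by \<open>c l\<close>, whose
  cokernel is that of \<open>l\<close>.\<close>

lemma n_cokernel_aux:
  assumes "k \<le> n - 1" "f \<in> Hom C X0 X1" "X0 \<in> M" "X1 \<in> M" "is_cokernel C f c"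
    "\<And>i N. \<lbrakk>1 \<le> i; i + k \<le> n - 1; N \<in> M\<rbrakk> \<Longrightarrow> vanish C i (Cod C c) N"
  shows "\<exists>ds. length ds = Suc k \<and> arrow_seq sub (f # ds) \<and> (\<forall>Y\<in>M. contra_hom_exact sub (f # ds) Y)"
  using assms
proof (induction k arbitrary: f X0 X1 c)
  case 0
  define L where "L = Cod C c"
  have c: "c \<in> Arr C" "Dom C c = X1" "Cod C c = L" "f \<cdot> c = Zero C X0 L" "L \<in> Ob C"
    using cokernel_arr[OF 0(5)] 0(2) by (auto simp: Hom_def L_def)
  note f = Hom_arr[OF 0(2)]
  \<comment> \<open>At \<open>k = 0\<close> all degrees up to \<open>n - 1\<close> are covered, so
    the cokernel lies in \<open>M\<close> and ends the sequence.\<close>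
  have L: "L \<in> M" using M_memI[OF c(5)] 0(6) c(3) by simp
  have s: "arrow_seq sub (f # [c])" using 0(2-4) c L f by (simp add: arrow_seq_Cons)
  have "contra_hom_exact sub [f, c] Y" if Y: "Y \<in> M" for Y
  proof -
    have YO: "Y \<in> Ob C" using M_Ob Y .
    have "f \<cdot> g = Zero C X0 Y \<longleftrightarrow> (\<exists>h\<in>Hom C L Y. g = c \<cdot> h)" if g: "g \<in> Hom C X1 Y" for g
    proof
      assume "f \<cdot> g = Zero C X0 Y"
      then show "\<exists>h\<in>Hom C L Y. g = c \<cdot> h"
        using cokernel_desc[OF 0(5), of g Y] g f c(3) by metis
    next
      assume "\<exists>h\<in>Hom C L Y. g = c \<cdot> h"
      then obtain h where h: "h \<in> Hom C L Y" "g = c \<cdot> h" by blast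
      have "f \<cdot> (c \<cdot> h) = (f \<cdot> c) \<cdot> h" using f c(1-3) Hom_arr[OF h(1)] by simp
      then show "f \<cdot> g = Zero C X0 Y" unfolding h(2) c(4) using Hom_arr[OF h(1)] f by simp
    qed
    moreover have "g = Zero C L Y" if g: "g \<in> Hom C L Y" "c \<cdot> g = Zero C X1 Y" for g
      using epiD[OF cokernel_is_epi[OF 0(5)], of g Y "Zero C L Y"] g c YO Zero_Hom by simp
    ultimately show ?thesis
      using sub.contra_hom_exact_Cons[OF s, of Y] sub.contra_hom_exact_single[of c Y] 0(3,4) Y f c L
      by simp
  qed
  then show ?case using s by (intro exI[of _ "[c]"]) simp
next
  case (Suc k)
  define L where "L = Cod C c"
  have c: "c \<in> Arr C" "Dom C c = X1" "Cod C c = L" "f \<cdot> c = Zero C X0 L" "L \<in> Ob C"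
    using cokernel_arr[OF Suc.prems(5)] Suc.prems(2) by (auto simp: Hom_def L_def)
  note f = Hom_arr[OF Suc.prems(2)]
  have epi_c: "is_epi C c" using cokernel_is_epi Suc.prems(5) .
  obtain X2 l where l: "X2 \<in> M" "l \<in> Hom C L X2" "is_mono C l"
    "\<And>Y' g. \<lbrakk>Y' \<in> M; g \<in> Hom C L Y'\<rbrakk> \<Longrightarrow> \<exists>h\<in>Hom C X2 Y'. g = l \<cdot> h"
    using left_approximationE[OF c(5)] by blast
  obtain c' where c': "ses C l c'" using mono_ses l by blast
  note al = Hom_arr[OF l(2)]
  have cl: "c \<cdot> l \<in> Hom C X1 X2" using c al by (simp add: Hom_def)
  have cok: "is_cokernel C (c \<cdot> l) c'"
    by (rule is_cokernel_epi_Comp[OF _ epi_c]) (use c' c al in \<open>simp_all add: ses_def\<close>)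
  \<comment> \<open>Degree one vanishes because \<open>l\<close> is an approximation; degree
    \<open>i\<close> above that comes from degree \<open>i - 1\<close> of the previous cokernel, so
    the bound grows by one.\<close>
  have V: "vanish C i (Cod C c') N" if i: "1 \<le> i" "i + k \<le> n - 1" and N: "N \<in> M" for i N
  proof (cases "i = 1")
    case True
    have "vanish C 1 (Cod C c') N"
    proof (rule vanish_shift_one[OF c'])
      show "vanish C 1 (Cod C l) N" using M_vanish l(1) N i al by simp
    qed (use l(4)[OF N] al in simp)
    then show ?thesis using True by simp
  next
    case False
    then obtain i' where i': "i = Suc i'" "1 \<le> i'" using i by (cases i) auto
    have "vanish C (Suc i') (Cod C c') N"
    proof (rule vanish_shift[OF c' i'(2)])
      show "vanish C i' (Dom C l) N" using Suc.prems(6)[of i' N] i' i N al c(3) by simp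
      show "vanish C (Suc i') (Cod C l) N" using M_vanish l(1) N i i' al by simp
    qed
    then show ?thesis using i' by simp
  qed
  have k: "k \<le> n - 1" using Suc.prems(1) by simp
  obtain ds where ds: "length ds = Suc k" "arrow_seq sub ((c \<cdot> l) # ds)"
    "\<And>Y. Y \<in> M \<Longrightarrow> contra_hom_exact sub ((c \<cdot> l) # ds) Y"
    using Suc.IH[OF k cl Suc.prems(4) l(1) cok V] by blast
  have s: "arrow_seq sub (f # (c \<cdot> l) # ds)"
    using ds(2) f Suc.prems(3,4) Hom_arr[OF cl] by (simp add: arrow_seq_Cons)
  have "contra_hom_exact sub (f # (c \<cdot> l) # ds) Y" if Y: "Y \<in> M" for Y
  proof -
    have "f \<cdot> g = Zero C X0 Y \<longleftrightarrow> (\<exists>h\<in>Hom C X2 Y. g = (c \<cdot> l) \<cdot> h)" if g: "g \<in> Hom C X1 Y" for g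
    proof
      assume "f \<cdot> g = Zero C X0 Y"
      then obtain h where h: "h \<in> Hom C L Y" "c \<cdot> h = g"
        using cokernel_desc[OF Suc.prems(5), of g Y] g f c(3) by metis
      then obtain h' where h': "h' \<in> Hom C X2 Y" "h = l \<cdot> h'" using l(4) Y by blast
      have "g = (c \<cdot> l) \<cdot> h'" using h(2)[symmetric] h'(2) c al Hom_arr[OF h'(1)] by simp
      then show "\<exists>h\<in>Hom C X2 Y. g = (c \<cdot> l) \<cdot> h" using h' by blast
    next
      assume "\<exists>h\<in>Hom C X2 Y. g = (c \<cdot> l) \<cdot> h"
      then obtain h where h: "h \<in> Hom C X2 Y" "g = (c \<cdot> l) \<cdot> h" by blast
      have "f \<cdot> ((c \<cdot> l) \<cdot> h) = (f \<cdot> c) \<cdot> (l \<cdot> h)" using f c(1-3) al Hom_arr[OF h(1)] by simp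
      then show "f \<cdot> g = Zero C X0 Y" unfolding h(2) c(4) using Hom_arr[OF h(1)] f al by simp
    qed
    then show ?thesis
      using sub.contra_hom_exact_Cons[OF s, of Y] ds(3)[OF Y] Suc.prems(3,4) Y f Hom_arr[OF cl] l(1)
      by simp
  qed
  then show ?case using ds(1) s by (intro exI[of _ "(c \<cdot> l) # ds"]) simp
qed

lemma ex_n_cokernel:
  assumes n: "n \<ge> 1" and f: "f \<in> Arr sub"
  shows "\<exists>ds. n_cokernel sub n f ds"
proof -
  have fA: "f \<in> Arr C" "Dom C f \<in> M" "Cod C f \<in> M" using f by auto
  obtain c where c: "is_cokernel C f c" using ex_cokernel fA by blast
  \<comment> \<open>For \<open>k = n - 1\<close> the vanishing condition is vacuous.\<close>
  obtain ds where "length ds = Suc (n - 1)" "arrow_seq sub (f # ds)"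
    "\<forall>Y\<in>M. contra_hom_exact sub (f # ds) Y"
    using n_cokernel_aux[of "n - 1" f "Dom C f" "Cod C f" c] fA c by (auto simp: Hom_def)
  then show ?thesis using n by (intro exI[of _ ds]) (simp add: n_cokernel_def)
qed

section \<open>Exactness of \<open>n\<close>-kernels of epimorphisms\<close>

text \<open>Induction from the far end: \<open>kills_butlast\<close> strips the last short exact
  sequence until \<open>kills_extends\<close> applies. It needs \<open>Ext\<close> of a middle term
  in one degree less than the current length, hence the bound \<open>n\<close>.\<close>

lemma extend_along_chain:
  assumes "chain C N X xs" "xs \<noteq> []" "T \<in> M" "t \<in> Hom C N T" "kills C X xs t" "length xs \<le> n"
    "\<forall>x\<in>set xs. Cod C (fst x) \<in> M"
  shows "\<exists>s\<in>Hom C (Cod C (fst (hd xs))) T. fst (hd xs) \<cdot> s = t"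
  using assms
proof (induction xs arbitrary: X rule: rev_induct)
  case (snoc x xs)
  obtain m e where x: "x = (m, e)" by (cases x)
  have s: "chain C N (Dom C m) xs" "ses C m e" "Cod C e = X" using snoc.prems(1) x by (auto simp: chain_append)
  show ?case
  proof (cases "xs = []")
    case True
    then show ?thesis
      using kills_extends[OF s(2), of t T] snoc.prems(4,5) s x by auto
  next
    case False
    have "1 \<le> length xs" using False by (simp add: Suc_le_eq)
    then have "vanish C (length xs) (Cod C m) T"
      using M_vanish[of "Cod C m" T "length xs"] snoc.prems x by simp
    then have "kills C (Dom C m) xs t"
      using kills_butlast[OF s(1) False s(2) refl snoc.prems(4)] snoc.prems(5) s(3) x by simp
    then show ?thesis using snoc.IH[OF s(1) False snoc.prems(3,4)] snoc.prems(6,7) False by simp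
  qed
qed simp

lemma is_kernel_mono_cancel:
  assumes "is_kernel C (e \<cdot> k) m" "is_mono C k" "e \<in> Arr C" "Cod C e = Dom C k"
  shows "is_kernel C e m"
  unfolding is_kernel_def
proof (intro conjI ballI impI)
  have kA: "k \<in> Arr C" using assms(2) by (simp add: is_mono_def)
  note a = kernel_arr[OF assms(1)]
  show me: "m \<in> Arr C" "e \<in> Arr C" "Cod C m = Dom C e" using a assms kA by simp_all
  have "m \<cdot> e \<cdot> k = Zero C (Dom C m) (Cod C e) \<cdot> k" using a me kA assms(4) by simp
  then show "m \<cdot> e = Zero C (Dom C m) (Cod C e)"
    using monoD[OF assms(2), of "m \<cdot> e" "Dom C m" "Zero C (Dom C m) (Cod C e)"] a me assms(4) Dom_Ob[OF kA]
    by (simp add: Hom_def)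
  fix W g assume W: "W \<in> Ob C" and g: "g \<in> Hom C W (Dom C e)" "g \<cdot> e = Zero C W (Cod C e)"
  have "g \<cdot> (e \<cdot> k) = (g \<cdot> e) \<cdot> k" using Hom_arr[OF g(1)] me kA assms(4) by simp
  also have "\<dots> = Zero C W (Cod C k)" unfolding g(2) using W kA assms(4) by simp
  finally have "g \<cdot> (e \<cdot> k) = Zero C W (Cod C (e \<cdot> k))" using me kA assms(4) by simp
  then show "\<exists>!h. h \<in> Hom C W (Dom C m) \<and> h \<cdot> m = g"
    using assms(1) W g(1) me kA assms(4) unfolding is_kernel_def by simp
qed

lemma epi_n_kernel_is_n_exact:
  assumes n: "n \<ge> 1" and g: "is_epi sub g" and ker: "n_kernel sub n g ds"
  shows "n_exact sub n (ds @ [g])"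
proof -
  define es where "es = ds @ [g]"
  have len: "length es = Suc n" and seq: "arrow_seq sub es" using ker by (auto simp: n_kernel_def es_def)
  have co: "co_hom_exact sub es Y" if "Y \<in> M" for Y using ker that by (simp add: n_kernel_def es_def)
  define d where "d j = es ! j" for j
  \<comment> \<open>The case split adds the codomain of the last arrow as object number
    \<open>n + 1\<close>.\<close>
  define X where "X j = (if j \<le> n then Dom C (d j) else Cod C (d n))" for j
  have dn: "d n = g" using ker by (auto simp: d_def es_def n_kernel_def nth_append)
  have dH: "d j \<in> Hom C (X j) (X (Suc j))" "X j \<in> M" "X (Suc j) \<in> M" if "j \<le> n" for j
  proof -
    have 1: "d j \<in> Arr sub" using seq len that unfolding arrow_seq_def d_def
      by (metis le_imp_less_Suc nth_mem subsetD)
    have "Cod C (d j) = Dom C (d (Suc j))" if "j < n"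
      using seq len that unfolding arrow_seq_def d_def by auto
    then have "X (Suc j) = Cod C (d j)" using that by (cases "j = n") (auto simp: X_def)
    then show "d j \<in> Hom C (X j) (X (Suc j))" "X j \<in> M" "X (Suc j) \<in> M"
      using 1 that by (auto simp: X_def Hom_def)
  qed
  note dA = dH(1)[THEN Hom_arr(1)] dH(1)[THEN Hom_arr(2)] dH(1)[THEN Hom_arr(3)]
  have co_iff: "y \<cdot> d (Suc j) = Zero C Y (X (Suc (Suc j))) \<longleftrightarrow> (\<exists>h\<in>Hom C Y (X j). y = h \<cdot> d j)"
    if "j < n" "Y \<in> M" "y \<in> Hom C Y (X (Suc j))" for j Y y
  proof -
    have "\<forall>g\<in>Hom sub Y (Dom C (d (Suc j))). g \<cdot> d (Suc j) = Zero C Y (Cod C (d (Suc j))) \<longleftrightarrow>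
      (\<exists>h\<in>Hom sub Y (Dom C (d j)). g = h \<cdot> d j)"
      using co[OF that(2)] sub.co_hom_exact_iff[OF seq, of Y] that(1,2) len by (simp add: d_def)
    then show ?thesis
      using that dA[of j] dA[of "Suc j"] dH(2,3)[of j] dH(3)[of "Suc j"] by simp
  qed
  \<comment> \<open>Exactness is tested on the identity of \<open>X j\<close>.\<close>
  have dd: "d j \<cdot> d (Suc j) = Zero C (X j) (X (Suc (Suc j)))" if "j < n" for j
  proof -
    have "d j = Idn C (X j) \<cdot> d j" "Idn C (X j) \<in> Hom C (X j) (X j)"
      using dA[of j] dH(2)[of j] that M_Ob Idn_Hom by auto
    then show ?thesis using co_iff[OF that, of "X j" "d j"] dH[of j] that by auto
  qed
  \<comment> \<open>An epimorphism of \<open>M\<close> is epic in the whole category: every test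
    target \<open>W\<close> embeds into an object of \<open>M\<close>.\<close>
  have epi_g: "is_epi C g" unfolding is_epi_def
  proof (intro conjI ballI impI)
    show gA: "g \<in> Arr C" using dA(1)[of n] dn by simp
    fix W x y assume W: "W \<in> Ob C" and xy: "x \<in> Hom C (Cod C g) W" "y \<in> Hom C (Cod C g) W" "g \<cdot> x = g \<cdot> y"
    obtain I m where m: "I \<in> M" "m \<in> Hom C W I" "is_mono C m" using cogeneratingE[OF W] .
    note a = gA Hom_arr[OF xy(1)] Hom_arr[OF xy(2)] Hom_arr[OF m(2)]
    have "g \<cdot> (x \<cdot> m) = (g \<cdot> x) \<cdot> m" using a by simp
    also have "\<dots> = g \<cdot> (y \<cdot> m)" unfolding xy(3) using a by simp
    finally have *: "g \<cdot> (x \<cdot> m) = g \<cdot> (y \<cdot> m)" .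
    have "Cod C g \<in> M" using dH(3)[of n] dA(3)[of n] dn by simp
    then have "x \<cdot> m \<in> Hom sub (Cod sub g) I" "y \<cdot> m \<in> Hom sub (Cod sub g) I"
      using a m(1) by (auto simp: Hom_def)
    then have "x \<cdot> m = y \<cdot> m" using g * m(1) unfolding is_epi_def by auto
    then show "x = y" using monoD[OF m(3), of x "Cod C g" y] xy a by simp
  qed
  have "\<exists>k. is_kernel C (d j) k" if "j \<le> n" for j using ex_kernel dA(1)[OF that] by blast
  then obtain k where k: "\<And>j. j \<le> n \<Longrightarrow> is_kernel C (d j) (k j)" by metis
  \<comment> \<open>\<open>K j\<close> is the kernel of \<open>d j\<close>; the last object serves
    as \<open>K (Suc n)\<close>, so that \<open>e n = d n\<close> fits the pattern.\<close>
  define K where "K j = (if j \<le> n then Dom C (k j) else X (Suc n))" for j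
  have kH: "k j \<in> Hom C (K j) (X j)" if "j \<le> n" for j
    using kernel_arr[OF k[OF that]] dA(2)[OF that] that by (auto simp: Hom_def K_def)
  note kA = kH[THEN Hom_arr(1)] kH[THEN Hom_arr(2)] kH[THEN Hom_arr(3)]
  have "\<exists>e. e \<in> Hom C (X j) (K (Suc j)) \<and> is_epi C e \<and> is_kernel C e (k j) \<and>
    (if j = n then e = d j else e \<cdot> k (Suc j) = d j)" if j: "j \<le> n" for j
  proof (cases "j = n")
    case True
    then show ?thesis using epi_g dn dH(1)[of n] k[of n] by (auto simp: K_def)
  next
    case False
    then have j': "Suc j \<le> n" "j < n" using j by auto
    obtain e where e: "e \<in> Hom C (X j) (K (Suc j))" "e \<cdot> k (Suc j) = d j"
      using kernel_lift[OF k[OF j'(1)], of "d j" "X j"] dH(1)[OF j] dA[OF j'(1)] dd[OF j'(2)] j'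
      by (auto simp: K_def)
    note ae = Hom_arr[OF e(1)]
    \<comment> \<open>Exactness is known only for test objects in \<open>M\<close>, so
      \<open>K (Suc j)\<close> is covered by some \<open>p\<close> from \<open>M\<close>. Then
      \<open>p\<close> factors through \<open>e\<close>, which is therefore epic.\<close>
    obtain Y p where p: "Y \<in> M" "p \<in> Hom C Y (K (Suc j))" "is_epi C p" using generatingE ae by metis
    note ap = Hom_arr[OF p(2)]
    have kd: "k (Suc j) \<cdot> d (Suc j) = Zero C (K (Suc j)) (X (Suc (Suc j)))"
      using kernel_arr(4)[OF k[OF j'(1)]] kA[OF j'(1)] dA[OF j'(1)] by simp
    have "p \<cdot> k (Suc j) \<cdot> d (Suc j) = p \<cdot> (k (Suc j) \<cdot> d (Suc j))"
      using ap kA[OF j'(1)] dA[OF j'(1)] by simp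
    also have "\<dots> = Zero C Y (X (Suc (Suc j)))"
      unfolding kd using ap M_Ob[OF dH(3)[OF j'(1)]] by simp
    finally obtain h where h: "h \<in> Hom C Y (X j)" "p \<cdot> k (Suc j) = h \<cdot> d j"
      using co_iff[OF j'(2) p(1), of "p \<cdot> k (Suc j)"] Comp_Hom[OF p(2) kH[OF j'(1)]] by blast
    note ah = Hom_arr[OF h(1)]
    have "p \<cdot> k (Suc j) = (h \<cdot> e) \<cdot> k (Suc j)"
      unfolding h(2) e(2)[symmetric] using ah ae kA[OF j'(1)] by simp
    then have phe: "p = h \<cdot> e"
      using monoD[OF kernel_is_mono[OF k[OF j'(1)]], of p Y "h \<cdot> e"] p(2) Comp_Hom[OF h(1) e(1)]
        kA[OF j'(1)] by simp
    have "is_epi C e" unfolding is_epi_def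
    proof (intro conjI ballI impI)
      fix W x y assume W: "W \<in> Ob C" and xy: "x \<in> Hom C (Cod C e) W" "y \<in> Hom C (Cod C e) W" "e \<cdot> x = e \<cdot> y"
      have "p \<cdot> x = h \<cdot> (e \<cdot> x)" unfolding phe using ah ae Hom_arr[OF xy(1)] by simp
      also have "\<dots> = p \<cdot> y" unfolding xy(3) phe using ah ae Hom_arr[OF xy(2)] by simp
      finally show "x = y" using epiD[OF p(3), of x W y] xy(1,2) ae ap by simp
    qed (use ae in simp)
    moreover have "is_kernel C e (k j)"
      by (rule is_kernel_mono_cancel[OF _ kernel_is_mono[OF k[OF j'(1)]]])
        (use k[OF j] e ae kA[OF j'(1)] in simp_all)
    ultimately show ?thesis using e False by auto
  qed
  then have "\<forall>j. \<exists>e. j \<le> n \<longrightarrow> e \<in> Hom C (X j) (K (Suc j)) \<and> is_epi C e \<and> is_kernel C e (k j) \<and>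
    (if j = n then e = d j else e \<cdot> k (Suc j) = d j)" by blast
  from choice[OF this] obtain e where E: "\<forall>j. j \<le> n \<longrightarrow> e j \<in> Hom C (X j) (K (Suc j)) \<and>
    is_epi C (e j) \<and> is_kernel C (e j) (k j) \<and> (if j = n then e j = d j else e j \<cdot> k (Suc j) = d j)" ..
  have e: "\<And>j. j \<le> n \<Longrightarrow> e j \<in> Hom C (X j) (K (Suc j))"
    "\<And>j. j \<le> n \<Longrightarrow> is_epi C (e j)" "\<And>j. j \<le> n \<Longrightarrow> is_kernel C (e j) (k j)"
    "e n = d n" "\<And>j. j < n \<Longrightarrow> e j \<cdot> k (Suc j) = d j"
    using E by auto
  note eA = e(1)[THEN Hom_arr(1)] e(1)[THEN Hom_arr(2)] e(1)[THEN Hom_arr(3)]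
  have ses: "ses C (k j) (e j)" if "j \<le> n" for j using is_kernel_epi_ses e that by blast
  have ch: "chain C (K (Suc n - i)) (X (Suc n)) (map (\<lambda>j. (k j, e j)) [Suc n - i..<Suc n])" if "i \<le> Suc n" for i
    using that
  proof (induction i)
    case 0
    then show ?case using M_Ob[OF dH(3)[of n]] by (simp add: K_def)
  next
    case (Suc i)
    have "[Suc n - Suc i..<Suc n] = (n - i) # [Suc n - i..<Suc n]"
      using Suc.prems by (metis Suc_diff_le diff_Suc_Suc diff_le_self le_imp_less_Suc not_less_eq_eq upt_conv_Cons)
    then show ?case
      using Suc ses[of "n - i"] kA(2)[of "n - i"] eA(3)[of "n - i"] by (simp add: Suc_diff_le)
  qed
  \<comment> \<open>As \<open>d j\<close> followed by \<open>y\<close> is zero, \<open>y\<close>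
    descends to a map \<open>f\<close> on the image \<open>K (Suc (Suc j))\<close> of
    \<open>d (Suc j)\<close>. It remains to extend \<open>f\<close> along the inclusion of that
    image.\<close>
  have exact: "\<exists>h\<in>Hom C (X (Suc (Suc j))) Y. y = d (Suc j) \<cdot> h"
    if j: "j < n" and Y: "Y \<in> M" and y: "y \<in> Hom C (X (Suc j)) Y" "d j \<cdot> y = Zero C (X j) Y" for j Y y
  proof -
    have j': "j \<le> n" "Suc j \<le> n" using j by auto
    note ay = Hom_arr[OF y(1)]
    have "e j \<cdot> (k (Suc j) \<cdot> y) = (e j \<cdot> k (Suc j)) \<cdot> y" using ay kA[OF j'(2)] eA[OF j'(1)] by simp
    also have "\<dots> = e j \<cdot> Zero C (K (Suc j)) Y"
      unfolding e(5)[OF j] y(2) using eA[OF j'(1)] ay by simp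
    finally have "k (Suc j) \<cdot> y = Zero C (K (Suc j)) Y"
      using epiD[OF e(2)[OF j'(1)], of "k (Suc j) \<cdot> y" Y "Zero C (K (Suc j)) Y"] eA[OF j'(1)]
        kA[OF j'(2)] ay Hom_arr(4)[OF kH[OF j'(2)]] by (simp add: Hom_def)
    then obtain f where f: "f \<in> Hom C (K (Suc (Suc j))) Y" "e (Suc j) \<cdot> f = y"
      using ses_desc[OF ses[OF j'(2)], of y Y] y(1) kA[OF j'(2)] eA[OF j'(2)] by auto
    show ?thesis
    proof (cases "Suc j = n")
      case True
      then show ?thesis using f e(4) by (auto simp: K_def)
    next
      case False
      then have j2: "Suc (Suc j) \<le> n" "Suc j < n" using j' by auto
      let ?xs = "map (\<lambda>j. (k j, e j)) [Suc (Suc j)..<Suc n]"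
      have c: "chain C (K (Suc (Suc j))) (X (Suc n)) ?xs" using ch[of "n - Suc j"] j2 by (simp add: Suc_diff_le)
      have ne: "?xs \<noteq> []" using j2 by simp
      have hd: "fst (hd ?xs) = k (Suc (Suc j))" using j2 by (subst upt_conv_Cons) auto
      have len_le: "length ?xs \<le> n" using j2 by simp
      have M: "\<forall>x\<in>set ?xs. Cod C (fst x) \<in> M" using kA(3) dH(2) by auto
      \<comment> \<open>The chain has length \<open>n - 1 - j\<close>, which lies between one and
        \<open>n - 1\<close>, so the obstruction to extending \<open>f\<close> starts in a vanishing
        \<open>Ext\<close> group.\<close>
      have "vanish C (length ?xs) (X (Suc n)) Y"
        by (rule M_vanish[OF dH(3)[of n] Y]) (use j2 in auto)
      then have "kills C (X (Suc n)) ?xs f"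
        by (rule vanish_kills[OF _ c refl _ f(1)]) (use j2 in auto)
      then obtain s where s: "s \<in> Hom C (X (Suc (Suc j))) Y" "k (Suc (Suc j)) \<cdot> s = f"
        using extend_along_chain[OF c ne Y f(1) _ len_le M] kA(3)[OF j2(1)] unfolding hd by auto
      have "y = (e (Suc j) \<cdot> k (Suc (Suc j))) \<cdot> s"
        unfolding f(2)[symmetric] s(2)[symmetric] using Hom_arr[OF s(1)] eA[OF j'(2)] kA[OF j2(1)] by simp
      then show ?thesis unfolding e(5)[OF j2(2)] using s(1) by blast
    qed
  qed
  have "contra_hom_exact sub es Y" if Y: "Y \<in> M" for Y
  proof -
    have YO: "Y \<in> Ob C" using M_Ob Y .
    have 1: "d j \<cdot> y = Zero C (X j) Y \<longleftrightarrow> (\<exists>h\<in>Hom C (X (Suc (Suc j))) Y. y = d (Suc j) \<cdot> h)"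
      if j: "j < n" and y: "y \<in> Hom C (X (Suc j)) Y" for j y
    proof
      assume "\<exists>h\<in>Hom C (X (Suc (Suc j))) Y. y = d (Suc j) \<cdot> h"
      then obtain h where h: "h \<in> Hom C (X (Suc (Suc j))) Y" "y = d (Suc j) \<cdot> h" by blast
      have "d j \<cdot> (d (Suc j) \<cdot> h) = (d j \<cdot> d (Suc j)) \<cdot> h"
        using dA[of j] dA[of "Suc j"] j Hom_arr[OF h(1)] by simp
      then show "d j \<cdot> y = Zero C (X j) Y"
        unfolding h(2) dd[OF j] using Hom_arr[OF h(1)] M_Ob[OF dH(2)[of j]] j by simp
    qed (use exact j Y y in blast)
    have 2: "y = Zero C (X (Suc n)) Y" if "y \<in> Hom C (X (Suc n)) Y" "d n \<cdot> y = Zero C (X n) Y" for y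
      using epiD[OF epi_g, of y Y "Zero C (X (Suc n)) Y"] that dn dA[of n] YO M_Ob[OF dH(3)[of n]] Zero_Hom
      by simp
    have "last es = d n" using dn by (simp add: es_def)
    then show ?thesis
      unfolding sub.contra_hom_exact_iff[OF seq, of Y, simplified, OF Y] len
      using 1 2 dA dH(2,3) Y by (auto simp: d_def[symmetric])
  qed
  then have "n_cokernel sub n (hd es) (tl es)"
    using seq len by (cases es) (auto simp: n_cokernel_def)
  moreover have "is_complex sub es" unfolding is_complex_def using seq dd len dA
    by (auto simp: d_def[symmetric])
  ultimately show ?thesis using ker len by (simp add: n_exact_def es_def)
qed

end

theorem theorem3p16:
  fixes A :: "('o, 'm) addcat" and M :: "'o set" and n :: nat
  assumes "n \<ge> 1"
    and "abelian_category A"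
    and "n_cluster_tilting A n M"
  shows "n_abelian_category (full_subcat A M) n"
proof -
  interpret abelian_category A by fact
  interpret n_ct_abelian A n M by unfold_locales fact
  \<comment> \<open>The opposite copy supplies the \<open>n\<close>-kernels and the axiom on
    monomorphisms.\<close>
  interpret op: n_ct_abelian "opc A" n M
    using abelian_category_opc' n_cluster_tilting_opc[OF assms(3)]
    by (simp add: n_ct_abelian_def n_ct_abelian_axioms_def)
  note op = full_subcat_opc[of A M]
  show ?thesis
  proof (intro n_abelian_category.intro sub_additive n_abelian_category_axioms.intro)
    show "idempotent_complete sub" by (rule sub_idempotent_complete)
    show "\<exists>ds. n_cokernel sub n f ds" if "f \<in> Arr sub" for f
      using ex_n_cokernel[OF assms(1) that] .
    show "\<exists>ds. n_kernel sub n f ds" if "f \<in> Arr sub" for f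
    proof -
      have "f \<in> Arr op.sub" using that by auto
      then obtain ds where "n_cokernel op.sub n f ds" using op.ex_n_cokernel[OF assms(1)] by blast
      then show ?thesis by (auto simp: op n_kernel_opc intro!: exI[of _ "rev ds"])
    qed
    show "n_exact sub n (ds @ [g])" if "is_epi sub g" "n_kernel sub n g ds" for g ds
      using epi_n_kernel_is_n_exact[OF assms(1) that] .
    show "n_exact sub n (f # ds)" if "is_mono sub f" "n_cokernel sub n f ds" for f ds
    proof -
      have "n_kernel op.sub n f (rev ds)" "is_epi op.sub f"
        using that by (simp_all add: op n_kernel_opc)
      then have "n_exact op.sub n (rev ds @ [f])" using op.epi_n_kernel_is_n_exact[OF assms(1)] by blast
      then show ?thesis using n_exact_opc[of "op.sub" n "rev ds @ [f]"] by (simp add: op)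
    qed
  qed
qed

end
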